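(* Let $\mathcal{X}$ be a separable (real) Hilbert space with orthonormal basis $\{\phi_1,\phi_2,\ldots\}$, let $\mu$ be a probability distribution on $\mathcal{X}$, let $\mathbf{X}\sim\mu$ and let $\mathbf{X}_1,\mathbf{X}_2,\ldots$ be i.i.d. with distribution $\mu$, and let $\mathbf{u}\in\mathcal{X}$ with $\|\mathbf{u}\|<1$. Suppose that $\mu$ is nonatomic and not entirely supported on a line in $\mathcal{X}$, and that $\sup_{\mathbf{Q}\in\mathcal{Z}_n,\|\mathbf{Q}\|\le C}E\{\|\mathbf{Q}-\mathbf{X}^{(n)}\|^{-2}\}<\infty$ for each $C>0$ and all appropriately large $n$. If for some $\alpha\in(0,1/2]$, $d(n)/n^{1-2\alpha}$ tends to a positive constant as $n\to\infty$, then the following Bahadur-type asymptotic linear representation holds: $$\widehat{\mathbf{Q}}(\mathbf{u})-\mathbf{Q}_n(\mathbf{u})=-\frac1n\sum_{i=1}^n[\widetilde{J}_{n,\mathbf{Q}_n(\mathbf{u})}]^{-1}\left(\frac{\mathbf{Q}_n(\mathbf{u})-\mathbf{X}_i^{(n)}}{\|\mathbf{Q}_n(\mathbf{u})-\mathbf{X}_i^{(n)}\|}-\mathbf{u}^{(n)}\right)+\mathbf{R}_n,$$ where $\|\mathbf{R}_n\|=O((\ln n)/n^{2\alpha})$ as $n\to\infty$ almost surely.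
   Context: $d(n)$ is a positive integer depending on $n$; $\mathcal{Z}_n=\mathrm{span}\{\phi_1,\ldots,\phi_{d(n)}\}$; for $\mathbf{z}\in\mathcal{X}$, $\mathbf{z}^{(n)}$ is the orthogonal projection of $\mathbf{z}$ onto $\mathcal{Z}_n$ (so $\mathbf{u}^{(n)},\mathbf{X}^{(n)},\mathbf{X}_i^{(n)}$ are projections). $\mathcal{X}^*$ is identified with $\mathcal{X}$, so $\mathbf{u}(\mathbf{Q})=\langle\mathbf{u},\mathbf{Q}\rangle$. A line through $\mathbf{x}_1,\mathbf{x}_2$ is $\{a\mathbf{x}_1+(1-a)\mathbf{x}_2:a\in\mathbb{R}\}$. Nonatomic means every singleton has measure zero. The sample spatial $\mathbf{u}$-quantile $\widehat{\mathbf{Q}}(\mathbf{u})$ is the minimizer over $\mathbf{Q}\in\mathcal{Z}_n$ of $n^{-1}\sum_{i=1}^n\{\|\mathbf{Q}-\mathbf{X}_i^{(n)}\|-\|\mathbf{X}_i^{(n)}\|\}-\mathbf{u}^{(n)}(\mathbf{Q})$. Put $g_n(\mathbf{Q})=E\{\|\mathbf{Q}-\mathbf{X}^{(n)}\|-\|\mathbf{X}^{(n)}\|\}-\mathbf{u}^{(n)}(\mathbf{Q})$ for $\mathbf{Q}\in\mathcal{Z}_n$, and $\mathbf{Q}_n(\mathbf{u})=\arg\min_{\mathbf{Q}\in\mathcal{Z}_n}g_n(\mathbf{Q})$. The Hessian $J_{n,\mathbf{Q}}$ of $g_n$ at $\mathbf{Q}\in\mathcal{Z}_n$ is the symmetric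 bounded bilinear form on $\mathcal{Z}_n\times\mathcal{Z}_n$ satisfying, for every $\mathbf{h}\in\mathcal{Z}_n$, $$\lim_{t\to0}\Bigl|g_n(\mathbf{Q}+t\mathbf{h})-g_n(\mathbf{Q})-t\Bigl\langle E\Bigl\{\tfrac{\mathbf{Q}-\mathbf{X}^{(n)}}{\|\mathbf{Q}-\mathbf{X}^{(n)}\|}-\mathbf{u}^{(n)}\Bigr\},\mathbf{h}\Bigr\rangle-\tfrac{t^2}{2}J_{n,\mathbf{Q}}(\mathbf{h},\mathbf{h})\Bigr|\Big/t^2=0,$$ namely $J_{n,\mathbf{Q}}(\mathbf{h},\mathbf{v})=E\bigl\{\frac{\langle\mathbf{h},\mathbf{v}\rangle}{\|\mathbf{Q}-\mathbf{X}^{(n)}\|}-\frac{\langle\mathbf{h},\mathbf{Q}-\mathbf{X}^{(n)}\rangle\langle\mathbf{v},\mathbf{Q}-\mathbf{X}^{(n)}\rangle}{\|\mathbf{Q}-\mathbf{X}^{(n)}\|^3}\bigr\}$. The operator $\widetilde{J}_{n,\mathbf{Q}}:\mathcal{Z}_n\to\mathcal{Z}_n$ is defined by $\langle\widetilde{J}_{n,\mathbf{Q}}(\mathbf{h}),\mathbf{v}\rangle=J_{n,\mathbf{Q}}(\mathbf{h},\mathbf{v})$ for all $\mathbf{h},\mathbf{v}\in\mathcal{Z}_n$. The representation is meant for all sufficiently large $n$. *)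

theory Defs
  imports "HOL-Probability.Probability" "HOL-Library.Landau_Symbols"
begin

text \<open>
  A separable real Hilbert space is a type of sort
  \<open>{real_inner, banach, second_countable_topology}\<close>. The orthonormal basis
  \<open>\<phi> 1, \<phi> 2, \<dots>\<close> has length \<open>N :: enat\<close>, where \<open>N = \<infinity>\<close> is the infinite-dimensional
  case; the value \<open>\<phi> 0\<close> is never used.
\<close>

definition orthonormal_basis_seq :: "(nat \<Rightarrow> 'a::real_inner) \<Rightarrow> enat \<Rightarrow> bool" where
  "orthonormal_basis_seq \<phi> N \<longleftrightarrow>
     (\<forall>i\<ge>1. \<forall>j\<ge>1. enat i \<le> N \<longrightarrow> enat j \<le> N \<longrightarrow> \<phi> i \<bullet> \<phi> j = (if i = j then 1 else 0)) \<and>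
     closure (span {\<phi> i | i. 1 \<le> i \<and> enat i \<le> N}) = UNIV"

definition basis_span :: "(nat \<Rightarrow> 'a::real_vector) \<Rightarrow> nat \<Rightarrow> 'a set" where
  "basis_span \<phi> k = span (\<phi> ` {1..k})"

definition orth_proj :: "'a::real_inner set \<Rightarrow> 'a \<Rightarrow> 'a" where
  "orth_proj Z z = (THE p. p \<in> Z \<and> (\<forall>y\<in>Z. orthogonal (z - p) y))"

definition line_through :: "'a::real_vector \<Rightarrow> 'a \<Rightarrow> 'a set" where
  "line_through x1 x2 = {a *\<^sub>R x1 + (1 - a) *\<^sub>R x2 | a. True}"

definition nonatomic :: "'a measure \<Rightarrow> bool" where
  "nonatomic \<mu> \<longleftrightarrow> (\<forall>x. emeasure \<mu> {x} = 0)"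

text \<open>
  Expectations of functions of a random element with law \<open>\<mu>\<close> are integrals with respect
  to \<open>\<mu>\<close>. In the following, \<open>Z\<close> is the subspace on which the problem is projected.
\<close>

definition sample_objective ::
    "'a::real_inner set \<Rightarrow> 'a \<Rightarrow> nat \<Rightarrow> (nat \<Rightarrow> 'a) \<Rightarrow> 'a \<Rightarrow> real" where
  "sample_objective Z u n x Q =
     (\<Sum>i=1..n. norm (Q - orth_proj Z (x i)) - norm (orth_proj Z (x i))) / real n
       - orth_proj Z u \<bullet> Q"

definition sample_quantile ::
    "'a::real_inner set \<Rightarrow> 'a \<Rightarrow> nat \<Rightarrow> (nat \<Rightarrow> 'a) \<Rightarrow> 'a" where
  "sample_quantile Z u n x = arg_min_on (sample_objective Z u n x) Z"

definition spatial_objective ::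
    "'a::real_inner measure \<Rightarrow> 'a set \<Rightarrow> 'a \<Rightarrow> 'a \<Rightarrow> real" where
  "spatial_objective \<mu> Z u Q =
     (\<integral>x. norm (Q - orth_proj Z x) - norm (orth_proj Z x) \<partial>\<mu>) - orth_proj Z u \<bullet> Q"

definition spatial_quantile :: "'a::real_inner measure \<Rightarrow> 'a set \<Rightarrow> 'a \<Rightarrow> 'a" where
  "spatial_quantile \<mu> Z u = arg_min_on (spatial_objective \<mu> Z u) Z"

definition spatial_score :: "'a::real_inner set \<Rightarrow> 'a \<Rightarrow> 'a \<Rightarrow> 'a \<Rightarrow> 'a" where
  "spatial_score Z u Q x =
     (Q - orth_proj Z x) /\<^sub>R norm (Q - orth_proj Z x) - orth_proj Z u"

definition spatial_hessian ::
    "'a::real_inner measure \<Rightarrow> 'a set \<Rightarrow> 'a \<Rightarrow> 'a \<Rightarrow> 'a \<Rightarrow> real" where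
  "spatial_hessian \<mu> Z Q h v =
     (\<integral>x. (h \<bullet> v) / norm (Q - orth_proj Z x)
           - (h \<bullet> (Q - orth_proj Z x)) * (v \<bullet> (Q - orth_proj Z x))
               / norm (Q - orth_proj Z x) ^ 3 \<partial>\<mu>)"

definition hessian_operator :: "'a::real_inner measure \<Rightarrow> 'a set \<Rightarrow> 'a \<Rightarrow> 'a \<Rightarrow> 'a" where
  "hessian_operator \<mu> Z Q h =
     (THE w. w \<in> Z \<and> (\<forall>v\<in>Z. w \<bullet> v = spatial_hessian \<mu> Z Q h v))"

text \<open>
  The Hessian is by definition the symmetric bounded bilinear form in the second-order
  expansion of \<open>spatial_objective\<close>; \<open>spatial_hessian\<close> is its explicit formula. The two
  lemmas at the end of this theory show that the formula is the unique form with the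
  defining property whenever the inverse second moment is finite.
\<close>

definition is_spatial_hessian ::
    "'a::{real_inner,banach,second_countable_topology} measure \<Rightarrow> 'a set \<Rightarrow> 'a \<Rightarrow> 'a
      \<Rightarrow> ('a \<Rightarrow> 'a \<Rightarrow> real) \<Rightarrow> bool" where
  "is_spatial_hessian \<mu> Z u Q J \<longleftrightarrow>
     (\<forall>h\<in>Z. \<forall>v\<in>Z. J h v = J v h) \<and>
     (\<forall>a b. \<forall>h\<in>Z. \<forall>h'\<in>Z. \<forall>v\<in>Z. J (a *\<^sub>R h + b *\<^sub>R h') v = a * J h v + b * J h' v) \<and>
     (\<exists>K. \<forall>h\<in>Z. \<forall>v\<in>Z. \<bar>J h v\<bar> \<le> K * norm h * norm v) \<and>
     (\<forall>h\<in>Z. ((\<lambda>t. \<bar>spatial_objective \<mu> Z u (Q + t *\<^sub>R h) - spatial_objective \<mu> Z u Q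
                     - t * ((\<integral>x. spatial_score Z u Q x \<partial>\<mu>) \<bullet> h)
                     - t\<^sup>2 / 2 * J h h\<bar> / t\<^sup>2) \<longlongrightarrow> 0) (at 0))"

text \<open>
  The inverse is taken in \<open>ennreal\<close>, where \<open>inverse 0 = \<infinity>\<close>; with real division an atom of
  the projected distribution at \<open>Q\<close> would go unnoticed.
\<close>

definition inverse_second_moment :: "'a::real_inner measure \<Rightarrow> 'a set \<Rightarrow> 'a \<Rightarrow> ennreal" where
  "inverse_second_moment \<mu> Z Q =
     (\<integral>\<^sup>+x. inverse (ennreal (norm (Q - orth_proj Z x)) ^ 2) \<partial>\<mu>)"


lemma orth_proj_basis_span:
  fixes \<phi> :: "nat \<Rightarrow> 'a::real_inner"
  assumes "orthonormal_basis_seq \<phi> N" "enat k \<le> N"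
  shows "orth_proj (basis_span \<phi> k) z = (\<Sum>i=1..k. (z \<bullet> \<phi> i) *\<^sub>R \<phi> i)" (is "_ = ?p")
proof -
  have on: "\<phi> i \<bullet> \<phi> j = (if i = j then 1 else 0)" if "i \<in> {1..k}" "j \<in> {1..k}" for i j
  proof -
    have "enat i \<le> N" "enat j \<le> N"
      using that assms(2) by (auto intro: order_trans[of _ "enat k"])
    then show ?thesis
      using that assms(1) unfolding orthonormal_basis_seq_def by auto
  qed
  have p: "?p \<in> basis_span \<phi> k"
    unfolding basis_span_def by (intro span_sum span_scale span_base) auto
  have orth: "orthogonal (z - ?p) y" if "y \<in> basis_span \<phi> k" for y
  proof -
    have "orthogonal (z - ?p) (\<phi> j)" if j: "j \<in> {1..k}" for j
    proof -
      have "?p \<bullet> \<phi> j = (\<Sum>i=1..k. (z \<bullet> \<phi> i) * (if i = j then 1 else 0))"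
        unfolding inner_sum_left inner_scaleR_left
        by (intro sum.cong refl) (simp add: on[OF _ j])
      also have "\<dots> = z \<bullet> \<phi> j" using j by (simp add: if_distrib sum.delta' cong: if_cong)
      finally show ?thesis by (simp add: orthogonal_def inner_diff_left)
    qed
    then show ?thesis
      using that unfolding basis_span_def
      by (intro orthogonal_to_span[of y "\<phi> ` {1..k}"]) auto
  qed
  show ?thesis
    unfolding orth_proj_def
  proof (rule the_equality)
    fix q assume q: "q \<in> basis_span \<phi> k \<and> (\<forall>y\<in>basis_span \<phi> k. orthogonal (z - q) y)"
    have m: "q - ?p \<in> basis_span \<phi> k"
      using q p unfolding basis_span_def by (auto intro: span_diff)
    have "(z - ?p) \<bullet> (q - ?p) = 0" "(z - q) \<bullet> (q - ?p) = 0"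
      using orth[OF m] q m by (auto simp: orthogonal_def)
    then have "(q - ?p) \<bullet> (q - ?p) = 0"
      by (simp add: inner_diff_left)
    then show "q = ?p" by simp
  qed (use p orth in auto)
qed

lemma measurable_orth_proj_basis_span:
  fixes \<phi> :: "nat \<Rightarrow> 'a::{real_inner,second_countable_topology}"
  assumes "orthonormal_basis_seq \<phi> N" "enat k \<le> N"
  shows "orth_proj (basis_span \<phi> k) \<in> borel_measurable borel"
proof -
  have "orth_proj (basis_span \<phi> k) = (\<lambda>z. \<Sum>i=1..k. (z \<bullet> \<phi> i) *\<^sub>R \<phi> i)"
    using orth_proj_basis_span[OF assms] by auto
  then show ?thesis by simp
qed

lemma norm_expansion_quotient:
  fixes y h :: "'a::real_inner"
  assumes "y \<noteq> 0" "t \<noteq> 0"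
  shows "(norm (y + t *\<^sub>R h) - norm y - t * ((y \<bullet> h) / norm y)) / t\<^sup>2 =
     ((h \<bullet> h) * norm y - (y \<bullet> h) * ((2 * (y \<bullet> h) + t * (h \<bullet> h)) / (norm (y + t *\<^sub>R h) + norm y)))
       / ((norm (y + t *\<^sub>R h) + norm y) * norm y)" (is ?eq)
    and "\<bar>(norm (y + t *\<^sub>R h) - norm y - t * ((y \<bullet> h) / norm y)) / t\<^sup>2\<bar> \<le> 2 * (h \<bullet> h) / norm y" (is ?bd)
proof -
  define m where "m = norm (y + t *\<^sub>R h)"
  define r where "r = norm y"
  define a where "a = y \<bullet> h"
  define b where "b = h \<bullet> h"
  have r: "r > 0" and m: "m \<ge> 0" using assms by (auto simp: r_def m_def)
  then have s: "m + r > 0" by simp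
  have "m\<^sup>2 = r\<^sup>2 + 2 * t * a + t\<^sup>2 * b"
    unfolding m_def r_def a_def b_def power2_norm_eq_inner
    by (simp add: inner_add_left inner_add_right inner_commute power2_eq_square algebra_simps)
  then have mr: "(m - r) * (m + r) = t * (2 * a + t * b)"
    by (simp add: algebra_simps power2_eq_square)
  define w where "w = (2 * a + t * b) / (m + r)"
  have w: "m - r = t * w"
    using mr s unfolding w_def by (simp add: field_simps)
  have ws: "w * (m + r) = 2 * a + t * b" unfolding w_def using s by simp
  have "m - r - t * (a / r) = t\<^sup>2 * ((b * r - a * w) / ((m + r) * r))"
  proof -
    have "(m - r - t * (a / r)) * ((m + r) * r) = (m - r) * (m + r) * r - t * a * (m + r)"
      using r by (simp add: field_simps)
    also have "\<dots> = t * (2 * a * r + t * b * r - a * (m - r) - 2 * a * r)"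
      unfolding mr by (simp add: algebra_simps)
    also have "\<dots> = t\<^sup>2 * (b * r - a * w)"
      unfolding w by (simp add: algebra_simps power2_eq_square)
    finally have "m - r - t * (a / r) = t\<^sup>2 * (b * r - a * w) / ((m + r) * r)"
      using r s by (intro eq_divide_imp) auto
    then show ?thesis by simp
  qed
  then have eq: "(m - r - t * (a / r)) / t\<^sup>2 = (b * r - a * w) / ((m + r) * r)"
    using assms(2) by simp
  then show ?eq unfolding w_def m_def r_def a_def b_def .
  have b: "b = (norm h)\<^sup>2" unfolding b_def by (simp add: power2_norm_eq_inner)
  have "\<bar>m - r\<bar> \<le> \<bar>t\<bar> * norm h"
    unfolding m_def r_def using norm_triangle_ineq3[of "y + t *\<^sub>R h" y] by simp
  then have wn: "\<bar>w\<bar> \<le> norm h"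
    using assms(2) unfolding w by (simp add: abs_mult)
  have an: "\<bar>a\<bar> \<le> r * norm h" unfolding a_def r_def by (rule Cauchy_Schwarz_ineq2)
  have "\<bar>a * w\<bar> \<le> (r * norm h) * norm h"
    unfolding abs_mult using an wn r by (intro mult_mono) auto
  then have "\<bar>b * r - a * w\<bar> \<le> 2 * b * r"
    using b r abs_triangle_ineq4[of "b * r" "a * w"] by (simp add: abs_mult power2_eq_square mult_ac)
  then have "\<bar>(b * r - a * w) / ((m + r) * r)\<bar> \<le> (2 * b * r) / (r * r)"
    unfolding abs_divide using r m by (intro frac_le) (auto intro: mult_right_mono)
  also have "\<dots> = 2 * b / r" using r by simp
  finally show ?bd using eq unfolding m_def r_def a_def b_def by simp
qed

lemma norm_expansion_limit:
  fixes y h :: "'a::real_inner"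
  assumes "y \<noteq> 0"
  shows "((\<lambda>t. (norm (y + t *\<^sub>R h) - norm y - t * ((y \<bullet> h) / norm y)) / t\<^sup>2)
      \<longlongrightarrow> ((h \<bullet> h) / norm y - (h \<bullet> y) * (h \<bullet> y) / norm y ^ 3) / 2) (at 0)"
proof -
  define q where "q t = ((h \<bullet> h) * norm y
       - (y \<bullet> h) * ((2 * (y \<bullet> h) + t * (h \<bullet> h)) / (norm (y + t *\<^sub>R h) + norm y)))
       / ((norm (y + t *\<^sub>R h) + norm y) * norm y)" for t
  have "(q \<longlongrightarrow> q 0) (at 0)"
    using assms unfolding q_def by (intro tendsto_intros) auto
  moreover have "q 0 = ((h \<bullet> h) / norm y - (h \<bullet> y) * (h \<bullet> y) / norm y ^ 3) / 2"
    using assms unfolding q_def by (simp add: inner_commute[of h y] field_simps power3_eq_cube)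
  ultimately have "(q \<longlongrightarrow> ((h \<bullet> h) / norm y - (h \<bullet> y) * (h \<bullet> y) / norm y ^ 3) / 2) (at 0)"
    by simp
  then show ?thesis
  proof (rule Lim_transform_eventually)
    show "\<forall>\<^sub>F t in at 0. q t = (norm (y + t *\<^sub>R h) - norm y - t * ((y \<bullet> h) / norm y)) / t\<^sup>2"
      unfolding eventually_at_filter q_def
      by (intro always_eventually allI impI norm_expansion_quotient(1)[OF assms, symmetric])
  qed
qed

lemma is_spatial_hessian_spatial_hessian:
  fixes \<mu> :: "'a::{real_inner,banach,second_countable_topology} measure"
  assumes "prob_space \<mu>" and sets: "sets \<mu> = sets borel"
    and Z: "subspace Z" "orth_proj Z \<in> borel_measurable borel"
    and fin: "inverse_second_moment \<mu> Z Q < \<infinity>"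
  shows "is_spatial_hessian \<mu> Z u Q (spatial_hessian \<mu> Z Q)"
proof -
  interpret prob_space \<mu> by fact
  note [measurable_cong] = sets
  define P where "P = orth_proj Z"
  have [measurable]: "P \<in> borel_measurable \<mu>" using Z(2) by (simp add: P_def)
  define y where "y x = Q - P x" for x
  have [measurable]: "y \<in> borel_measurable \<mu>" unfolding y_def by measurable
  define k where "k h v x = (h \<bullet> v) / norm (y x) - (h \<bullet> y x) * (v \<bullet> y x) / norm (y x) ^ 3" for h v x
  have [measurable]: "k h v \<in> borel_measurable \<mu>" for h v unfolding k_def by measurable
  have J: "spatial_hessian \<mu> Z Q h v = (\<integral>x. k h v x \<partial>\<mu>)" for h v
    unfolding spatial_hessian_def k_def y_def P_def ..

  have fin': "(\<integral>\<^sup>+x. inverse (ennreal (norm (y x)) ^ 2) \<partial>\<mu>) < \<infinity>"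
    using fin unfolding inverse_second_moment_def y_def P_def .
  have "AE x in \<mu>. inverse (ennreal (norm (y x)) ^ 2) \<noteq> \<infinity>"
    using fin' by (intro nn_integral_PInf_AE) auto
  then have ne: "AE x in \<mu>. y x \<noteq> 0"
    by eventually_elim auto
  have int1: "integrable \<mu> (\<lambda>x. 1 / norm (y x))"
  proof (rule integrableI_bounded)
    have "(\<integral>\<^sup>+x. ennreal (norm (1 / norm (y x))) \<partial>\<mu>)
        \<le> (\<integral>\<^sup>+x. 1 + inverse (ennreal (norm (y x)) ^ 2) \<partial>\<mu>)"
    proof (rule nn_integral_mono_AE, use ne in eventually_elim)
      fix x assume "y x \<noteq> 0"
      then have r: "norm (y x) > 0" by simp
      have "(1 / norm (y x) - 1)\<^sup>2 \<ge> 0" by simp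
      then have "2 * (1 / norm (y x)) \<le> 1 + inverse (norm (y x) ^ 2)"
        by (simp add: power2_diff power_one_over inverse_eq_divide)
      then have "1 / norm (y x) \<le> 1 + inverse (norm (y x) ^ 2)"
        using r zero_le_divide_1_iff[of "norm (y x)"] by linarith
      then have "ennreal (norm (1 / norm (y x))) \<le> ennreal (1 + inverse (norm (y x) ^ 2))"
        by (intro ennreal_leI) simp
      also have "\<dots> = 1 + inverse (ennreal (norm (y x)) ^ 2)"
        using r by (simp add: ennreal_power inverse_ennreal)
      finally show "ennreal (norm (1 / norm (y x))) \<le> 1 + inverse (ennreal (norm (y x)) ^ 2)" .
    qed
    also have "\<dots> = 1 + (\<integral>\<^sup>+x. inverse (ennreal (norm (y x)) ^ 2) \<partial>\<mu>)"
      by (subst nn_integral_add) (auto simp: emeasure_space_1)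
    also have "\<dots> < \<infinity>" using fin' by (simp add: ennreal_add_eq_top less_top)
    finally show "(\<integral>\<^sup>+x. ennreal (norm (1 / norm (y x))) \<partial>\<mu>) < \<infinity>" .
  qed measurable

  have kb: "\<bar>k h v x\<bar> \<le> 2 * norm h * norm v * (1 / norm (y x))" for h v x
  proof (cases "y x = 0")
    case False
    then have r: "norm (y x) > 0" by simp
    have "\<bar>(h \<bullet> y x) * (v \<bullet> y x)\<bar> \<le> (norm h * norm (y x)) * (norm v * norm (y x))"
      unfolding abs_mult by (intro mult_mono Cauchy_Schwarz_ineq2) auto
    then have "\<bar>(h \<bullet> y x) * (v \<bullet> y x) / norm (y x) ^ 3\<bar>
        \<le> (norm h * norm (y x)) * (norm v * norm (y x)) / norm (y x) ^ 3"
      unfolding abs_divide using r by (simp add: divide_right_mono)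
    also have "\<dots> = norm h * norm v * (1 / norm (y x))"
      using r by (simp add: power3_eq_cube field_simps)
    finally have 1: "\<bar>(h \<bullet> y x) * (v \<bullet> y x) / norm (y x) ^ 3\<bar> \<le> norm h * norm v * (1 / norm (y x))" .
    have "\<bar>(h \<bullet> v) / norm (y x)\<bar> \<le> norm h * norm v * (1 / norm (y x))"
      using Cauchy_Schwarz_ineq2[of h v] r by (simp add: abs_divide divide_right_mono)
    then show ?thesis using 1 unfolding k_def by linarith
  qed (simp add: k_def)
  have intk: "integrable \<mu> (k h v)" for h v
  proof (rule Bochner_Integration.integrable_bound)
    show "integrable \<mu> (\<lambda>x. 2 * norm h * norm v * (1 / norm (y x)))"
      using int1 by (rule integrable_mult_right)
    show "AE x in \<mu>. norm (k h v x) \<le> norm (2 * norm h * norm v * (1 / norm (y x)))"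
      using kb[of h v] by (intro AE_I2) (auto intro: order_trans[OF _ abs_ge_self])
  qed measurable

  have sym: "spatial_hessian \<mu> Z Q h v = spatial_hessian \<mu> Z Q v h" for h v
    unfolding J k_def by (simp add: inner_commute mult.commute)
  have lin: "spatial_hessian \<mu> Z Q (a *\<^sub>R h + b *\<^sub>R h') v
      = a * spatial_hessian \<mu> Z Q h v + b * spatial_hessian \<mu> Z Q h' v" for a b h h' v
  proof -
    have "k (a *\<^sub>R h + b *\<^sub>R h') v x = a * k h v x + b * k h' v x" for x
      unfolding k_def by (simp add: inner_add_left diff_divide_distrib add_divide_distrib algebra_simps)
    then have "k (a *\<^sub>R h + b *\<^sub>R h') v = (\<lambda>x. a * k h v x + b * k h' v x)" by (rule ext)
    then show ?thesis unfolding J using intk by simp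
  qed
  have bdd: "\<bar>spatial_hessian \<mu> Z Q h v\<bar> \<le> 2 * (\<integral>x. 1 / norm (y x) \<partial>\<mu>) * norm h * norm v" for h v
  proof -
    have "\<bar>spatial_hessian \<mu> Z Q h v\<bar> \<le> (\<integral>x. 2 * norm h * norm v * (1 / norm (y x)) \<partial>\<mu>)"
      unfolding J
      using integrable_abs[OF intk[of h v]] integrable_mult_right[OF int1, of "2 * norm h * norm v"] kb[of h v]
      by (intro order_trans[OF integral_abs_bound] integral_mono)
    also have "\<dots> = 2 * norm h * norm v * (\<integral>x. 1 / norm (y x) \<partial>\<mu>)"
      by (rule integral_mult_right_zero)
    finally show ?thesis by (simp add: mult_ac)
  qed

  have lim: "((\<lambda>t. \<bar>spatial_objective \<mu> Z u (Q + t *\<^sub>R h) - spatial_objective \<mu> Z u Q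
                 - t * ((\<integral>x. spatial_score Z u Q x \<partial>\<mu>) \<bullet> h)
                 - t\<^sup>2 / 2 * spatial_hessian \<mu> Z Q h h\<bar> / t\<^sup>2) \<longlongrightarrow> 0) (at 0)" for h
  proof -
    define F where "F t x = (norm (y x + t *\<^sub>R h) - norm (y x) - t * ((y x \<bullet> h) / norm (y x))) / t\<^sup>2
        - k h h x / 2" for t x
    have [measurable]: "F t \<in> borel_measurable \<mu>" for t unfolding F_def by measurable
    have into: "integrable \<mu> (\<lambda>x. norm (q - P x) - norm (P x))" for q
    proof (rule integrable_const_bound[where B="norm q"])
      have "\<bar>norm (q - P x) - norm (P x)\<bar> \<le> norm q" for x
        using norm_triangle_ineq3[of "q - P x" "- P x"] by simp
      then show "AE x in \<mu>. norm (norm (q - P x) - norm (P x)) \<le> norm q" by simp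
    qed measurable
    have ints: "integrable \<mu> (\<lambda>x. y x /\<^sub>R norm (y x))"
      by (rule integrable_const_bound[where B=1]) (auto intro!: AE_I2 simp: inverse_eq_divide)
    have eq: "(spatial_objective \<mu> Z u (Q + t *\<^sub>R h) - spatial_objective \<mu> Z u Q
                 - t * ((\<integral>x. spatial_score Z u Q x \<partial>\<mu>) \<bullet> h)
                 - t\<^sup>2 / 2 * spatial_hessian \<mu> Z Q h h) / t\<^sup>2 = (\<integral>x. F t x \<partial>\<mu>)" if t: "t \<noteq> 0" for t
    proof -
      have ints': "integrable \<mu> (\<lambda>x. (y x \<bullet> h) / norm (y x))"
        using integrable_inner_left[of h \<mu>, OF ints] by (simp add: divide_inverse_commute)
      have sc: "(\<integral>x. spatial_score Z u Q x \<partial>\<mu>) \<bullet> h = (\<integral>x. (y x \<bullet> h) / norm (y x) \<partial>\<mu>) - P u \<bullet> h"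
      proof -
        have "(\<integral>x. spatial_score Z u Q x \<partial>\<mu>) = (\<integral>x. y x /\<^sub>R norm (y x) \<partial>\<mu>) - P u"
          unfolding spatial_score_def P_def[symmetric] y_def[symmetric]
          using ints by (simp add: prob_space)
        moreover have "(\<integral>x. y x /\<^sub>R norm (y x) \<partial>\<mu>) \<bullet> h = (\<integral>x. (y x \<bullet> h) / norm (y x) \<partial>\<mu>)"
          using integral_inner_left[of h \<mu> "\<lambda>x. y x /\<^sub>R norm (y x)"] ints
          by (simp add: divide_inverse_commute)
        ultimately show ?thesis by (simp add: inner_diff_left)
      qed
      have "(\<integral>x. F t x \<partial>\<mu>) = (\<integral>x. ((norm (Q + t *\<^sub>R h - P x) - norm (P x)) - (norm (Q - P x) - norm (P x))
           - t * ((y x \<bullet> h) / norm (y x))) / t\<^sup>2 - k h h x / 2 \<partial>\<mu>)"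
        by (intro Bochner_Integration.integral_cong) (auto simp: F_def y_def algebra_simps)
      also have "\<dots> = ((\<integral>x. norm (Q + t *\<^sub>R h - P x) - norm (P x) \<partial>\<mu>) - (\<integral>x. norm (Q - P x) - norm (P x) \<partial>\<mu>)
           - t * (\<integral>x. (y x \<bullet> h) / norm (y x) \<partial>\<mu>)) / t\<^sup>2 - (\<integral>x. k h h x \<partial>\<mu>) / 2"
      proof -
        note i1 = into[of "Q + t *\<^sub>R h"] and i2 = into[of Q]
        note i3 = Bochner_Integration.integrable_diff[OF i1 i2]
        have i4: "integrable \<mu> (\<lambda>x. t * ((y x \<bullet> h) / norm (y x)))"
          using ints' by (rule integrable_mult_right)
        note i5 = integrable_divide[OF Bochner_Integration.integrable_diff[OF i3 i4], of "t\<^sup>2"]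
        have i6: "integrable \<mu> (\<lambda>x. k h h x / 2)" using intk by (rule integrable_divide)
        show ?thesis
          unfolding Bochner_Integration.integral_diff[OF i5 i6]
            Bochner_Integration.integral_divide_zero
            Bochner_Integration.integral_diff[OF i3 i4]
            Bochner_Integration.integral_diff[OF i1 i2]
            Bochner_Integration.integral_mult_right_zero ..
      qed
      finally show ?thesis
        using t unfolding sc J spatial_objective_def P_def[symmetric]
        by (simp add: field_simps inner_add_right)
    qed
    have "((\<lambda>t. \<integral>x. F t x \<partial>\<mu>) \<longlongrightarrow> 0) (at 0)"
      unfolding tendsto_at_iff_sequentially
    proof (intro allI impI)
      fix T :: "nat \<Rightarrow> real" assume T: "\<forall>i. T i \<in> UNIV - {0}" "T \<longlonglongrightarrow> 0"
      have "(\<lambda>i. \<integral>x. F (T i) x \<partial>\<mu>) \<longlonglongrightarrow> (\<integral>x. 0 \<partial>\<mu>)"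
      proof (rule integral_dominated_convergence[where w="\<lambda>x. 3 * (h \<bullet> h) * (1 / norm (y x))"])
        show "AE x in \<mu>. (\<lambda>i. F (T i) x) \<longlonglongrightarrow> 0"
          using ne
        proof eventually_elim
          fix x assume "y x \<noteq> 0"
          from norm_expansion_limit[OF this, of h]
          have "((\<lambda>t. F t x) \<longlongrightarrow> 0) (at 0)"
            unfolding F_def k_def by (simp add: LIM_zero)
          then show "(\<lambda>i. F (T i) x) \<longlonglongrightarrow> 0"
            using T unfolding tendsto_at_iff_sequentially comp_def by blast
        qed
        show "AE x in \<mu>. norm (F (T i) x) \<le> 3 * (h \<bullet> h) * (1 / norm (y x))" for i
          using ne
        proof eventually_elim
          fix x assume y: "y x \<noteq> 0"
          have "T i \<noteq> 0" using T by auto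
          note A = norm_expansion_quotient(2)[OF y this, of h]
          have B: "\<bar>k h h x\<bar> \<le> 2 * (h \<bullet> h) / norm (y x)"
            using kb[of h h x] by (simp add: dot_square_norm power2_eq_square mult.assoc)
          have "\<bar>p - q / 2\<bar> \<le> 3 * (h \<bullet> h) * (1 / norm (y x))"
            if "\<bar>p\<bar> \<le> 2 * (h \<bullet> h) / norm (y x)" "\<bar>q\<bar> \<le> 2 * (h \<bullet> h) / norm (y x)" for p q :: real
          proof -
            define c where "c = (h \<bullet> h) / norm (y x)"
            have "\<bar>p\<bar> \<le> 2 * c" "\<bar>q\<bar> \<le> 2 * c" using that by (simp_all add: c_def)
            then have "\<bar>p - q / 2\<bar> \<le> 3 * c" by linarith
            then show ?thesis by (simp add: c_def)
          qed
          from this[OF A B]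
          show "norm (F (T i) x) \<le> 3 * (h \<bullet> h) * (1 / norm (y x))"
            unfolding F_def real_norm_def .
        qed
      qed (use integrable_mult_right[OF int1, of "3 * (h \<bullet> h)"] in simp_all)
      then show "((\<lambda>t. \<integral>x. F t x \<partial>\<mu>) \<circ> T) \<longlonglongrightarrow> 0" by (simp add: comp_def)
    qed
    then have "((\<lambda>t. \<bar>\<integral>x. F t x \<partial>\<mu>\<bar>) \<longlongrightarrow> 0) (at 0)"
      by (rule tendsto_rabs_zero)
    then show ?thesis
      by (rule Lim_transform_eventually)
         (auto simp: eventually_at_filter eq[symmetric] abs_divide)
  qed
  show ?thesis
    unfolding is_spatial_hessian_def using sym lin bdd lim by blast
qed

lemma is_spatial_hessian_unique:
  assumes Z: "subspace Z"
    and J: "is_spatial_hessian \<mu> Z u Q J" and J': "is_spatial_hessian \<mu> Z u Q J'"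
    and hv: "h \<in> Z" "v \<in> Z"
  shows "J h v = J' h v"
proof -
  have diag: "J h h = J' h h" if h: "h \<in> Z" for h
  proof -
    define A where "A t = spatial_objective \<mu> Z u (Q + t *\<^sub>R h) - spatial_objective \<mu> Z u Q
                 - t * ((\<integral>x. spatial_score Z u Q x \<partial>\<mu>) \<bullet> h)" for t
    have "((\<lambda>t. \<bar>A t - t\<^sup>2 / 2 * J h h\<bar> / t\<^sup>2) \<longlongrightarrow> 0) (at 0)"
      and "((\<lambda>t. \<bar>A t - t\<^sup>2 / 2 * J' h h\<bar> / t\<^sup>2) \<longlongrightarrow> 0) (at 0)"
      using J J' h unfolding is_spatial_hessian_def A_def by blast+
    then have "((\<lambda>t. \<bar>(A t - t\<^sup>2 / 2 * J h h) / t\<^sup>2\<bar>) \<longlongrightarrow> 0) (at 0)"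
      and "((\<lambda>t. \<bar>(A t - t\<^sup>2 / 2 * J' h h) / t\<^sup>2\<bar>) \<longlongrightarrow> 0) (at 0)"
      by (simp_all add: abs_divide)
    then have "((\<lambda>t. (A t - t\<^sup>2 / 2 * J h h) / t\<^sup>2 - (A t - t\<^sup>2 / 2 * J' h h) / t\<^sup>2) \<longlongrightarrow> 0 - 0) (at 0)"
      unfolding tendsto_rabs_zero_iff by (intro tendsto_diff)
    then have "((\<lambda>t. (J' h h - J h h) / 2) \<longlongrightarrow> 0 - 0) (at (0::real))"
    proof (rule Lim_transform_eventually)
      show "\<forall>\<^sub>F t in at (0::real). (A t - t\<^sup>2 / 2 * J h h) / t\<^sup>2 - (A t - t\<^sup>2 / 2 * J' h h) / t\<^sup>2
          = (J' h h - J h h) / 2"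
        by (simp add: eventually_at_filter field_simps)
    qed
    then show ?thesis by (simp add: tendsto_const_iff)
  qed
  have polar: "B (h + v) (h + v) = B h h + 2 * B h v + B v v" if "is_spatial_hessian \<mu> Z u Q B" for B
  proof -
    have s: "B x w = B w x" if "x \<in> Z" "w \<in> Z" for x w
      using \<open>is_spatial_hessian \<mu> Z u Q B\<close> that unfolding is_spatial_hessian_def by blast
    have l: "B (1 *\<^sub>R h + 1 *\<^sub>R v) w = 1 * B h w + 1 * B v w" if "w \<in> Z" for w
      using \<open>is_spatial_hessian \<mu> Z u Q B\<close> that hv unfolding is_spatial_hessian_def by blast
    have hvZ: "h + v \<in> Z" using Z hv by (rule subspace_add)
    show ?thesis
      using l[OF hvZ] l[OF hv(1)] l[OF hv(2)] s[OF hv] s[OF hvZ hv(1)] s[OF hvZ hv(2)] by simp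
  qed
  have "h + v \<in> Z" using Z hv by (rule subspace_add)
  then show ?thesis
    using polar[OF J] polar[OF J'] diag hv by fastforce
qed

end

theory Submission
  imports Defs "HOL-Real_Asymp.Real_Asymp"
begin

text \<open>
  With \<open>S Q x = sgn (Q - P x)\<close>, the population and sample objectives have (sub)gradients
  \<open>G Q = E (S Q X) - P u\<close> and \<open>Gn Q = mean (S Q X\<^sub>i) - P u\<close>. Orthogonal projection only decreases
  distances, so a bound on the inverse second moment for one dimension holds for all larger
  ones. Everything depends on this single bound \<open>B\<close>: it limits the mass near any line, which makes
  \<open>G\<close> strongly monotone with a constant independent of the dimension, and it gives
  \<open>G Q = J (Q - Q\<^sub>n) + O(|Q - Q\<^sub>n|\<^sup>2)\<close>. Put \<open>L\<^sup>2 = ln n / n\<^sup>2\<^sup>\<alpha>\<close>, which is of order \<open>d(n) ln n / n\<close>.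
  Since \<open>S Q X - S Q\<^sub>n X\<close> has second moment \<open>O(|Q - Q\<^sub>n|\<^sup>2)\<close>, Bernstein's inequality and a union
  bound over a net of \<open>exp (O(d(n) ln n))\<close> points show that almost surely, for all large \<open>n\<close>,
  \<open>(Gn - G) Q - (Gn - G) Q\<^sub>n = O(|Q - Q\<^sub>n| L + L\<^sup>2)\<close> uniformly in \<open>|Q - Q\<^sub>n| \<le> 1\<close>, and
  \<open>Gn Q\<^sub>n = O(L)\<close>. Convexity turns this into \<open>|Qhat - Q\<^sub>n| = O(L)\<close> and \<open>Gn Qhat = O(L\<^sup>2)\<close>, so that
  \<open>J (Qhat - Q\<^sub>n) + Gn Q\<^sub>n = O(L\<^sup>2)\<close>.
\<close>

section \<open>The direction map \<open>sgn\<close>\<close>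

text \<open>The convention \<open>sgn 0 = 0\<close> agrees with division by zero in
  \<open>spatial_score\<close> and selects a subgradient of the norm also at the origin, so sample
  points whose projection coincides with \<open>Q\<close> need no separate treatment. The price is
  that the sample subgradient need not vanish at the sample minimizer; its size there is estimated
  by moving a distance \<open>L\<^sup>2\<close> away. The error has to be of the order of the square
  of the typical deviation \<open>L\<close>. A bound of order \<open>L\<close> on the increments of
  \<open>Gn - G\<close> would be too weak at distance \<open>L\<close> from the minimizer; the
  missing factor is the distance itself, and it enters through the second moment in Bernstein's
  inequality. Since \<open>sgn\<close> is discontinuous, passing from a net to all points cannot
  rest on a Lipschitz bound for single summands. It rests on the envelope
  \<open>2 * e / max (norm y) e\<close>, whose mean is O(e) and whose empirical mean obeys the same
  deviation inequality.\<close>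

lemma inner_sgn_le_norm: "sgn x \<bullet> y \<le> norm (y::'a::real_inner)"
proof -
  have "sgn x \<bullet> y \<le> norm (sgn x) * norm y"
    by (rule norm_cauchy_schwarz)
  also have "\<dots> \<le> norm y"
    by (simp add: norm_sgn)
  finally show ?thesis .
qed

lemma inner_sgn_self: "sgn x \<bullet> x = norm (x::'a::real_inner)"
  by (cases "x = 0") (simp_all add: sgn_div_norm dot_square_norm power2_eq_square)

lemma norm_diff_le_inner_sgn: "norm z - norm y \<le> sgn z \<bullet> (z - y :: 'a::real_inner)"
  using inner_sgn_le_norm[of z y] by (simp add: inner_diff_right inner_sgn_self)

text \<open>Scaling the difference by \<open>norm y\<close> gives
  \<open>(norm y - norm z) *\<^sub>R sgn z + (z - y)\<close>, and both summands have norm at most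
  \<open>norm (z - y)\<close>. Only \<open>y\<close> has to be nonzero, so integrated versions
  require an inverse moment at one of the two points only.\<close>

lemma norm_sgn_diff_le:
  fixes y z :: "'a::real_inner"
  assumes "y \<noteq> 0"
  shows "norm (sgn z - sgn y) \<le> 2 * norm (z - y) / norm y"
proof -
  have y: "norm y > 0" using assms by simp
  have "norm y *\<^sub>R (sgn z - sgn y) = (norm y - norm z) *\<^sub>R sgn z + (z - y)"
    using assms by (cases "z = 0") (simp_all add: sgn_div_norm algebra_simps)
  then have "norm y * norm (sgn z - sgn y) = norm ((norm y - norm z) *\<^sub>R sgn z + (z - y))"
    using y by (metis abs_of_pos norm_scaleR)
  also have "\<dots> \<le> \<bar>norm y - norm z\<bar> * norm (sgn z) + norm (z - y)"
    by (rule order_trans[OF norm_triangle_ineq]) simp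
  also have "\<dots> \<le> norm (z - y) * 1 + norm (z - y)"
    using norm_triangle_ineq3[of y z]
    by (intro add_mono mult_mono) (simp_all add: norm_sgn norm_minus_commute)
  finally show ?thesis using y by (simp add: field_simps)
qed

text \<open>Combines the previous bound with the trivial bound 2. The right-hand side is bounded and
  depends on the center \<open>y\<close> alone, so it dominates the oscillation of
  \<open>sgn\<close> over the whole ball of radius \<open>e\<close>.\<close>

lemma norm_sgn_diff_le_max:
  fixes y z :: "'a::real_inner"
  assumes "norm (z - y) \<le> e" "0 < e"
  shows "norm (sgn z - sgn y) \<le> 2 * e / max (norm y) e"
proof (cases "norm y \<le> e")
  case True
  have "norm (sgn z - sgn y) \<le> norm (sgn z) + norm (sgn y)" by (rule norm_triangle_ineq4)
  also have "\<dots> \<le> 2" by (simp add: norm_sgn)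
  finally show ?thesis using True assms by (simp add: max_def)
next
  case False
  then have "y \<noteq> 0" using assms by auto
  from norm_sgn_diff_le[OF this, of z]
  have "norm (sgn z - sgn y) \<le> 2 * norm (z - y) / norm y" .
  also have "\<dots> \<le> 2 * e / norm y" using assms by (intro divide_right_mono) auto
  finally show ?thesis using False by (simp add: max_def)
qed

text \<open>Writing the error as \<open>(sgn z - sgn y) (|y| - |z|) / |y|\<close> plus a multiple of \<open>sgn y\<close>
  whose coefficient is controlled by the subgradient inequality avoids any calculus.\<close>

lemma norm_sgn_second_order:
  fixes y z :: "'a::real_inner"
  assumes "y \<noteq> 0"
  shows "norm (sgn z - sgn y - ((1 / norm y) *\<^sub>R (z - y) - ((y \<bullet> (z - y)) / norm y ^ 3) *\<^sub>R y))
    \<le> 4 * (norm (z - y))\<^sup>2 / (norm y)\<^sup>2"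
proof -
  define r where "r = norm y"
  have r: "r > 0" using assms by (simp add: r_def)
  define s where "s = sgn y"
  have y: "y = r *\<^sub>R s" using r by (simp add: s_def r_def sgn_div_norm)
  have z: "z = norm z *\<^sub>R sgn z" by (cases "z = 0") (simp_all add: sgn_div_norm)
  \<comment> \<open>The Bregman remainder of the norm at \<open>y\<close>: nonnegative by convexity,
    and quadratically small because the subgradient inequality at \<open>z\<close> bounds it by
    \<open>(sgn z - s) \<bullet> (z - y)\<close>.\<close>
  define e where "e = norm z - r - s \<bullet> (z - y)"
  have ss: "s \<bullet> y = r" unfolding s_def r_def by (rule inner_sgn_self)
  have e1: "e = (sgn z - s) \<bullet> z"
    unfolding e_def by (simp add: inner_diff_right inner_diff_left ss inner_sgn_self)
  have e0: "0 \<le> e" unfolding e1 inner_diff_left s_def using inner_sgn_le_norm[of y z]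
    by (simp add: inner_sgn_self)
  have "e = (sgn z - s) \<bullet> (z - y) + (sgn z \<bullet> y - r)"
    unfolding e1 by (simp add: inner_diff_right inner_diff_left ss)
  also have "\<dots> \<le> (sgn z - s) \<bullet> (z - y)"
    using inner_sgn_le_norm[of z y] by (simp add: r_def)
  also have "\<dots> \<le> norm (sgn z - s) * norm (z - y)" by (rule norm_cauchy_schwarz)
  also have d: "\<dots> \<le> (2 * norm (z - y) / r) * norm (z - y)"
    using norm_sgn_diff_le[OF assms, of z] unfolding s_def r_def by (rule mult_right_mono) simp
  finally have e2: "e \<le> 2 * (norm (z - y))\<^sup>2 / r" by (simp add: power2_eq_square)
  have id: "r *\<^sub>R (sgn z - s - ((1 / r) *\<^sub>R (z - y) - ((y \<bullet> (z - y)) / r ^ 3) *\<^sub>R y))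
      = (r - norm z) *\<^sub>R (sgn z - s) - e *\<^sub>R s"
  proof -
    have "((y \<bullet> (z - y)) / r ^ 3) *\<^sub>R y = ((s \<bullet> (z - y)) / r) *\<^sub>R s"
      using r by (subst (1 3) y) (simp add: power3_eq_cube)
    then have "r *\<^sub>R (sgn z - s - ((1 / r) *\<^sub>R (z - y) - ((y \<bullet> (z - y)) / r ^ 3) *\<^sub>R y))
      = r *\<^sub>R sgn z - r *\<^sub>R s - (z - y) + (s \<bullet> (z - y)) *\<^sub>R s"
      using r by (simp add: scaleR_diff_right)
    also have "z - y = norm z *\<^sub>R sgn z - r *\<^sub>R s" using y z by simp
    finally show ?thesis unfolding e_def
      using y z by (simp add: algebra_simps)
  qed
  have "r * norm (sgn z - s - ((1 / r) *\<^sub>R (z - y) - ((y \<bullet> (z - y)) / r ^ 3) *\<^sub>R y))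
      = norm ((r - norm z) *\<^sub>R (sgn z - s) - e *\<^sub>R s)"
    using r unfolding id[symmetric] by simp
  also have "\<dots> \<le> \<bar>r - norm z\<bar> * norm (sgn z - s) + e * norm s"
    by (rule order_trans[OF norm_triangle_ineq4]) (use e0 in simp)
  also have "\<dots> \<le> norm (z - y) * (2 * norm (z - y) / r) + 2 * (norm (z - y))\<^sup>2 / r"
  proof (intro add_mono mult_mono)
    show "\<bar>r - norm z\<bar> \<le> norm (z - y)"
      using norm_triangle_ineq3[of y z] by (simp add: r_def norm_minus_commute)
    show "norm (sgn z - s) \<le> 2 * norm (z - y) / r"
      using norm_sgn_diff_le[OF assms, of z] by (simp add: s_def r_def)
    have "e * norm s \<le> e * 1" using e0 by (intro mult_left_mono) (simp_all add: s_def norm_sgn)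
    then show "e * norm s \<le> 2 * (norm (z - y))\<^sup>2 / r" using e2 by simp
  qed (use r in auto)
  also have "\<dots> = r * (4 * (norm (z - y))\<^sup>2 / r\<^sup>2)"
    using r by (simp add: power2_eq_square field_simps)
  finally show ?thesis unfolding s_def[symmetric] r_def[symmetric]
    using r by (rule mult_left_le_imp_le)
qed

text \<open>With \<open>\<theta>\<close> the angle between \<open>y\<close> and \<open>z\<close>, the left-hand side is
  \<open>(|y| + |z|) (1 - cos \<theta>)\<close>, while \<open>area\<^sup>2 = |y|\<^sup>2 |z|\<^sup>2 sin\<^sup>2 \<theta>\<close> is the squared area of the
  parallelogram spanned by \<open>y\<close> and \<open>z\<close>.\<close>

lemma inner_sgn_diff_ge:
  fixes y z :: "'a::real_inner"
  assumes "norm y \<le> C" "norm z \<le> C" "0 < C"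
  shows "((norm (y - z))\<^sup>2 * (norm y)\<^sup>2 - ((y - z) \<bullet> y)\<^sup>2) / C ^ 3 \<le> (sgn y - sgn z) \<bullet> (y - z)"
proof (cases "y = 0 \<or> z = 0")
  case True
  then have "(norm (y - z))\<^sup>2 * (norm y)\<^sup>2 - ((y - z) \<bullet> y)\<^sup>2 = 0"
    by (auto simp: dot_square_norm power2_eq_square)
  moreover have "0 \<le> (sgn y - sgn z) \<bullet> (y - z)"
    using inner_sgn_le_norm[of y z] inner_sgn_le_norm[of z y]
    by (simp add: inner_diff_left inner_diff_right inner_sgn_self)
  ultimately show ?thesis by simp
next
  case False
  define a b p where "a = norm y" "b = norm z" "p = y \<bullet> z"
  have a: "a > 0" "a \<le> C" and b: "b > 0" "b \<le> C" using False assms by (auto simp: a_b_p_def)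
  have p: "p \<le> a * b" "- (a * b) \<le> p"
    using Cauchy_Schwarz_ineq2[of y z] by (auto simp: a_b_p_def abs_le_iff)
  have lhs: "(norm (y - z))\<^sup>2 * (norm y)\<^sup>2 - ((y - z) \<bullet> y)\<^sup>2 = a\<^sup>2 * b\<^sup>2 - p\<^sup>2"
  proof -
    have "(norm (y - z))\<^sup>2 = a\<^sup>2 - 2 * p + b\<^sup>2"
      unfolding a_b_p_def power2_norm_eq_inner
      by (simp add: inner_diff_left inner_diff_right inner_commute)
    moreover have "(y - z) \<bullet> y = a\<^sup>2 - p"
      unfolding a_b_p_def power2_norm_eq_inner by (simp add: inner_diff_left inner_commute[of z y])
    ultimately show ?thesis
      unfolding a_b_p_def(1)[symmetric] by (simp only:) (simp add: power2_eq_square algebra_simps)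
  qed
  have "sgn y \<bullet> z = p / a" "sgn z \<bullet> y = p / b"
    by (simp_all add: a_b_p_def sgn_div_norm inner_commute field_simps)
  then have rhs: "(sgn y - sgn z) \<bullet> (y - z) = (a + b) * (a * b - p) / (a * b)"
    using a b by (simp add: inner_diff_left inner_diff_right inner_sgn_self a_b_p_def[symmetric])
      (simp add: field_simps)
  have "(a\<^sup>2 * b\<^sup>2 - p\<^sup>2) / C ^ 3 = (a * b - p) * ((a * b + p) / C ^ 3)"
    by (simp add: power2_eq_square algebra_simps)
  also have "\<dots> \<le> (a * b - p) * ((a + b) / (a * b))"
  proof (rule mult_left_mono)
    have "(a * b + p) / C ^ 3 \<le> (2 * (a * b)) / C ^ 3"
      using p assms by (intro divide_right_mono) auto
    also have "\<dots> \<le> (a + b) / (a * b)"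
    proof -
      have "a * b * (a * b) \<le> a * C * (C * C)"
        using a b by (intro mult_mono) auto
      moreover have "a * b * (a * b) \<le> C * b * (C * C)"
        using a b by (intro mult_mono) auto
      ultimately have "2 * (a * b) * (a * b) \<le> (a + b) * C ^ 3"
        by (simp add: power3_eq_cube algebra_simps)
      then show ?thesis using a b assms by (simp add: field_simps)
    qed
    finally show "(a * b + p) / C ^ 3 \<le> (a + b) / (a * b)" .
  qed (use p in simp)
  finally show ?thesis unfolding lhs rhs by (simp add: mult.commute)
qed

text \<open>The derivative of \<open>sgn\<close> at a nonzero \<open>y\<close>: the projection onto
  the orthogonal complement of \<open>y\<close>, divided by \<open>norm y\<close>. At
  \<open>y = 0\<close> division by zero makes it vanish.\<close>

definition sgn_deriv :: "'a::real_inner \<Rightarrow> 'a \<Rightarrow> 'a" where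
  "sgn_deriv y h = (1 / norm y) *\<^sub>R h - ((y \<bullet> h) / norm y ^ 3) *\<^sub>R y"

lemma linear_sgn_deriv: "linear (sgn_deriv y)"
  by (rule linearI) (simp_all add: sgn_deriv_def inner_add_right algebra_simps add_divide_distrib)

lemma norm_sgn_deriv_le: "norm (sgn_deriv y h) \<le> 2 * norm h * (1 / norm y)"
proof (cases "y = 0")
  case False
  then have y: "norm y > 0" by simp
  have "norm (((y \<bullet> h) / norm y ^ 3) *\<^sub>R y) = \<bar>y \<bullet> h\<bar> / norm y ^ 2"
    using y by (simp add: abs_divide power3_eq_cube power2_eq_square)
  also have "\<dots> \<le> (norm y * norm h) / norm y ^ 2"
    by (intro divide_right_mono Cauchy_Schwarz_ineq2) simp
  also have "\<dots> = norm h * (1 / norm y)" using y by (simp add: power2_eq_square)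
  finally have "norm (((y \<bullet> h) / norm y ^ 3) *\<^sub>R y) \<le> norm h * (1 / norm y)" .
  moreover have "norm ((1 / norm y) *\<^sub>R h) = norm h * (1 / norm y)" by simp
  ultimately show ?thesis
    unfolding sgn_deriv_def using norm_triangle_ineq4[of "(1 / norm y) *\<^sub>R h" "((y \<bullet> h) / norm y ^ 3) *\<^sub>R y"]
    by linarith
qed (simp add: sgn_deriv_def)

lemma inner_sgn_deriv:
  "sgn_deriv y h \<bullet> v = (h \<bullet> v) / norm y - (h \<bullet> y) * (v \<bullet> y) / norm y ^ 3"
  unfolding sgn_deriv_def inner_diff_left inner_scaleR_left by (simp add: inner_commute)

text \<open>The numerator is the same squared area as in \<open>inner_sgn_diff_ge\<close>, so a
  single lower bound on its integral serves both the monotonicity of \<open>G\<close> and the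
  invertibility of the Hessian.\<close>

lemma inner_sgn_deriv_self:
  "sgn_deriv y h \<bullet> h = ((norm h)\<^sup>2 * (norm y)\<^sup>2 - (h \<bullet> y)\<^sup>2) / norm y ^ 3"
proof (cases "y = 0")
  case False
  then show ?thesis
    by (simp add: sgn_deriv_def inner_diff_left dot_square_norm inner_commute[of y h] diff_divide_distrib
        power2_eq_square power3_eq_cube)
qed (simp add: sgn_deriv_def)

section \<open>A Bernstein inequality\<close>

lemma exp_le_quadratic:
  fixes x :: real
  assumes "\<bar>x\<bar> \<le> 1"
  shows "exp x \<le> 1 + x + x\<^sup>2"
proof (cases "x \<ge> 0")
  case True
  then show ?thesis using assms exp_bound[of x] by simp
next
  case False
  then have "exp x * exp (- x) = 1" "0 \<le> - x" by (simp_all add: exp_minus)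
  have t: "1 + (- x) + x\<^sup>2 / 2 \<le> exp (- x)" using exp_lower_Taylor_quadratic[of "- x"] False by simp
  have pos: "0 < 1 + x + x\<^sup>2"
    using assms False by (smt (verit) zero_le_power2 zero_less_power2)
  \<comment> \<open>Multiplying the claim by \<open>exp (- x)\<close> and bounding that factor below
    by its quadratic Taylor polynomial leaves a polynomial inequality.\<close>
  have "1 \<le> (1 + x + x\<^sup>2) * (1 - x + x\<^sup>2 / 2)"
  proof -
    have "(1 + x + x\<^sup>2) * (1 - x + x\<^sup>2 / 2) = 1 + x\<^sup>2 * (1 - x + x\<^sup>2) / 2"
      by (simp add: power2_eq_square field_simps)
    moreover have "0 \<le> x\<^sup>2 * (1 - x + x\<^sup>2)" using False by (intro mult_nonneg_nonneg) auto
    ultimately show ?thesis by simp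
  qed
  also have "\<dots> \<le> (1 + x + x\<^sup>2) * exp (- x)" using t pos by (intro mult_left_mono) auto
  finally show ?thesis by (simp add: exp_minus field_simps)
qed

lemma (in prob_space) bernstein_mgf:
  fixes Y :: "'a \<Rightarrow> real"
  assumes [measurable]: "Y \<in> borel_measurable M" and b: "\<And>\<omega>. \<bar>Y \<omega>\<bar> \<le> b"
    and s: "expectation (\<lambda>\<omega>. (Y \<omega>)\<^sup>2) \<le> s" and l: "\<bar>l\<bar> * b \<le> 1"
  shows "expectation (\<lambda>\<omega>. exp (l * Y \<omega>)) \<le> exp (l * expectation Y + l\<^sup>2 * s)"
proof -
  have i1: "integrable M Y"
    by (rule integrable_const_bound[where B=b]) (use b in auto)
  have i2: "integrable M (\<lambda>\<omega>. (Y \<omega>)\<^sup>2)"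
  proof (rule integrable_const_bound[where B="b\<^sup>2"])
    show "AE x in M. norm ((Y x)\<^sup>2) \<le> b\<^sup>2"
      using b by (auto intro!: AE_I2 power2_le_iff_abs_le[THEN iffD2] order_trans[OF abs_ge_zero])
  qed auto
  have lb: "\<bar>l * Y \<omega>\<bar> \<le> 1" for \<omega>
    using mult_left_mono[OF b[of \<omega>], of "\<bar>l\<bar>"] l by (simp add: abs_mult)
  have i3: "integrable M (\<lambda>\<omega>. exp (l * Y \<omega>))"
    by (rule integrable_const_bound[where B="exp 1"]) (use lb in \<open>auto simp: abs_le_iff\<close>)
  have "expectation (\<lambda>\<omega>. exp (l * Y \<omega>)) \<le> expectation (\<lambda>\<omega>. 1 + l * Y \<omega> + l\<^sup>2 * (Y \<omega>)\<^sup>2)"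
  proof (rule integral_mono[OF i3])
    show "integrable M (\<lambda>\<omega>. 1 + l * Y \<omega> + l\<^sup>2 * (Y \<omega>)\<^sup>2)" using i1 i2 by simp
    show "exp (l * Y \<omega>) \<le> 1 + l * Y \<omega> + l\<^sup>2 * (Y \<omega>)\<^sup>2" for \<omega>
      using exp_le_quadratic[OF lb[of \<omega>]] by (simp add: power_mult_distrib)
  qed
  also have "\<dots> = 1 + l * expectation Y + l\<^sup>2 * expectation (\<lambda>\<omega>. (Y \<omega>)\<^sup>2)"
    using i1 i2 by (simp add: prob_space)
  also have "\<dots> \<le> 1 + (l * expectation Y + l\<^sup>2 * s)"
    using mult_left_mono[OF s, of "l\<^sup>2"] by simp
  also have "\<dots> \<le> exp (l * expectation Y + l\<^sup>2 * s)" by (rule exp_ge_add_one_self)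
  finally show ?thesis .
qed

lemma (in prob_space) bernstein_upper:
  fixes Y :: "'i \<Rightarrow> 'a \<Rightarrow> real"
  assumes I: "finite I" and ind: "indep_vars (\<lambda>_. borel) Y I"
    and b: "\<And>i \<omega>. i \<in> I \<Longrightarrow> \<bar>Y i \<omega>\<bar> \<le> b"
    and e: "\<And>i. i \<in> I \<Longrightarrow> expectation (Y i) = e"
    and s: "\<And>i. i \<in> I \<Longrightarrow> expectation (\<lambda>\<omega>. (Y i \<omega>)\<^sup>2) \<le> s"
    and l: "0 < l" "l * b \<le> 1"
  shows "prob {\<omega> \<in> space M. real (card I) * e + t \<le> (\<Sum>i\<in>I. Y i \<omega>)}
    \<le> exp (real (card I) * l\<^sup>2 * s - l * t)"
proof -
  have [measurable]: "Y i \<in> borel_measurable M" if "i \<in> I" for i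
    using ind that unfolding indep_vars_def by auto
  have indx: "indep_vars (\<lambda>_. borel) (\<lambda>i \<omega>. exp (l * Y i \<omega>)) I"
    by (rule indep_vars_compose2[OF ind, where Y="\<lambda>i y. exp (l * y)"]) simp
  have intx: "integrable M (\<lambda>\<omega>. exp (l * Y i \<omega>))" if "i \<in> I" for i
  proof (rule integrable_const_bound[where B="exp 1"])
    have "l * Y i \<omega> \<le> 1" for \<omega>
    proof -
      have "l * Y i \<omega> \<le> l * b" using b[OF that, of \<omega>] l by (intro mult_left_mono) auto
      then show ?thesis using l by linarith
    qed
    then show "AE \<omega> in M. norm (exp (l * Y i \<omega>)) \<le> exp 1" by simp
  qed (use that in measurable)
  have sumx: "exp (l * (\<Sum>i\<in>I. Y i \<omega>)) = (\<Prod>i\<in>I. exp (l * Y i \<omega>))" for \<omega>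
    using I by (simp add: exp_sum sum_distrib_left)
  have "prob {\<omega> \<in> space M. real (card I) * e + t \<le> (\<Sum>i\<in>I. Y i \<omega>)}
      \<le> exp (- l * (real (card I) * e + t)) * (\<integral>\<omega>\<in>space M. exp (l * (\<Sum>i\<in>I. Y i \<omega>)) \<partial>M)"
  proof (rule Chernoff_ineq_ge)
    show "set_integrable M (space M) (\<lambda>\<omega>. exp (l * (\<Sum>i\<in>I. Y i \<omega>)))"
      unfolding set_integrable_def sumx by (rule integrable_mult_indicator[OF sets.top indep_vars_integrable[OF I indx intx]])
  qed (use l in auto)
  also have "(\<integral>\<omega>\<in>space M. exp (l * (\<Sum>i\<in>I. Y i \<omega>)) \<partial>M) = (\<Prod>i\<in>I. expectation (\<lambda>\<omega>. exp (l * Y i \<omega>)))"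
    unfolding sumx by (subst set_integral_space)
      (use indep_vars_integrable[OF I indx intx] indep_vars_lebesgue_integral[OF I indx intx] in simp_all)
  also have "\<dots> \<le> (\<Prod>i\<in>I. exp (l * e + l\<^sup>2 * s))"
  proof (intro prod_mono conjI)
    fix i assume i: "i \<in> I"
    show "expectation (\<lambda>\<omega>. exp (l * Y i \<omega>)) \<le> exp (l * e + l\<^sup>2 * s)"
      using bernstein_mgf[of "Y i" b s l] b[OF i] s[OF i] l e[OF i] i by simp
  qed (auto intro!: integral_nonneg_AE)
  also have "\<dots> = exp (real (card I) * (l * e + l\<^sup>2 * s))" by (simp add: exp_of_nat_mult)
  finally have "prob {\<omega> \<in> space M. real (card I) * e + t \<le> (\<Sum>i\<in>I. Y i \<omega>)}
      \<le> exp (- l * (real (card I) * e + t)) * exp (real (card I) * (l * e + l\<^sup>2 * s))" by simp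
  also have "\<dots> = exp (real (card I) * l\<^sup>2 * s - l * t)"
    unfolding exp_add[symmetric] by (simp add: algebra_simps)
  finally show ?thesis .
qed

text \<open>In the threshold, \<open>\<rho> * L\<close> belongs to the Gaussian regime and
  \<open>L * L\<close> to the bounded regime of Bernstein's inequality. The resulting exponent is
  free of \<open>\<rho>\<close>, so one union bound can mix functions of different scales.\<close>

lemma (in prob_space) empirical_mean_deviation:
  fixes f :: "'b::topological_space \<Rightarrow> real" and X :: "nat \<Rightarrow> 'a \<Rightarrow> 'b"
  assumes ind: "indep_vars (\<lambda>_. borel) X {1..n}" and n: "1 \<le> n"
    and law: "\<And>i. i \<in> {1..n} \<Longrightarrow> distr M borel (X i) = \<mu>"
    and f [measurable]: "f \<in> borel_measurable borel" and bound: "\<And>x. \<bar>f x\<bar> \<le> 4"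
    and second: "(\<integral>x. (f x)\<^sup>2 \<partial>\<mu>) \<le> V * \<rho>\<^sup>2" and V: "0 \<le> V" and \<rho>: "0 \<le> \<rho>" and L: "0 < L"
  shows "prob {\<omega> \<in> space M. K * L * (\<rho> + L) \<le> \<bar>(\<Sum>i=1..n. f (X i \<omega>)) / real n - (\<integral>x. f x \<partial>\<mu>)\<bar>}
    \<le> 2 * exp (- (real n * L\<^sup>2 * (K / 4 - V / 16)))"
proof -
  \<comment> \<open>With this parameter \<open>l * t\<close> equals
    \<open>n * L\<^sup>2 * K / 4\<close> exactly, the second-moment term is at most
    \<open>n * L\<^sup>2 * V / 16\<close>, and the summands bounded by 4 satisfy
    \<open>l * 4 \<le> 1\<close>.\<close>
  define l where "l = L / (4 * (\<rho> + L))"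
  have pL: "0 < \<rho> + L" using \<rho> L by simp
  have l: "0 < l" "l * 4 \<le> 1" using \<rho> L by (simp_all add: l_def field_simps)
  define t where "t = real n * (K * L * (\<rho> + L))"
  have X [measurable]: "X i \<in> borel_measurable M" if "i \<in> {1..n}" for i
    using ind that unfolding indep_vars_def by auto
  have E: "expectation (\<lambda>\<omega>. F (X i \<omega>)) = (\<integral>x. F x \<partial>\<mu>)"
    if "i \<in> {1..n}" "F \<in> borel_measurable borel" for i and F :: "'b \<Rightarrow> real"
    using integral_distr[OF X[OF that(1)] that(2)] law[OF that(1)] by simp
  have expo: "real n * l\<^sup>2 * (V * \<rho>\<^sup>2) - l * t \<le> - (real n * L\<^sup>2 * (K / 4 - V / 16))"
  proof -
    have "l\<^sup>2 * \<rho>\<^sup>2 \<le> L\<^sup>2 / 16"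
    proof -
      have "l * \<rho> = L / 4 * (\<rho> / (\<rho> + L))" using pL by (simp add: l_def)
      also have "\<dots> \<le> L / 4 * 1" using pL \<rho> L by (intro mult_left_mono) auto
      finally have "(l * \<rho>)\<^sup>2 \<le> (L / 4)\<^sup>2" using l \<rho> by (intro power_mono) auto
      then show ?thesis by (simp add: power_mult_distrib power_divide)
    qed
    then have "(real n * V) * (l\<^sup>2 * \<rho>\<^sup>2) \<le> (real n * V) * (L\<^sup>2 / 16)"
      using V by (intro mult_left_mono) auto
    moreover have "l * t = real n * L\<^sup>2 * (K / 4)"
    proof -
      define w where "w = \<rho> + L"
      show ?thesis
        using pL unfolding l_def t_def w_def[symmetric] by (simp add: power2_eq_square)
    qed
    ultimately show ?thesis by (simp add: algebra_simps)
  qed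
  have one: "prob {\<omega> \<in> space M. real n * (\<integral>x. F x \<partial>\<mu>) + t \<le> (\<Sum>i=1..n. F (X i \<omega>))}
      \<le> exp (- (real n * L\<^sup>2 * (K / 4 - V / 16)))"
    if F [measurable]: "F \<in> borel_measurable borel" and b: "\<And>x. \<bar>F x\<bar> \<le> 4"
      and s: "(\<integral>x. (F x)\<^sup>2 \<partial>\<mu>) \<le> V * \<rho>\<^sup>2" for F :: "'b \<Rightarrow> real"
  proof -
    have "prob {\<omega> \<in> space M. real (card {1..n}) * (\<integral>x. F x \<partial>\<mu>) + t \<le> (\<Sum>i\<in>{1..n}. F (X i \<omega>))}
      \<le> exp (real (card {1..n}) * l\<^sup>2 * (V * \<rho>\<^sup>2) - l * t)"
    proof (rule bernstein_upper[where b=4])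
      show "indep_vars (\<lambda>_. borel) (\<lambda>i \<omega>. F (X i \<omega>)) {1..n}"
        by (rule indep_vars_compose2[OF ind, where Y="\<lambda>_. F"]) simp
      show "expectation (\<lambda>\<omega>. (F (X i \<omega>))\<^sup>2) \<le> V * \<rho>\<^sup>2" if "i \<in> {1..n}" for i
        using E[OF that, of "\<lambda>x. (F x)\<^sup>2"] s by simp
    qed (use b E l in auto)
    also have "\<dots> \<le> exp (- (real n * L\<^sup>2 * (K / 4 - V / 16)))" using expo by simp
    finally show ?thesis by simp
  qed
  define A1 where "A1 = {\<omega> \<in> space M. real n * (\<integral>x. f x \<partial>\<mu>) + t \<le> (\<Sum>i=1..n. f (X i \<omega>))}"
  define A2 where "A2 = {\<omega> \<in> space M. real n * (\<integral>x. - f x \<partial>\<mu>) + t \<le> (\<Sum>i=1..n. - f (X i \<omega>))}"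
  have [measurable]: "A1 \<in> sets M" "A2 \<in> sets M" unfolding A1_def A2_def by measurable
  have "{\<omega> \<in> space M. K * L * (\<rho> + L) \<le> \<bar>(\<Sum>i=1..n. f (X i \<omega>)) / real n - (\<integral>x. f x \<partial>\<mu>)\<bar>} \<subseteq> A1 \<union> A2"
  proof
    fix \<omega> assume w: "\<omega> \<in> {\<omega> \<in> space M. K * L * (\<rho> + L) \<le> \<bar>(\<Sum>i=1..n. f (X i \<omega>)) / real n - (\<integral>x. f x \<partial>\<mu>)\<bar>}"
    define a where "a = (\<Sum>i=1..n. f (X i \<omega>))"
    define e where "e = (\<integral>x. f x \<partial>\<mu>)"
    have "real n * (K * L * (\<rho> + L)) \<le> real n * \<bar>a / real n - e\<bar>"
      using w unfolding a_def e_def by (intro mult_left_mono) auto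
    also have "\<dots> = \<bar>real n * (a / real n - e)\<bar>" by (simp add: abs_mult)
    also have "real n * (a / real n - e) = a - real n * e" using n by (simp add: right_diff_distrib)
    finally have "t \<le> \<bar>a - real n * e\<bar>" by (simp add: t_def)
    then have "real n * e + t \<le> a \<or> - (real n * e) + t \<le> - a" by linarith
    then show "\<omega> \<in> A1 \<union> A2"
      using w unfolding A1_def A2_def a_def e_def by (auto simp: sum_negf)
  qed
  then have "prob {\<omega> \<in> space M. K * L * (\<rho> + L) \<le> \<bar>(\<Sum>i=1..n. f (X i \<omega>)) / real n - (\<integral>x. f x \<partial>\<mu>)\<bar>}
      \<le> prob (A1 \<union> A2)" by (rule finite_measure_mono) simp
  also have "\<dots> \<le> prob A1 + prob A2" by (rule measure_Un_le) simp_all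
  also have "\<dots> \<le> 2 * exp (- (real n * L\<^sup>2 * (K / 4 - V / 16)))"
    using one[of f] one[of "\<lambda>x. - f x"] bound second unfolding A1_def A2_def by simp
  finally show ?thesis .
qed

section \<open>Finite sections of an orthonormal basis\<close>

text \<open>The ambient space may be infinite-dimensional, so compactness is built up coordinate by
  coordinate, as a sum of compact sets.\<close>

lemma compact_coordinate_box:
  fixes \<phi> :: "nat \<Rightarrow> 'a::real_normed_vector"
  shows "compact {(\<Sum>i=1..k. c i *\<^sub>R \<phi> i) | c. \<forall>i\<in>{1..k}. \<bar>c i\<bar> \<le> R}"
proof (induction k)
  case 0
  then show ?case by simp
next
  case (Suc k)
  have "compact ((\<lambda>t. t *\<^sub>R \<phi> (Suc k)) ` {-R..R})"
    by (intro compact_continuous_image continuous_intros) auto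
  from compact_sums[OF Suc.IH this]
  show ?case
  proof (rule back_subst[where P=compact], intro set_eqI iffI)
    fix x
    assume "x \<in> {x + y |x y. x \<in> {\<Sum>i = 1..k. c i *\<^sub>R \<phi> i |c. \<forall>i\<in>{1..k}. \<bar>c i\<bar> \<le> R} \<and>
        y \<in> (\<lambda>t. t *\<^sub>R \<phi> (Suc k)) ` {- R..R}}"
    then obtain c t where ct: "x = (\<Sum>i = 1..k. c i *\<^sub>R \<phi> i) + t *\<^sub>R \<phi> (Suc k)"
      "\<forall>i\<in>{1..k}. \<bar>c i\<bar> \<le> R" "t \<in> {-R..R}" by auto
    have "(\<Sum>i = 1..k. c i *\<^sub>R \<phi> i) = (\<Sum>i = 1..k. (c(Suc k := t)) i *\<^sub>R \<phi> i)"
      by (intro sum.cong) auto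
    then have "x = (\<Sum>i = 1..Suc k. (c(Suc k := t)) i *\<^sub>R \<phi> i)" using ct(1) by simp
    moreover have "\<forall>i\<in>{1..Suc k}. \<bar>(c(Suc k := t)) i\<bar> \<le> R" using ct by auto
    ultimately show "x \<in> {\<Sum>i = 1..Suc k. c i *\<^sub>R \<phi> i |c. \<forall>i\<in>{1..Suc k}. \<bar>c i\<bar> \<le> R}" by blast
  next
    fix x
    assume "x \<in> {\<Sum>i = 1..Suc k. c i *\<^sub>R \<phi> i |c. \<forall>i\<in>{1..Suc k}. \<bar>c i\<bar> \<le> R}"
    then obtain c where c: "x = (\<Sum>i = 1..k. c i *\<^sub>R \<phi> i) + c (Suc k) *\<^sub>R \<phi> (Suc k)"
      "\<forall>i\<in>{1..Suc k}. \<bar>c i\<bar> \<le> R" by auto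
    moreover have "c (Suc k) \<in> {-R..R}" using c(2)[rule_format, of "Suc k"] by (auto simp: abs_le_iff)
    ultimately show "x \<in> {x + y |x y. x \<in> {\<Sum>i = 1..k. c i *\<^sub>R \<phi> i |c. \<forall>i\<in>{1..k}. \<bar>c i\<bar> \<le> R} \<and>
        y \<in> (\<lambda>t. t *\<^sub>R \<phi> (Suc k)) ` {- R..R}}" by fastforce
  qed
qed

locale basis_section =
  fixes \<phi> :: "nat \<Rightarrow> 'a::{real_inner,banach,second_countable_topology}" and N :: enat and k :: nat
  assumes basis: "orthonormal_basis_seq \<phi> N" and k_le: "enat k \<le> N"
begin

abbreviation "Z \<equiv> basis_span \<phi> k"
abbreviation "P \<equiv> orth_proj Z"

lemma orthonormal: "i \<in> {1..k} \<Longrightarrow> j \<in> {1..k} \<Longrightarrow> \<phi> i \<bullet> \<phi> j = (if i = j then 1 else 0)"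
  using basis k_le order_trans[of "enat i" "enat k" N] order_trans[of "enat j" "enat k" N]
  unfolding orthonormal_basis_seq_def by auto

lemma subspace_Z: "subspace Z"
  by (simp add: basis_span_def)

lemma basis_in_Z: "i \<in> {1..k} \<Longrightarrow> \<phi> i \<in> Z"
  by (simp add: basis_span_def span_base)

lemma P_eq: "P z = (\<Sum>i=1..k. (z \<bullet> \<phi> i) *\<^sub>R \<phi> i)"
  by (rule orth_proj_basis_span[OF basis k_le])

lemma bounded_linear_P: "bounded_linear P"
proof -
  have "P = (\<lambda>z. \<Sum>i=1..k. (z \<bullet> \<phi> i) *\<^sub>R \<phi> i)" using P_eq by auto
  then show ?thesis
    by (auto intro!: bounded_linear_sum bounded_linear_scaleR_const bounded_linear_inner_left)
qed

lemma borel_measurable_P [measurable]: "P \<in> borel_measurable borel"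
  by (rule measurable_orth_proj_basis_span[OF basis k_le])

lemma P_in_Z [simp]: "P z \<in> Z"
  unfolding P_eq by (intro subspace_sum subspace_scale subspace_Z basis_in_Z)

lemma inner_P_basis: "j \<in> {1..k} \<Longrightarrow> P z \<bullet> \<phi> j = z \<bullet> \<phi> j"
proof -
  assume j: "j \<in> {1..k}"
  have "P z \<bullet> \<phi> j = (\<Sum>i=1..k. (z \<bullet> \<phi> i) * (if i = j then 1 else 0))"
    unfolding P_eq inner_sum_left inner_scaleR_left
    by (intro sum.cong refl) (simp add: orthonormal[OF _ j])
  then show ?thesis using j by (simp add: if_distrib sum.delta' cong: if_cong)
qed

lemma orthogonal_to_Z:
  assumes "\<And>j. j \<in> {1..k} \<Longrightarrow> w \<bullet> \<phi> j = 0" "v \<in> Z"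
  shows "w \<bullet> v = 0"
proof -
  have "orthogonal w v"
    using assms by (intro orthogonal_to_span[of v "\<phi> ` {1..k}"]) (auto simp: basis_span_def orthogonal_def)
  then show ?thesis by (simp add: orthogonal_def)
qed

lemma inner_P: "v \<in> Z \<Longrightarrow> P z \<bullet> v = z \<bullet> v"
  using orthogonal_to_Z[of "P z - z" v] inner_P_basis by (simp add: inner_diff_left)

lemma eq_in_Z:
  assumes "a \<in> Z" "b \<in> Z" "\<And>v. v \<in> Z \<Longrightarrow> a \<bullet> v = b \<bullet> v"
  shows "a = b"
proof -
  have "(a - b) \<bullet> (a - b) = 0"
    using assms(3)[OF subspace_diff[OF subspace_Z assms(1,2)]] by (simp add: inner_diff_left)
  then show ?thesis by simp
qed

lemma P_id [simp]: "z \<in> Z \<Longrightarrow> P z = z"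
  by (rule eq_in_Z) (auto simp: inner_P)

lemma in_Z_iff: "z \<in> Z \<longleftrightarrow> P z = z"
  using P_id P_in_Z by metis

lemma norm_P_le: "norm (P z) \<le> norm z"
proof (cases "P z = 0")
  case False
  have "norm (P z) * norm (P z) = z \<bullet> P z"
    using inner_P[of "P z" z] by (simp add: dot_square_norm power2_eq_square)
  also have "\<dots> \<le> norm z * norm (P z)" by (rule norm_cauchy_schwarz)
  finally show ?thesis using False by simp
qed simp

lemma closed_Z: "closed Z"
proof -
  have "Z = {z. P z = z}" using in_Z_iff by auto
  moreover have "closed {z. P z = z}"
    by (intro closed_Collect_eq continuous_intros linear_continuous_on bounded_linear_P)
  ultimately show ?thesis by simp
qed

lemma basis_coefficient_le: "i \<in> {1..k} \<Longrightarrow> \<bar>z \<bullet> \<phi> i\<bar> \<le> norm z"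
proof -
  assume "i \<in> {1..k}"
  then have "norm (\<phi> i) = 1" using orthonormal[of i i] by (simp add: norm_eq_sqrt_inner)
  then show ?thesis using Cauchy_Schwarz_ineq2[of z "\<phi> i"] by simp
qed

lemma compact_Z_cball: "compact (Z \<inter> cball 0 R)"
proof -
  have "Z \<inter> cball 0 R \<subseteq> {(\<Sum>i=1..k. c i *\<^sub>R \<phi> i) | c. \<forall>i\<in>{1..k}. \<bar>c i\<bar> \<le> R}"
  proof
    fix z assume z: "z \<in> Z \<inter> cball 0 R"
    then have "z = (\<Sum>i=1..k. (z \<bullet> \<phi> i) *\<^sub>R \<phi> i)" using P_eq[of z] by simp
    moreover have "\<forall>i\<in>{1..k}. \<bar>z \<bullet> \<phi> i\<bar> \<le> R"
      using basis_coefficient_le[of _ z] z by fastforce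
    ultimately show "z \<in> {(\<Sum>i=1..k. c i *\<^sub>R \<phi> i) | c. \<forall>i\<in>{1..k}. \<bar>c i\<bar> \<le> R}"
      by (intro CollectI exI[of _ "\<lambda>i. z \<bullet> \<phi> i"] conjI)
  qed
  then have "Z \<inter> cball 0 R =
      {(\<Sum>i=1..k. c i *\<^sub>R \<phi> i) | c. \<forall>i\<in>{1..k}. \<bar>c i\<bar> \<le> R} \<inter> (Z \<inter> cball 0 R)" by blast
  moreover have "compact ({(\<Sum>i=1..k. c i *\<^sub>R \<phi> i) | c. \<forall>i\<in>{1..k}. \<bar>c i\<bar> \<le> R} \<inter> (Z \<inter> cball 0 R))"
    by (intro compact_Int_closed compact_coordinate_box closed_Int closed_Z closed_cball)
  ultimately show ?thesis by simp
qed

text \<open>\<open>arg_min_on\<close> is a choice and has the minimizing property only if a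
  minimizer exists. Beyond the radius \<open>R\<close> coercivity forces \<open>f z\<close> above
  \<open>f 0\<close>, so a minimum over the compact ball of radius \<open>R\<close> is
  global.\<close>

lemma arg_min_on_Z:
  assumes cont: "continuous_on Z f" and a: "0 < (a::real)"
    and coercive: "\<And>z. z \<in> Z \<Longrightarrow> a * norm z - b \<le> f z"
  shows "arg_min_on f Z \<in> Z \<and> (\<forall>z\<in>Z. f (arg_min_on f Z) \<le> f z)"
proof -
  define R where "R = (\<bar>f 0\<bar> + \<bar>b\<bar>) / a"
  have R: "0 \<le> R" using a by (simp add: R_def)
  have Z0: "0 \<in> Z" using subspace_Z by (rule subspace_0)
  have "\<exists>m\<in>Z \<inter> cball 0 R. \<forall>z\<in>Z \<inter> cball 0 R. f m \<le> f z"
  proof (rule continuous_attains_inf[OF compact_Z_cball])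
    show "Z \<inter> cball 0 R \<noteq> {}" using Z0 R by (auto intro!: exI[of _ 0])
    show "continuous_on (Z \<inter> cball 0 R) f" using cont by (rule continuous_on_subset) simp
  qed
  then obtain m where m: "m \<in> Z \<inter> cball 0 R" "\<And>z. z \<in> Z \<inter> cball 0 R \<Longrightarrow> f m \<le> f z" by blast
  have min: "f m \<le> f z" if "z \<in> Z" for z
  proof (cases "norm z \<le> R")
    case False
    then have "\<bar>f 0\<bar> + \<bar>b\<bar> \<le> a * norm z" using a by (simp add: R_def field_simps)
    then have "f 0 \<le> f z" using coercive[OF that] by linarith
    moreover have "f m \<le> f 0" using m(2)[of 0] Z0 R by simp
    ultimately show ?thesis by simp
  qed (use m(2) that in simp)
  have "is_arg_min f (\<lambda>x. x \<in> Z) m"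
    using m(1) min by (auto simp: is_arg_min_linorder)
  then have "is_arg_min f (\<lambda>x. x \<in> Z) (arg_min_on f Z)"
    unfolding arg_min_on_def arg_min_def by (rule someI)
  then show ?thesis by (simp add: is_arg_min_linorder)
qed

text \<open>Rounding each of the \<open>k\<close> coordinates down to a multiple of
  \<open>1 / (m * k)\<close> costs at most \<open>1 / m\<close> in total by the triangle inequality.
  The grid is wasteful, but only the logarithm of its size matters. Grid points may lie outside the
  unit ball.\<close>

lemma finite_net:
  assumes "1 \<le> k" "1 \<le> m"
  obtains \<Gamma> where "finite \<Gamma>" "\<Gamma> \<subseteq> Z" "card \<Gamma> \<le> (2 * (m * k) + 1) ^ k"
    "\<And>z. z \<in> Z \<Longrightarrow> norm z \<le> 1 \<Longrightarrow> \<exists>q\<in>\<Gamma>. norm (z - q) \<le> 1 / real m"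
proof -
  define s where "s = real m * real k"
  have s: "s > 0" using assms by (simp add: s_def)
  define A where "A = PiE {1..k} (\<lambda>_. {- int (m * k)..int (m * k)})"
  define f where "f c = (\<Sum>i=1..k. (real_of_int (c i) / s) *\<^sub>R \<phi> i)" for c :: "nat \<Rightarrow> int"
  have A: "finite A" unfolding A_def by (intro finite_PiE) auto
  have cA: "card A = (2 * (m * k) + 1) ^ k"
  proof -
    have "card {- int q..int q} = 2 * q + 1" for q by simp
    then show ?thesis unfolding A_def by (simp only: card_PiE finite_atLeastAtMost prod_constant) simp
  qed
  have card: "card (f ` A) \<le> (2 * (m * k) + 1) ^ k"
    using card_image_le[OF A, of f] unfolding cA .
  have sub: "f ` A \<subseteq> Z"
  proof
    fix q assume "q \<in> f ` A"
    then obtain c where "q = f c" by blast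
    then show "q \<in> Z"
      unfolding f_def by (simp only:) (intro subspace_sum subspace_scale subspace_Z basis_in_Z)
  qed
  have net: "\<exists>q\<in>f ` A. norm (z - q) \<le> 1 / real m" if z: "z \<in> Z" "norm z \<le> 1" for z
  proof -
    define c where "c = restrict (\<lambda>i. \<lfloor>s * (z \<bullet> \<phi> i)\<rfloor>) {1..k}"
    have co: "\<bar>z \<bullet> \<phi> i\<bar> \<le> 1" if "i \<in> {1..k}" for i using basis_coefficient_le[OF that, of z] z by simp
    have "c \<in> A"
      unfolding A_def c_def
    proof (intro restrict_PiE_iff[THEN iffD2] ballI)
      fix i assume "i \<in> {1..k}"
      from co[OF this] s have "s * (z \<bullet> \<phi> i) \<le> s" "- s \<le> s * (z \<bullet> \<phi> i)"
        using mult_left_mono[of "z \<bullet> \<phi> i" 1 s] mult_left_mono[of "-1" "z \<bullet> \<phi> i" s]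
        by (auto simp: abs_le_iff)
      moreover have "s = real_of_int (int (m * k))" by (simp add: s_def)
      ultimately show "\<lfloor>s * (z \<bullet> \<phi> i)\<rfloor> \<in> {- int (m * k)..int (m * k)}"
        by (simp add: le_floor_iff floor_le_iff)
    qed
    moreover have "norm (z - f c) \<le> 1 / real m"
    proof -
      have "z - f c = (\<Sum>i=1..k. (z \<bullet> \<phi> i) *\<^sub>R \<phi> i) - f c" using P_eq[of z] z by simp
      also have "\<dots> = (\<Sum>i=1..k. (z \<bullet> \<phi> i - real_of_int \<lfloor>s * (z \<bullet> \<phi> i)\<rfloor> / s) *\<^sub>R \<phi> i)"
        unfolding f_def c_def sum_subtractf[symmetric] by (intro sum.cong) (auto simp: algebra_simps)
      finally have "norm (z - f c)
          \<le> (\<Sum>i=1..k. norm ((z \<bullet> \<phi> i - real_of_int \<lfloor>s * (z \<bullet> \<phi> i)\<rfloor> / s) *\<^sub>R \<phi> i))"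
        by (simp only: norm_sum)
      also have "\<dots> \<le> (\<Sum>i=1..k. 1 / s)"
      proof (rule sum_mono)
        fix i assume i: "i \<in> {1..k}"
        have "norm (\<phi> i) = 1" using orthonormal[OF i i] by (simp add: norm_eq_sqrt_inner)
        moreover have "z \<bullet> \<phi> i - real_of_int \<lfloor>s * (z \<bullet> \<phi> i)\<rfloor> / s
            = (s * (z \<bullet> \<phi> i) - real_of_int \<lfloor>s * (z \<bullet> \<phi> i)\<rfloor>) / s" using s by (simp add: field_simps)
        moreover have "\<bar>s * (z \<bullet> \<phi> i) - real_of_int \<lfloor>s * (z \<bullet> \<phi> i)\<rfloor>\<bar> \<le> 1" by linarith
        ultimately show "norm ((z \<bullet> \<phi> i - real_of_int \<lfloor>s * (z \<bullet> \<phi> i)\<rfloor> / s) *\<^sub>R \<phi> i) \<le> 1 / s"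
          using s by (simp add: divide_right_mono)
      qed
      also have "\<dots> = 1 / real m" using assms by (simp add: s_def)
      finally show ?thesis .
    qed
    ultimately show ?thesis by blast
  qed
  show thesis using that[of "f ` A"] A card sub net by blast
qed

text \<open>Dimension count: the image of the basis is independent, and a vector outside its span
  would give more independent vectors in \<open>Z\<close> than the spanning set has
  elements.\<close>

lemma linear_inj_on_imp_bij_betw_Z:
  assumes lin: "linear F" and img: "F ` Z \<subseteq> Z" and inj: "inj_on F Z"
  shows "bij_betw F Z Z"
proof -
  have ind: "independent (\<phi> ` {1..k})"
  proof (rule pairwise_orthogonal_independent)
    show "pairwise orthogonal (\<phi> ` {1..k})"
      using orthonormal by (auto simp: pairwise_def orthogonal_def split: if_splits)
    show "0 \<notin> \<phi> ` {1..k}" using orthonormal by force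
  qed
  have indF: "independent (F ` \<phi> ` {1..k})"
    using ind inj unfolding basis_span_def by (rule linear_independent_injective_image[OF lin])
  have inj': "inj_on F (\<phi> ` {1..k})"
    using inj by (rule inj_on_subset) (auto simp: basis_in_Z)
  have "F ` Z = Z"
  proof (rule antisym[OF img], rule subsetI)
    fix z assume z: "z \<in> Z"
    have "z \<in> span (F ` \<phi> ` {1..k})"
    proof (rule ccontr)
      assume n: "z \<notin> span (F ` \<phi> ` {1..k})"
      then have ins: "independent (insert z (F ` \<phi> ` {1..k}))" using indF by (rule independent_insertI)
      have sub: "insert z (F ` \<phi> ` {1..k}) \<subseteq> span (\<phi> ` {1..k})"
      proof -
        have "F ` \<phi> ` {1..k} \<subseteq> F ` Z" using basis_in_Z by (intro image_mono) blast
        then have "insert z (F ` \<phi> ` {1..k}) \<subseteq> Z" using z img by blast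
        then show ?thesis by (simp only: basis_span_def)
      qed
      have "card (insert z (F ` \<phi> ` {1..k})) \<le> card (\<phi> ` {1..k})"
        using independent_span_bound[OF _ ins sub] by simp
      moreover have "z \<notin> F ` \<phi> ` {1..k}" using n span_base[of z] by metis
      ultimately show False using card_image[OF inj'] by simp
    qed
    then show "z \<in> F ` Z" unfolding basis_span_def by (simp add: linear_span_image[OF lin])
  qed
  then show ?thesis using inj by (simp add: bij_betw_def)
qed

end

section \<open>The population problem in a fixed finite section\<close>

text \<open>All constants below depend on \<open>B\<close>, \<open>C\<close> and \<open>r\<close> only, hence not on the dimension \<open>k\<close>. The bound
  on \<open>C\<close> keeps the minimizer at distance 2 from the boundary of the ball of radius \<open>C\<close>; the larger
  radius \<open>2 * C + r\<close> leaves room for the centers of the balls in the tube estimate.\<close>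

locale spatial_model = basis_section \<phi> N k + prob_space \<mu>
  for \<phi> :: "nat \<Rightarrow> 'a::{real_inner,banach,second_countable_topology}" and N k
    and \<mu> :: "'a measure" +
  fixes u :: 'a and B C r :: real
  assumes sets_mu [measurable_cong]: "sets \<mu> = sets borel"
    and norm_u: "norm u < 1"
    and B: "0 \<le> B" and r: "0 < r"
    and C: "4 * r / (1 - norm u) + 2 \<le> C"
    and moment: "q \<in> Z \<Longrightarrow> norm q \<le> 2 * C + r \<Longrightarrow> inverse_second_moment \<mu> Z q \<le> ennreal B"
    and tail: "prob {x \<in> space \<mu>. r < norm x} \<le> (1 - norm u) / 4"
begin

lemma space_mu [simp]: "space \<mu> = UNIV"
  using sets_eq_imp_space_eq[OF sets_mu] by simp

abbreviation "S q x \<equiv> sgn (q - P x)"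

definition "G q = (\<integral>x. S q x \<partial>\<mu>) - P u"

lemma C_ge: "2 \<le> C"
  using C r norm_u divide_nonneg_pos[of "4 * r" "1 - norm u"] by linarith

lemma prob_UNIV [simp]: "prob UNIV = 1"
  using prob_space by simp

lemma integrable_S [simp]: "integrable \<mu> (S q)"
  by (rule integrable_const_bound[where B=1]) (auto simp: norm_sgn)

lemma integral_in_Z:
  assumes "integrable \<mu> f" "\<And>x. f x \<in> Z"
  shows "(\<integral>x. f x \<partial>\<mu>) \<in> Z"
proof -
  have "P (\<integral>x. f x \<partial>\<mu>) = (\<integral>x. P (f x) \<partial>\<mu>)"
    by (rule integral_bounded_linear[symmetric, OF bounded_linear_P assms(1)])
  also have "\<dots> = (\<integral>x. f x \<partial>\<mu>)" using assms(2) by simp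
  finally show ?thesis by (metis P_in_Z)
qed

lemma sgn_in_Z: "y \<in> Z \<Longrightarrow> sgn y \<in> Z"
  by (simp add: sgn_div_norm subspace_scale[OF subspace_Z])

lemma S_in_Z: "q \<in> Z \<Longrightarrow> S q x \<in> Z"
  by (intro sgn_in_Z subspace_diff subspace_Z) simp_all

lemma G_in_Z: "q \<in> Z \<Longrightarrow> G q \<in> Z"
  unfolding G_def by (intro subspace_diff subspace_Z integral_in_Z S_in_Z) simp_all

text \<open>In \<open>ennreal\<close> the inverse of 0 is infinite, so the finite moment excludes an
  atom of the projected law at \<open>q\<close>; from there on real division is harmless. The first
  inverse moment follows from \<open>t \<le> 1 + t\<^sup>2\<close>.\<close>

lemma
  assumes "q \<in> Z" "norm q \<le> 2 * C + r"
  shows AE_ne: "AE x in \<mu>. q - P x \<noteq> 0"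
    and integrable_inverse_sq: "integrable \<mu> (\<lambda>x. 1 / (norm (q - P x))\<^sup>2)"
    and integral_inverse_sq: "(\<integral>x. 1 / (norm (q - P x))\<^sup>2 \<partial>\<mu>) \<le> B"
    and integrable_inverse: "integrable \<mu> (\<lambda>x. 1 / norm (q - P x))"
    and integral_inverse: "(\<integral>x. 1 / norm (q - P x) \<partial>\<mu>) \<le> 1 + B"
proof -
  have fin: "(\<integral>\<^sup>+x. inverse (ennreal (norm (q - P x)) ^ 2) \<partial>\<mu>) \<le> ennreal B"
    using moment[OF assms] unfolding inverse_second_moment_def .
  have "AE x in \<mu>. inverse (ennreal (norm (q - P x)) ^ 2) \<noteq> \<infinity>"
    using fin by (intro nn_integral_PInf_AE) (auto simp: top_unique)
  then show ne: "AE x in \<mu>. q - P x \<noteq> 0"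
    by eventually_elim auto
  have "ennreal (1 / (norm (q - P x))\<^sup>2) \<le> inverse (ennreal (norm (q - P x)) ^ 2)" for x
  proof (cases "q - P x = 0")
    case False
    then have "0 < norm (q - P x)" by simp
    then show ?thesis by (simp add: ennreal_power inverse_ennreal inverse_eq_divide)
  qed simp
  then have nn: "(\<integral>\<^sup>+x. ennreal (1 / (norm (q - P x))\<^sup>2) \<partial>\<mu>) \<le> ennreal B"
    using fin by (meson nn_integral_mono order_trans)
  show i2: "integrable \<mu> (\<lambda>x. 1 / (norm (q - P x))\<^sup>2)"
    using nn by (intro integrableI_bounded) (auto intro: le_less_trans)
  show b2: "(\<integral>x. 1 / (norm (q - P x))\<^sup>2 \<partial>\<mu>) \<le> B"
    using nn B by (intro integral_real_bounded) auto
  have le: "1 / norm (q - P x) \<le> 1 + 1 / (norm (q - P x))\<^sup>2" for x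
  proof -
    define t where "t = 1 / norm (q - P x)"
    have "2 * t \<le> 1 + t\<^sup>2" using sum_squares_bound[of 1 t] by simp
    then have "t \<le> 1 + t\<^sup>2" using zero_le_power2[of t] by linarith
    then show ?thesis by (simp add: t_def power_one_over)
  qed
  show i1: "integrable \<mu> (\<lambda>x. 1 / norm (q - P x))"
    by (rule Bochner_Integration.integrable_bound[where f="\<lambda>x. 1 + 1 / (norm (q - P x))\<^sup>2"])
      (use i2 le in \<open>auto intro!: order_trans[OF le abs_ge_self]\<close>)
  have "(\<integral>x. 1 / norm (q - P x) \<partial>\<mu>) \<le> (\<integral>x. 1 + 1 / (norm (q - P x))\<^sup>2 \<partial>\<mu>)"
    using i1 i2 le by (intro integral_mono) auto
  also have "\<dots> \<le> 1 + B" using i2 b2 by (simp add: prob_space)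
  finally show "(\<integral>x. 1 / norm (q - P x) \<partial>\<mu>) \<le> 1 + B" .
qed

lemma G_diff: "G q' - G q = (\<integral>x. S q' x - S q x \<partial>\<mu>)"
  by (simp add: G_def)

lemma G_lipschitz:
  assumes q: "q \<in> Z" "norm q \<le> 2 * C + r"
  shows "norm (G q' - G q) \<le> 2 * (1 + B) * norm (q' - q)"
proof -
  have "norm (G q' - G q) \<le> (\<integral>x. norm (S q' x - S q x) \<partial>\<mu>)"
    unfolding G_diff by (rule integral_norm_bound)
  also have "\<dots> \<le> (\<integral>x. 2 * norm (q' - q) * (1 / norm (q - P x)) \<partial>\<mu>)"
  proof (rule integral_mono_AE)
    show "AE x in \<mu>. norm (S q' x - S q x) \<le> 2 * norm (q' - q) * (1 / norm (q - P x))"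
      using AE_ne[OF q]
    proof eventually_elim
      case (elim x)
      from norm_sgn_diff_le[OF this, of "q' - P x"] show ?case by simp
    qed
    show "integrable \<mu> (\<lambda>x. 2 * norm (q' - q) * (1 / norm (q - P x)))"
      using integrable_inverse[OF q] by (rule integrable_mult_right)
  qed (auto intro!: integrable_norm)
  also have "\<dots> = 2 * norm (q' - q) * (\<integral>x. 1 / norm (q - P x) \<partial>\<mu>)"
    by (rule integral_mult_right_zero)
  also have "\<dots> \<le> 2 * norm (q' - q) * (1 + B)"
    using integral_inverse[OF q] by (intro mult_left_mono) auto
  finally show ?thesis by (simp only: mult_ac)
qed

section \<open>The population objective and its minimizer\<close>

abbreviation "g \<equiv> spatial_objective \<mu> Z u"

lemma integrable_norm_diff: "integrable \<mu> (\<lambda>x. norm (q - P x) - norm (P x))"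
proof (rule integrable_const_bound[where B="norm q"])
  have "\<bar>norm (q - P x) - norm (P x)\<bar> \<le> norm q" for x
    using norm_triangle_ineq3[of "q - P x" "- P x"] by simp
  then show "AE x in \<mu>. norm (norm (q - P x) - norm (P x)) \<le> norm q" by simp
qed measurable

lemma objective_subgradient: "g q' - g q \<le> G q' \<bullet> (q' - q)"
proof -
  have "(\<integral>x. norm (q' - P x) - norm (P x) \<partial>\<mu>) - (\<integral>x. norm (q - P x) - norm (P x) \<partial>\<mu>)
      = (\<integral>x. (norm (q' - P x) - norm (P x)) - (norm (q - P x) - norm (P x)) \<partial>\<mu>)"
    by (rule Bochner_Integration.integral_diff[symmetric]) (rule integrable_norm_diff)+
  also have "\<dots> \<le> (\<integral>x. S q' x \<bullet> (q' - q) \<partial>\<mu>)"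
  proof (rule integral_mono)
    show "norm (q' - P x) - norm (P x) - (norm (q - P x) - norm (P x)) \<le> S q' x \<bullet> (q' - q)" for x
      using norm_diff_le_inner_sgn[of "q' - P x" "q - P x"] by simp
  qed (intro Bochner_Integration.integrable_diff integrable_norm_diff integrable_inner_left integrable_S)+
  also have "\<dots> = (\<integral>x. S q' x \<partial>\<mu>) \<bullet> (q' - q)" by (rule integral_inner_left) simp
  finally show ?thesis
    unfolding spatial_objective_def G_def by (simp add: inner_diff_left inner_diff_right)
qed

lemma norm_G_le: "norm (G q) \<le> 2"
proof -
  have "norm (\<integral>x. S q x \<partial>\<mu>) \<le> (\<integral>x. norm (S q x) \<partial>\<mu>)" by (rule integral_norm_bound)
  also have "\<dots> \<le> (\<integral>x. 1 \<partial>\<mu>)"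
    by (intro integral_mono integrable_norm integrable_S) (auto simp: norm_sgn)
  finally have "norm (\<integral>x. S q x \<partial>\<mu>) \<le> 1" by (simp add: prob_space)
  then show ?thesis
    unfolding G_def using norm_triangle_ineq4[of "\<integral>x. S q x \<partial>\<mu>" "P u"] norm_P_le[of u] norm_u by linarith
qed

lemma continuous_on_objective: "continuous_on A g"
proof -
  have "g q' - g q \<le> 2 * norm (q' - q)" for q q'
  proof -
    have "g q' - g q \<le> norm (G q') * norm (q' - q)"
      using objective_subgradient[of q' q] norm_cauchy_schwarz[of "G q'" "q' - q"] by linarith
    also have "\<dots> \<le> 2 * norm (q' - q)" by (intro mult_right_mono norm_G_le) simp
    finally show ?thesis .
  qed
  from this[of x y for x y] have "\<bar>g q' - g q\<bar> \<le> 2 * norm (q' - q)" for q q'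
    by (smt (verit) norm_minus_commute)
  then have "2-lipschitz_on A g"
    by (intro lipschitz_onI) (auto simp: dist_norm)
  then show ?thesis by (rule lipschitz_on_continuous_on)
qed

text \<open>The integrand is at least \<open>norm q - 2 * r\<close> on the ball of radius
  \<open>r\<close> and at least \<open>- norm q\<close> elsewhere. The tail bound
  \<open>(1 - norm u) / 4\<close> limits the loss to half of the slope \<open>1 - norm u\<close>
  left after subtracting the linear term.\<close>

lemma objective_coercive: "(1 - norm u) / 2 * norm q - 2 * r \<le> g q"
proof -
  define A where "A = {x \<in> space \<mu>. r < norm x}"
  have [measurable]: "A \<in> sets \<mu>" unfolding A_def by measurable
  have iA: "integrable \<mu> (indicator A :: 'a \<Rightarrow> real)"
    by (rule integrable_real_indicator) (auto simp: emeasure_eq_measure)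
  have "norm q - 2 * r - 2 * norm q * prob A = (\<integral>x. (norm q - 2 * r) - 2 * norm q * indicator A x \<partial>\<mu>)"
    using iA by (simp add: prob_space)
  also have "\<dots> \<le> (\<integral>x. norm (q - P x) - norm (P x) \<partial>\<mu>)"
  proof (rule integral_mono)
    fix x
    show "norm q - 2 * r - 2 * norm q * indicator A x \<le> norm (q - P x) - norm (P x)"
    proof (cases "x \<in> A")
      case True
      then show ?thesis using norm_triangle_ineq3[of "q - P x" "- P x"] r by simp
    next
      case False
      then have "norm (P x) \<le> r" using norm_P_le[of x] by (auto simp: A_def)
      then show ?thesis using norm_triangle_ineq2[of q "P x"] False by simp
    qed
  qed (use iA integrable_norm_diff in auto)
  finally have 1: "norm q - 2 * r - 2 * norm q * prob A \<le> (\<integral>x. norm (q - P x) - norm (P x) \<partial>\<mu>)" .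
  have "2 * norm q * prob A \<le> 2 * norm q * ((1 - norm u) / 4)"
    using tail by (intro mult_left_mono) (auto simp: A_def)
  moreover have "P u \<bullet> q \<le> norm u * norm q"
    using norm_cauchy_schwarz[of "P u" q] mult_right_mono[OF norm_P_le[of u], of "norm q"] by simp
  ultimately show ?thesis using 1 unfolding spatial_objective_def by (simp add: field_simps)
qed

abbreviation "Q0 \<equiv> spatial_quantile \<mu> Z u"

lemma Q0_in_Z: "Q0 \<in> Z" and Q0_min: "q \<in> Z \<Longrightarrow> g Q0 \<le> g q"
  using arg_min_on_Z[OF continuous_on_objective, of "(1 - norm u) / 2" "2 * r"] norm_u objective_coercive
  unfolding spatial_quantile_def by auto

lemma norm_Q0_le: "norm Q0 \<le> C - 2"
proof -
  have "(1 - norm u) / 2 * norm Q0 - 2 * r \<le> g 0"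
    using objective_coercive[of Q0] Q0_min[OF subspace_0[OF subspace_Z]] by linarith
  also have "g 0 = 0" by (simp add: spatial_objective_def)
  finally have "norm Q0 \<le> 4 * r / (1 - norm u)" using norm_u by (simp add: field_simps)
  then show ?thesis using C by linarith
qed

lemma norm_Q0_le': "norm Q0 \<le> 2 * C + r"
  using norm_Q0_le C_ge r by linarith

text \<open>Derived without differentiating \<open>g\<close>: if \<open>G Q0\<close> were nonzero, a
  short step against it would, by the Lipschitz bound, leave \<open>G\<close> in nearly the same
  direction, and the subgradient inequality at the new point would contradict minimality.\<close>

lemma G_Q0: "G Q0 = 0"
proof (rule ccontr)
  assume n: "G Q0 \<noteq> 0"
  \<comment> \<open>Half the inverse of the Lipschitz constant \<open>2 * (1 + B)\<close>, so that
    \<open>G\<close> changes by at most half its norm along the step.\<close>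
  define t where "t = 1 / (4 * (1 + B))"
  have t: "t > 0" using B by (simp add: t_def)
  define v where "v = - t *\<^sub>R G Q0"
  have "0 \<le> g (Q0 + v) - g Q0"
    using Q0_min[of "Q0 + v"] Q0_in_Z G_in_Z subspace_Z
    by (simp add: v_def subspace_add subspace_diff subspace_scale)
  also have "\<dots> \<le> G (Q0 + v) \<bullet> v" using objective_subgradient[of "Q0 + v" Q0] by simp
  also have "\<dots> = - t * (G (Q0 + v) \<bullet> G Q0)" by (simp add: v_def)
  finally have "G (Q0 + v) \<bullet> G Q0 \<le> 0" using t by (simp add: mult_le_0_iff)
  then have "G Q0 \<bullet> G Q0 \<le> - ((G (Q0 + v) - G Q0) \<bullet> G Q0)"
    by (simp add: inner_diff_left)
  also have "\<dots> \<le> norm (G (Q0 + v) - G Q0) * norm (G Q0)"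
    using Cauchy_Schwarz_ineq2[of "G (Q0 + v) - G Q0" "G Q0"] by linarith
  also have "\<dots> \<le> (2 * (1 + B) * norm v) * norm (G Q0)"
    using G_lipschitz[OF Q0_in_Z norm_Q0_le', of "Q0 + v"] by (intro mult_right_mono) auto
  also have "\<dots> = 1 / 2 * (G Q0 \<bullet> G Q0)"
    using t B by (simp add: v_def t_def dot_square_norm power2_eq_square field_simps)
  finally show False using n by simp
qed

section \<open>Mass near lines and strong monotonicity\<close>

definition "T = C + r"
text \<open>An integer fraction of \<open>T\<close>, so that finitely many multiples of it reach
  exactly from \<open>-T\<close> to \<open>T\<close>. The term \<open>64 * T\<^sup>2 * B\<close> in
  the denominator makes the covering balls carry mass at most 1/4; the added 1 keeps it positive
  when \<open>B = 0\<close>.\<close>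

definition "width = T / real (nat \<lceil>64 * T\<^sup>2 * B\<rceil> + 1)"
definition "ell = width\<^sup>2 / 2 / T ^ 3"

lemma T_pos: "0 < T"
  using C_ge r by (simp add: T_def)

lemma width_pos: "0 < width"
  using T_pos by (simp add: width_def)

lemma ell_pos: "0 < ell"
  using T_pos width_pos by (simp add: ell_def)

text \<open>The Gram determinant of \<open>h\<close> and \<open>y\<close>; for unit
  \<open>h\<close>, the squared distance of \<open>y\<close> from the line spanned by
  \<open>h\<close>.\<close>

abbreviation "area2 h y \<equiv> (norm h)\<^sup>2 * (norm y)\<^sup>2 - (h \<bullet> y)\<^sup>2"

lemma area2_nonneg: "0 \<le> area2 h y" for h y :: 'a
  using power_mono[OF Cauchy_Schwarz_ineq2[of h y], of 2] by (simp add: power_mult_distrib)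

text \<open>Markov's inequality for the inverse square of the distance. The quadratic decay in
  \<open>s\<close> outweighs the number of balls along a line, which grows only like
  \<open>1 / s\<close>.\<close>

lemma prob_ball:
  assumes q: "q \<in> Z" "norm q \<le> 2 * C + r" and s: "0 < s"
  shows "prob {x \<in> space \<mu>. norm (q - P x) < s} \<le> s\<^sup>2 * B"
proof -
  have "prob {x \<in> space \<mu>. norm (q - P x) < s} = (\<integral>x. indicator {x \<in> space \<mu>. norm (q - P x) < s} x \<partial>\<mu>)"
    by simp
  also have "\<dots> \<le> (\<integral>x. s\<^sup>2 * (1 / (norm (q - P x))\<^sup>2) \<partial>\<mu>)"
  proof (rule integral_mono_AE)
    show "AE x in \<mu>. indicator {x \<in> space \<mu>. norm (q - P x) < s} x \<le> s\<^sup>2 * (1 / (norm (q - P x))\<^sup>2)"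
      using AE_ne[OF q]
    proof eventually_elim
      case (elim x)
      then have p: "0 < norm (q - P x)" by simp
      show ?case
      proof (cases "norm (q - P x) < s")
        case True
        then have "(norm (q - P x))\<^sup>2 \<le> s\<^sup>2" using p by (intro power_mono) auto
        then have "(norm (q - P x))\<^sup>2 / (norm (q - P x))\<^sup>2 \<le> s\<^sup>2 / (norm (q - P x))\<^sup>2"
          by (rule divide_right_mono) simp
        then show ?thesis using p True by simp
      qed simp
    qed
    show "integrable \<mu> (indicator {x \<in> space \<mu>. norm (q - P x) < s} :: 'a \<Rightarrow> real)"
      by (rule integrable_real_indicator) (auto simp: emeasure_eq_measure)
  qed (use integrable_inverse_sq[OF q] in \<open>rule integrable_mult_right\<close>)
  also have "\<dots> = s\<^sup>2 * (\<integral>x. 1 / (norm (q - P x))\<^sup>2 \<partial>\<mu>)" by (rule integral_mult_right_zero)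
  also have "\<dots> \<le> s\<^sup>2 * B" using integral_inverse_sq[OF q] by (intro mult_left_mono) auto
  finally show ?thesis .
qed

abbreviation "core \<equiv> {x. norm x \<le> r}"

lemma norm_core: "norm q \<le> C \<Longrightarrow> x \<in> core \<Longrightarrow> norm (q - P x) \<le> T"
  using norm_triangle_ineq4[of q "P x"] norm_P_le[of x] by (simp add: T_def)

lemma integrable_area2:
  assumes "norm q \<le> C"
  shows "integrable \<mu> (\<lambda>x. indicator core x * area2 h (q - P x))"
proof (rule integrable_const_bound[where B="(norm h)\<^sup>2 * T\<^sup>2"])
  show "AE x in \<mu>. norm (indicator core x * area2 h (q - P x)) \<le> (norm h)\<^sup>2 * T\<^sup>2"
  proof (rule AE_I2)
    fix x
    show "norm (indicator core x * area2 h (q - P x)) \<le> (norm h)\<^sup>2 * T\<^sup>2"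
    proof (cases "x \<in> core")
      case True
      have "area2 h (q - P x) \<le> (norm h)\<^sup>2 * (norm (q - P x))\<^sup>2" by simp
      also have "\<dots> \<le> (norm h)\<^sup>2 * T\<^sup>2"
        using norm_core[OF assms True] by (intro mult_left_mono power_mono) auto
      finally show ?thesis using True area2_nonneg[of h "q - P x"] by simp
    qed simp
  qed
qed measurable

text \<open>A tube of radius \<open>width\<close> around the line \<open>q + \<real> h\<close> meets the ball of radius \<open>r\<close> in a set
  covered by \<open>O(T / width)\<close> balls of radius \<open>2 width\<close>, each of mass \<open>O(width\<^sup>2)\<close> by the inverse
  second moment; hence half of the mass stays away from that line.\<close>

lemma tube_estimate_unit:
  assumes q: "q \<in> Z" "norm q \<le> C" and h: "h \<in> Z" "norm h = 1"
  shows "width\<^sup>2 / 2 \<le> (\<integral>x. indicator core x * area2 h (q - P x) \<partial>\<mu>)"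
proof -
  define m where "m = nat \<lceil>64 * T\<^sup>2 * B\<rceil> + 1"
  define s where "s = T / real m"
  have sw: "s = width" by (simp add: s_def width_def m_def)
  have m: "m \<ge> 1" "64 * T\<^sup>2 * B \<le> real m" unfolding m_def by (simp, linarith)
  have s: "s > 0" using T_pos m by (simp add: s_def)
  have ms: "real m * s = T" using m by (simp add: s_def)
  define D where "D j = {x \<in> space \<mu>. norm (q - (real_of_int j * s) *\<^sub>R h - P x) < 2 * s}" for j :: int
  define A where "A = {x \<in> space \<mu>. r < norm x}"
  have [measurable]: "D j \<in> sets \<mu>" "A \<in> sets \<mu>" for j unfolding D_def A_def by measurable
  have pD: "prob (D j) \<le> 4 * s\<^sup>2 * B" if j: "j \<in> {- int m..int m}" for j
  proof -
    have jm: "\<bar>real_of_int j\<bar> \<le> real m" using j by auto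
    have "norm (q - (real_of_int j * s) *\<^sub>R h) \<le> norm q + norm ((real_of_int j * s) *\<^sub>R h)"
      by (rule norm_triangle_ineq4)
    also have "\<dots> \<le> C + real m * s"
      using q(2) h(2) s jm by (intro add_mono) (auto simp: abs_mult)
    finally have "norm (q - (real_of_int j * s) *\<^sub>R h) \<le> 2 * C + r" by (simp add: ms T_def)
    moreover have "q - (real_of_int j * s) *\<^sub>R h \<in> Z"
      using q h subspace_Z by (simp add: subspace_diff subspace_scale)
    ultimately show ?thesis
      unfolding D_def using prob_ball[of "q - (real_of_int j * s) *\<^sub>R h" "2 * s"] s
      by (simp add: power_mult_distrib)
  qed
  define U where "U = (\<Union>j\<in>{- int m..int m}. D j)"
  have [measurable]: "U \<in> sets \<mu>" unfolding U_def by measurable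
  have "prob U \<le> (\<Sum>j\<in>{- int m..int m}. prob (D j))"
    unfolding U_def by (rule finite_measure_subadditive_finite) auto
  also have "\<dots> \<le> real (card {- int m..int m}) * (4 * s\<^sup>2 * B)" using pD by (rule sum_bounded_above)
  also have "\<dots> = (2 * real m + 1) * (4 * s\<^sup>2 * B)" by simp
  also have "\<dots> \<le> (3 * real m) * (4 * s\<^sup>2 * B)"
    using m(1) B s by (intro mult_right_mono mult_nonneg_nonneg) auto
  also have "\<dots> = 12 * (T\<^sup>2 * B) / real m"
    using m(1) by (simp add: s_def power2_eq_square)
  also have "\<dots> \<le> 1 / 4" using m by (simp add: field_simps)
  finally have pU: "prob U \<le> 1 / 4" .
  have "prob A \<le> 1 / 4"
    by (rule order_trans[OF tail[folded A_def]]) simp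
  then have "prob (A \<union> U) \<le> 1 / 2"
    using pU measure_Un_le[of A \<mu> U] by simp
  then have "1 / 2 \<le> prob (space \<mu> - (A \<union> U))"
    by (subst prob_compl) auto
  then have "s\<^sup>2 / 2 \<le> s\<^sup>2 * prob (space \<mu> - (A \<union> U))"
    using mult_left_mono[of "1/2" _ "s\<^sup>2"] by fastforce
  also have "\<dots> = (\<integral>x. s\<^sup>2 * indicator (space \<mu> - (A \<union> U)) x \<partial>\<mu>)" by simp
  also have "\<dots> \<le> (\<integral>x. indicator core x * area2 h (q - P x) \<partial>\<mu>)"
  proof (rule integral_mono)
    show "integrable \<mu> (\<lambda>x. indicator core x * area2 h (q - P x))" by (rule integrable_area2[OF q(2)])
    show "integrable \<mu> (\<lambda>x. s\<^sup>2 * indicator (space \<mu> - (A \<union> U)) x)"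
      by (intro integrable_mult_right integrable_real_indicator) (auto simp: emeasure_eq_measure)
    fix x
    show "s\<^sup>2 * indicator (space \<mu> - (A \<union> U)) x \<le> indicator core x * area2 h (q - P x)"
    proof (cases "x \<in> A \<union> U")
      case False
      then have xc: "x \<in> core" by (auto simp: A_def)
      define y where "y = q - P x"
      \<comment> \<open>\<open>t\<close> locates the foot of \<open>y\<close> on the line. A
        covering center \<open>j * s\<close> lies within \<open>s\<close> of the foot, so avoiding
        the ball of radius \<open>2 * s\<close> around it keeps \<open>y\<close> at distance at
        least \<open>s\<close> from the line.\<close>
      define t where "t = h \<bullet> y"
      have "\<bar>t\<bar> \<le> T"
        using Cauchy_Schwarz_ineq2[of h y] norm_core[OF q(2) xc] h(2) by (simp add: t_def y_def)
      then have "- real m \<le> t / s" "t / s \<le> real m"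
        using s ms by (auto simp: field_simps abs_le_iff)
      then have j: "\<lfloor>t / s\<rfloor> \<in> {- int m..int m}" by (auto simp: le_floor_iff floor_le_iff)
      define j where "j = \<lfloor>t / s\<rfloor>"
      have "x \<notin> D j" using False j by (auto simp: U_def j_def)
      then have d: "2 * s \<le> norm (y - (real_of_int j * s) *\<^sub>R h)"
        by (simp add: D_def y_def algebra_simps)
      have "\<bar>t / s - real_of_int j\<bar> \<le> 1" unfolding j_def by linarith
      then have ts: "\<bar>t - real_of_int j * s\<bar> \<le> s" using s
        by (simp add: field_simps abs_le_iff)
      have "norm (y - (real_of_int j * s) *\<^sub>R h) \<le> norm (y - t *\<^sub>R h) + norm ((t - real_of_int j * s) *\<^sub>R h)"
        using norm_triangle_ineq[of "y - t *\<^sub>R h" "(t - real_of_int j * s) *\<^sub>R h"] by (simp add: algebra_simps)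
      then have "s \<le> norm (y - t *\<^sub>R h)" using d ts h(2) by simp
      then have "s\<^sup>2 \<le> (norm (y - t *\<^sub>R h))\<^sup>2" using s by (intro power_mono) auto
      also have "\<dots> = area2 h y"
      proof -
        have "h \<bullet> h = 1" using h(2) by (simp add: dot_square_norm)
        then show ?thesis
          unfolding power2_norm_eq_inner t_def
          by (simp add: inner_diff_left inner_diff_right inner_commute[of y h] power2_eq_square)
      qed
      finally show ?thesis using xc False by (simp add: y_def)
    qed (use area2_nonneg[of h "q - P x"] in \<open>auto simp: indicator_def\<close>)
  qed
  finally show ?thesis by (simp add: sw)
qed

lemma tube_estimate:
  assumes q: "q \<in> Z" "norm q \<le> C" and h: "h \<in> Z"
  shows "(norm h)\<^sup>2 * (width\<^sup>2 / 2) \<le> (\<integral>x. indicator core x * area2 h (q - P x) \<partial>\<mu>)"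
proof (cases "h = 0")
  case False
  have a: "area2 h y = (norm h)\<^sup>2 * area2 (sgn h) y" for y
  proof -
    have "h \<bullet> y = norm h * (sgn h \<bullet> y)" using False by (simp add: sgn_div_norm)
    then show ?thesis using False by (simp add: norm_sgn power_mult_distrib algebra_simps)
  qed
  have "width\<^sup>2 / 2 \<le> (\<integral>x. indicator core x * area2 (sgn h) (q - P x) \<partial>\<mu>)"
    using tube_estimate_unit[OF q sgn_in_Z[OF h]] False by (simp add: norm_sgn)
  then have "(norm h)\<^sup>2 * (width\<^sup>2 / 2) \<le> (norm h)\<^sup>2 * (\<integral>x. indicator core x * area2 (sgn h) (q - P x) \<partial>\<mu>)"
    by (rule mult_left_mono) simp
  also have "\<dots> = (\<integral>x. (norm h)\<^sup>2 * (indicator core x * area2 (sgn h) (q - P x)) \<partial>\<mu>)" by simp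
  also have "\<dots> = (\<integral>x. indicator core x * area2 h (q - P x) \<partial>\<mu>)"
    unfolding a[of "q - P x" for x] by (simp add: mult_ac)
  finally show ?thesis .
qed simp

text \<open>On the core the pointwise bound \<open>inner_sgn_diff_ge\<close> applies with radius
  \<open>T\<close>, and its area term involves only the point \<open>q\<close> and the direction
  \<open>q - q'\<close>, as the tube estimate requires. Off the core monotonicity of
  \<open>sgn\<close> suffices.\<close>

lemma G_strongly_monotone:
  assumes q: "q \<in> Z" "norm q \<le> C" and q': "q' \<in> Z" "norm q' \<le> C"
  shows "ell * (norm (q - q'))\<^sup>2 \<le> (G q - G q') \<bullet> (q - q')"
proof -
  have "ell * (norm (q - q'))\<^sup>2 = ((norm (q - q'))\<^sup>2 * (width\<^sup>2 / 2)) / T ^ 3" by (simp add: ell_def)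
  also have "\<dots> \<le> (\<integral>x. indicator core x * area2 (q - q') (q - P x) \<partial>\<mu>) / T ^ 3"
    using tube_estimate[OF q subspace_diff[OF subspace_Z q(1) q'(1)]] T_pos
    by (intro divide_right_mono) auto
  also have "\<dots> = (\<integral>x. indicator core x * area2 (q - q') (q - P x) / T ^ 3 \<partial>\<mu>)" by simp
  also have "\<dots> \<le> (\<integral>x. (S q x - S q' x) \<bullet> (q - q') \<partial>\<mu>)"
  proof (rule integral_mono)
    show "integrable \<mu> (\<lambda>x. indicator core x * area2 (q - q') (q - P x) / T ^ 3)"
      using integrable_area2[OF q(2)] by (rule integrable_divide)
    fix x
    show "indicator core x * area2 (q - q') (q - P x) / T ^ 3 \<le> (S q x - S q' x) \<bullet> (q - q')"
    proof (cases "x \<in> core")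
      case True
      from inner_sgn_diff_ge[OF norm_core[OF q(2) True] norm_core[OF q'(2) True] T_pos]
      show ?thesis using True by simp
    next
      case False
      then show ?thesis
        using inner_sgn_le_norm[of "q - P x" "q' - P x"] inner_sgn_le_norm[of "q' - P x" "q - P x"]
          inner_sgn_self[of "q - P x"] inner_sgn_self[of "q' - P x"]
        by (simp add: inner_diff_left inner_diff_right)
    qed
  qed (auto intro!: integrable_inner_left)
  also have "\<dots> = (\<integral>x. S q x - S q' x \<partial>\<mu>) \<bullet> (q - q')" by (rule integral_inner_left) simp
  finally show ?thesis by (simp add: G_diff)
qed

section \<open>The Hessian at the population minimizer\<close>

definition "J h = (\<integral>x. sgn_deriv (Q0 - P x) h \<partial>\<mu>)"

lemma integrable_sgn_deriv: "integrable \<mu> (\<lambda>x. sgn_deriv (Q0 - P x) h)"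
proof (rule Bochner_Integration.integrable_bound)
  show "integrable \<mu> (\<lambda>x. 2 * norm h * (1 / norm (Q0 - P x)))"
    using integrable_inverse[OF Q0_in_Z norm_Q0_le'] by (rule integrable_mult_right)
  show "(\<lambda>x. sgn_deriv (Q0 - P x) h) \<in> borel_measurable \<mu>" unfolding sgn_deriv_def by measurable
qed (auto intro!: AE_I2 order_trans[OF norm_sgn_deriv_le])

lemma linear_J: "linear J"
  by (rule linearI) (simp_all add: J_def linear_add[OF linear_sgn_deriv] linear_scale[OF linear_sgn_deriv]
      integrable_sgn_deriv)

lemma J_in_Z: "h \<in> Z \<Longrightarrow> J h \<in> Z"
  unfolding J_def
  by (intro integral_in_Z integrable_sgn_deriv)
    (simp add: sgn_deriv_def subspace_diff subspace_scale subspace_Z Q0_in_Z)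

lemma J_inner: "J h \<bullet> v = spatial_hessian \<mu> Z Q0 h v"
proof -
  have "J h \<bullet> v = (\<integral>x. sgn_deriv (Q0 - P x) h \<bullet> v \<partial>\<mu>)"
    unfolding J_def by (rule integral_inner_left[symmetric]) (rule integrable_sgn_deriv)
  also have "\<dots> = spatial_hessian \<mu> Z Q0 h v"
    unfolding spatial_hessian_def
    by (rule Bochner_Integration.integral_cong) (simp_all only: inner_sgn_deriv)
  finally show ?thesis .
qed

text \<open>Justifies the definite description: the vector-valued integral \<open>J h\<close>
  provides existence, and elements of \<open>Z\<close> are determined by their inner products with
  \<open>Z\<close>.\<close>

lemma hessian_operator_eq: "h \<in> Z \<Longrightarrow> hessian_operator \<mu> Z Q0 h = J h"
  unfolding hessian_operator_def
  by (rule the_equality) (auto simp: J_in_Z J_inner intro!: eq_in_Z)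

lemma J_coercive:
  assumes h: "h \<in> Z"
  shows "ell * norm h \<le> norm (J h)"
proof (cases "h = 0")
  case False
  have nQ: "norm Q0 \<le> C" using norm_Q0_le by simp
  have "ell * (norm h)\<^sup>2 = ((norm h)\<^sup>2 * (width\<^sup>2 / 2)) / T ^ 3" by (simp add: ell_def)
  also have "\<dots> \<le> (\<integral>x. indicator core x * area2 h (Q0 - P x) \<partial>\<mu>) / T ^ 3"
    using tube_estimate[OF Q0_in_Z nQ h] T_pos by (intro divide_right_mono) auto
  also have "\<dots> = (\<integral>x. indicator core x * area2 h (Q0 - P x) / T ^ 3 \<partial>\<mu>)" by simp
  also have "\<dots> \<le> (\<integral>x. sgn_deriv (Q0 - P x) h \<bullet> h \<partial>\<mu>)"
  proof (rule integral_mono)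
    show "integrable \<mu> (\<lambda>x. indicator core x * area2 h (Q0 - P x) / T ^ 3)"
      using integrable_area2[OF nQ] by (rule integrable_divide)
    show "indicator core x * area2 h (Q0 - P x) / T ^ 3 \<le> sgn_deriv (Q0 - P x) h \<bullet> h" for x
    proof (cases "x \<in> core \<and> Q0 - P x \<noteq> 0")
      case True
      then have "0 < norm (Q0 - P x)" "norm (Q0 - P x) \<le> T" using norm_core[OF nQ] by auto
      then have "area2 h (Q0 - P x) / T ^ 3 \<le> area2 h (Q0 - P x) / norm (Q0 - P x) ^ 3"
        by (intro divide_left_mono area2_nonneg power_mono) (auto simp: T_pos)
      then show ?thesis using True by (simp add: inner_sgn_deriv_self)
    qed (auto simp: inner_sgn_deriv_self intro!: divide_nonneg_nonneg area2_nonneg)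
  qed (auto intro!: integrable_inner_left integrable_sgn_deriv)
  also have "\<dots> = J h \<bullet> h" unfolding J_def by (rule integral_inner_left) (rule integrable_sgn_deriv)
  also have "\<dots> \<le> norm (J h) * norm h" by (rule norm_cauchy_schwarz)
  finally show ?thesis using False by (simp add: power2_eq_square)
qed simp

lemma bij_betw_J: "bij_betw J Z Z"
proof (rule linear_inj_on_imp_bij_betw_Z[OF linear_J])
  show "J ` Z \<subseteq> Z" using J_in_Z by auto
  show "inj_on J Z"
  proof (rule inj_onI)
    fix a b assume ab: "a \<in> Z" "b \<in> Z" "J a = J b"
    then have "J (a - b) = 0" by (simp add: linear_diff[OF linear_J])
    then show "a = b"
      using J_coercive[OF subspace_diff[OF subspace_Z ab(1,2)]] ell_pos by (simp add: mult_le_0_iff)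
  qed
qed

text \<open>The pointwise expansion of \<open>sgn\<close> around \<open>Q0 - P x\<close> holds for
  increments of any size, so \<open>q\<close> is unrestricted and integration costs exactly the
  inverse second moment at \<open>Q0\<close>. The zeroth-order term is absent by
  \<open>G_Q0\<close>.\<close>

lemma G_second_order:
  "norm (G q - J (q - Q0)) \<le> 4 * B * (norm (q - Q0))\<^sup>2"
proof -
  have eq: "(G q - G Q0) - J (q - Q0) = (\<integral>x. (S q x - S Q0 x) - sgn_deriv (Q0 - P x) (q - Q0) \<partial>\<mu>)"
    unfolding G_diff J_def
    by (rule Bochner_Integration.integral_diff[symmetric]) (simp_all add: integrable_sgn_deriv)
  have "norm (G q - J (q - Q0)) \<le> (\<integral>x. norm ((S q x - S Q0 x) - sgn_deriv (Q0 - P x) (q - Q0)) \<partial>\<mu>)"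
    using integral_norm_bound[of \<mu> "\<lambda>x. (S q x - S Q0 x) - sgn_deriv (Q0 - P x) (q - Q0)"]
    unfolding eq[symmetric] by (simp add: G_Q0)
  also have "\<dots> \<le> (\<integral>x. 4 * (norm (q - Q0))\<^sup>2 * (1 / (norm (Q0 - P x))\<^sup>2) \<partial>\<mu>)"
  proof (rule integral_mono_AE)
    show "AE x in \<mu>. norm ((S q x - S Q0 x) - sgn_deriv (Q0 - P x) (q - Q0))
        \<le> 4 * (norm (q - Q0))\<^sup>2 * (1 / (norm (Q0 - P x))\<^sup>2)"
      using AE_ne[OF Q0_in_Z norm_Q0_le']
    proof eventually_elim
      case (elim x)
      from norm_sgn_second_order[OF this, of "q - P x"] show ?case by (simp add: sgn_deriv_def)
    qed
    show "integrable \<mu> (\<lambda>x. norm ((S q x - S Q0 x) - sgn_deriv (Q0 - P x) (q - Q0)))"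
      by (intro integrable_norm Bochner_Integration.integrable_diff integrable_sgn_deriv integrable_S)
  qed (use integrable_inverse_sq[OF Q0_in_Z norm_Q0_le'] in \<open>rule integrable_mult_right\<close>)
  also have "\<dots> = 4 * (norm (q - Q0))\<^sup>2 * (\<integral>x. 1 / (norm (Q0 - P x))\<^sup>2 \<partial>\<mu>)"
    by (rule integral_mult_right_zero)
  also have "\<dots> \<le> 4 * (norm (q - Q0))\<^sup>2 * B"
    using integral_inverse_sq[OF Q0_in_Z norm_Q0_le'] by (intro mult_left_mono) auto
  finally show ?thesis by (simp add: mult_ac)
qed

end

section \<open>The sample problem\<close>

context spatial_model
begin

lemma score_eq: "spatial_score Z u q x = S q x - P u"
  by (simp add: spatial_score_def sgn_div_norm)

text \<open>One selection from the subdifferential of the sample objective: a summand with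
  \<open>q = P (x i)\<close> contributes 0.\<close>

definition "Gn n x q = (1 / real n) *\<^sub>R (\<Sum>i=1..n. S q (x i)) - P u" for x :: "nat \<Rightarrow> 'a"

abbreviation "gn n x \<equiv> sample_objective Z u n x" for x :: "nat \<Rightarrow> 'a"
abbreviation "Qn n x \<equiv> sample_quantile Z u n x" for x :: "nat \<Rightarrow> 'a"

lemma Gn_in_Z: "q \<in> Z \<Longrightarrow> Gn n x q \<in> Z"
  unfolding Gn_def by (intro subspace_diff subspace_scale subspace_sum subspace_Z S_in_Z) simp_all

lemma sample_objective_subgradient:
  "gn n x q' - gn n x q \<le> Gn n x q' \<bullet> (q' - q)"
proof -
  have "(\<Sum>i=1..n. norm (q' - P (x i)) - norm (P (x i))) - (\<Sum>i=1..n. norm (q - P (x i)) - norm (P (x i)))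
      = (\<Sum>i=1..n. norm (q' - P (x i)) - norm (q - P (x i)))"
    unfolding sum_subtractf[symmetric] by simp
  also have "\<dots> \<le> (\<Sum>i=1..n. S q' (x i) \<bullet> (q' - q))"
    using norm_diff_le_inner_sgn[of "q' - P (x i)" "q - P (x i)" for i] by (intro sum_mono) simp
  finally have "((\<Sum>i=1..n. norm (q' - P (x i)) - norm (P (x i))) - (\<Sum>i=1..n. norm (q - P (x i)) - norm (P (x i)))) / real n
      \<le> (\<Sum>i=1..n. S q' (x i) \<bullet> (q' - q)) / real n" by (rule divide_right_mono) simp
  moreover have "Gn n x q' \<bullet> (q' - q) = (\<Sum>i=1..n. S q' (x i) \<bullet> (q' - q)) / real n - P u \<bullet> (q' - q)"
    unfolding Gn_def inner_diff_left[of _ "P u"] by (simp add: inner_sum_left)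
  ultimately show ?thesis
    unfolding sample_objective_def by (simp add: diff_divide_distrib inner_diff_right)
qed

lemma
  assumes n: "1 \<le> n"
  shows Qn_in_Z: "Qn n x \<in> Z" and Qn_min: "q \<in> Z \<Longrightarrow> gn n x (Qn n x) \<le> gn n x q"
proof -
  have "(1 - norm u) * norm q - (\<Sum>i=1..n. 2 * norm (P (x i))) / real n \<le> gn n x q" for q
  proof -
    have "real n * norm q - (\<Sum>i=1..n. 2 * norm (P (x i))) = (\<Sum>i=1..n. norm q - 2 * norm (P (x i)))"
      by (simp add: sum_subtractf)
    also have "\<dots> \<le> (\<Sum>i=1..n. norm (q - P (x i)) - norm (P (x i)))"
      using norm_triangle_ineq2[of q "P (x i)" for i] by (intro sum_mono) (simp add: algebra_simps)
    finally have "(real n * norm q - (\<Sum>i=1..n. 2 * norm (P (x i)))) / real n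
        \<le> (\<Sum>i=1..n. norm (q - P (x i)) - norm (P (x i))) / real n" by (rule divide_right_mono) simp
    moreover have "(real n * norm q - (\<Sum>i=1..n. 2 * norm (P (x i)))) / real n
        = norm q - (\<Sum>i=1..n. 2 * norm (P (x i))) / real n" using n by (simp add: diff_divide_distrib)
    moreover have "P u \<bullet> q \<le> norm u * norm q"
      using norm_cauchy_schwarz[of "P u" q] mult_right_mono[OF norm_P_le[of u], of "norm q"] by simp
    ultimately show ?thesis unfolding sample_objective_def by (simp add: left_diff_distrib)
  qed
  moreover have "continuous_on Z (gn n x)"
    unfolding sample_objective_def by (intro continuous_intros) (use n in auto)
  ultimately show "Qn n x \<in> Z" "q \<in> Z \<Longrightarrow> gn n x (Qn n x) \<le> gn n x q"
    using arg_min_on_Z[of "gn n x" "1 - norm u"] norm_u unfolding sample_quantile_def by auto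
qed

section \<open>Deterministic bound on the remainder\<close>

definition "remainder n x = Qn n x - Q0
  + (1 / real n) *\<^sub>R (\<Sum>i=1..n. inv_into Z (hessian_operator \<mu> Z Q0) (spatial_score Z u Q0 (x i)))"
  for x :: "nat \<Rightarrow> 'a"

lemma bij_betw_hessian_operator: "bij_betw (hessian_operator \<mu> Z Q0) Z Z"
  using bij_betw_J bij_betw_cong[of Z "hessian_operator \<mu> Z Q0" J Z] hessian_operator_eq by simp

text \<open>Applying \<open>J\<close> removes the inverses from the average, so the remainder can be
  bounded by coercivity of \<open>J\<close>.\<close>

lemma J_remainder:
  assumes n: "1 \<le> n"
  shows "remainder n x \<in> Z" "J (remainder n x) = J (Qn n x - Q0) + Gn n x Q0"
proof -
  define I where "I w = inv_into Z (hessian_operator \<mu> Z Q0) w" for w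
  have sZ: "spatial_score Z u Q0 y \<in> Z" for y
    unfolding score_eq by (intro subspace_diff subspace_Z S_in_Z Q0_in_Z) simp
  have img: "hessian_operator \<mu> Z Q0 ` Z = Z" using bij_betw_hessian_operator by (simp add: bij_betw_def)
  have I: "I w \<in> Z" "J (I w) = w" if "w \<in> Z" for w
  proof -
    show "I w \<in> Z" unfolding I_def using that img by (intro inv_into_into) simp
    then show "J (I w) = w"
      using hessian_operator_eq[of "I w"] f_inv_into_f[of w "hessian_operator \<mu> Z Q0" Z] that img
      by (simp add: I_def)
  qed
  show "remainder n x \<in> Z"
    unfolding remainder_def I_def[symmetric]
    by (intro subspace_add subspace_diff subspace_scale subspace_sum subspace_Z I sZ Qn_in_Z Q0_in_Z n)
  have "J (remainder n x) = J (Qn n x - Q0) + (1 / real n) *\<^sub>R (\<Sum>i=1..n. J (I (spatial_score Z u Q0 (x i))))"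
    unfolding remainder_def I_def[symmetric]
    by (simp add: linear_add[OF linear_J] linear_scale[OF linear_J] linear_sum[OF linear_J])
  also have "(1 / real n) *\<^sub>R (\<Sum>i=1..n. J (I (spatial_score Z u Q0 (x i)))) = Gn n x Q0"
    unfolding I(2)[OF sZ]
    using n by (simp add: score_eq Gn_def sum_subtractf scaleR_diff_right sum_constant_scaleR)
  finally show "J (remainder n x) = J (Qn n x - Q0) + Gn n x Q0" .
qed

text \<open>No probability is left here: given the two deviation bounds, convexity and strong
  monotonicity do the rest. In \<open>D\<close>, the factor 6 is 3 from the deviation bound
  \<open>3 * K * L\<close> at the comparison point times 2, because that point is the midpoint
  between the two minimizers.\<close>

lemma remainder_bound:
  assumes n: "1 \<le> n" and L: "0 < L" "L \<le> 1 / 2" and K: "0 < K" "12 * K * L \<le> ell"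
    and A: "norm (Gn n x Q0 - G Q0) \<le> K * L"
    and B': "\<And>q. q \<in> Z \<Longrightarrow> norm (q - Q0) \<le> 1 \<Longrightarrow>
      norm ((Gn n x q - G q) - (Gn n x Q0 - G Q0)) \<le> K * (norm (q - Q0) * L + L\<^sup>2)"
  defines "D \<equiv> 6 * K / ell"
  shows "norm (remainder n x) \<le> (K * (D + 1) + (2 + 2 * B + K * (2 * D + 3)) + 4 * B * D\<^sup>2) / ell * L\<^sup>2"
proof -
  note QZ = Qn_in_Z[OF n, of x]
  have L2: "0 < L\<^sup>2" "L\<^sup>2 \<le> 1 / 4" "L\<^sup>2 \<le> L"
  proof -
    show "L\<^sup>2 \<le> 1 / 4" using L power_mono[of L "1/2" 2] by (simp add: power_divide)
    show "L\<^sup>2 \<le> L" using L mult_left_mono[of L 1 L] by (simp add: power2_eq_square)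
  qed (use L in simp)
  define v where "v = Qn n x - Q0"
  define dl where "dl = norm v"
  have vZ: "v \<in> Z" unfolding v_def by (intro subspace_diff subspace_Z QZ Q0_in_Z)
  have dl: "dl \<le> D * L"
  proof (cases "v = 0")
    case True
    then show ?thesis using K L ell_pos by (simp add: dl_def D_def)
  next
    case False
    then have dl0: "0 < dl" by (simp add: dl_def)
    \<comment> \<open>The comparison point lies on the segment towards the sample minimizer.
      Stopping at half way makes convexity fix the sign of
      \<open>Gn n x q \<bullet> (q - Q0)\<close>; stopping at distance 1 keeps it where the
      deviation bound is available. The estimate \<open>\<rho> < 1\<close> then shows that the
      second restriction was not active.\<close>
    define s where "s = min (1 / 2) (1 / dl)"
    have s: "0 < s" "s \<le> 1 / 2" using dl0 by (auto simp: s_def)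
    define q where "q = Q0 + s *\<^sub>R v"
    define \<rho> where "\<rho> = s * dl"
    have q: "q \<in> Z" unfolding q_def by (intro subspace_add subspace_scale subspace_Z vZ Q0_in_Z)
    have \<rho>: "norm (q - Q0) = \<rho>" "0 < \<rho>" "\<rho> \<le> 1"
      using s dl0 by (auto simp: q_def \<rho>_def dl_def[symmetric] s_def min_def field_simps)
    have nq: "norm q \<le> C"
      using norm_triangle_ineq[of Q0 "q - Q0"] \<rho> norm_Q0_le by simp
    have "0 \<le> gn n x q - gn n x (Qn n x)" using Qn_min[OF n q] by simp
    also have "\<dots> \<le> Gn n x q \<bullet> (q - Qn n x)" by (rule sample_objective_subgradient)
    also have "Gn n x q \<bullet> (q - Qn n x) = Gn n x q \<bullet> - (((1 - s) / s) *\<^sub>R (q - Q0))"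
    proof -
      have "q - Q0 = s *\<^sub>R v" "q - Qn n x = - ((1 - s) *\<^sub>R v)" by (simp_all add: q_def v_def algebra_simps)
      then show ?thesis using s by simp
    qed
    finally have "((1 - s) / s) * (Gn n x q \<bullet> (q - Q0)) \<le> 0" by simp
    then have neg: "Gn n x q \<bullet> (q - Q0) \<le> 0"
      using s by (simp add: mult_le_0_iff divide_le_0_iff)
    have "norm (Gn n x q - G q) \<le> norm (Gn n x Q0 - G Q0) + norm ((Gn n x q - G q) - (Gn n x Q0 - G Q0))"
      using norm_triangle_ineq[of "Gn n x Q0 - G Q0" "(Gn n x q - G q) - (Gn n x Q0 - G Q0)"] by simp
    also have "\<dots> \<le> K * L + K * (\<rho> * L + L\<^sup>2)" using A B'[OF q] \<rho> by simp
    also have "\<dots> \<le> K * L + K * (1 * L + L)"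
      using K L(1) L2(3) \<rho> by (intro add_mono mult_left_mono mult_right_mono) auto
    finally have dev: "norm (Gn n x q - G q) \<le> 3 * K * L" by simp
    have "ell * \<rho>\<^sup>2 \<le> (G q - G Q0) \<bullet> (q - Q0)"
      using G_strongly_monotone[OF q nq Q0_in_Z] norm_Q0_le \<rho> by simp
    also have "\<dots> \<le> (G q - Gn n x q) \<bullet> (q - Q0)" using neg by (simp add: G_Q0 inner_diff_left)
    also have "\<dots> \<le> norm (G q - Gn n x q) * norm (q - Q0)" by (rule norm_cauchy_schwarz)
    also have "\<dots> \<le> (3 * K * L) * \<rho>"
      using dev \<rho> by (simp add: norm_minus_commute mult_right_mono)
    finally have er: "ell * \<rho> \<le> 3 * K * L" using \<rho> by (simp add: power2_eq_square)
    then have "ell * \<rho> < ell * 1" using K(2) ell_pos by linarith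
    then have "\<rho> < 1" using ell_pos by (simp only: mult_less_cancel_left_pos)
    then have "s = 1 / 2" using dl0 by (auto simp: \<rho>_def s_def min_def split: if_splits)
    then have "ell * dl = 2 * (ell * \<rho>)" by (simp add: \<rho>_def)
    then have "ell * dl \<le> 6 * K * L" using er by linarith
    then show ?thesis using ell_pos by (simp add: D_def field_simps)
  qed
  \<comment> \<open>The factor 12 in the hypothesis gives 1/2 here, which together with
    \<open>L\<^sup>2 \<le> 1 / 4\<close> keeps both the sample minimizer and its displaced copy
    below within distance 1 of \<open>Q0\<close>.\<close>
  have DL: "D * L \<le> 1 / 2" using K ell_pos by (simp add: D_def field_simps)
  have D0: "0 < D" using K ell_pos by (simp add: D_def)
  have dev1: "norm ((Gn n x (Qn n x) - G (Qn n x)) - (Gn n x Q0 - G Q0)) \<le> K * (D + 1) * L\<^sup>2"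
  proof -
    have "norm ((Gn n x (Qn n x) - G (Qn n x)) - (Gn n x Q0 - G Q0)) \<le> K * (dl * L + L\<^sup>2)"
      using B'[OF QZ] dl DL unfolding v_def[symmetric] dl_def[symmetric] by simp
    also have "\<dots> \<le> K * ((D * L) * L + L\<^sup>2)"
      using dl K L by (intro mult_left_mono add_mono mult_right_mono) auto
    finally show ?thesis by (simp add: power2_eq_square algebra_simps)
  qed
  have grad: "norm (Gn n x (Qn n x)) \<le> (2 + 2 * B + K * (2 * D + 3)) * L\<^sup>2"
  proof -
    define w where "w = Gn n x (Qn n x)"
    \<comment> \<open>A step of length at most \<open>L\<^sup>2\<close> against \<open>w\<close>.
      Minimality makes the subgradient at the new point have nonpositive component along
      \<open>w\<close>, so \<open>norm w\<close> is at most the change of \<open>Gn\<close> over the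
      step. This length keeps the Lipschitz part of the change of order
      \<open>L\<^sup>2\<close>.\<close>
    define y where "y = - (L\<^sup>2 *\<^sub>R sgn w)"
    define q where "q = Qn n x + y"
    have ny: "norm y \<le> L\<^sup>2" using L2 by (simp add: y_def norm_sgn)
    have q: "q \<in> Z"
      unfolding q_def y_def w_def
      by (intro subspace_add subspace_neg subspace_scale subspace_Z sgn_in_Z Gn_in_Z QZ)
    have qn: "norm (q - Q0) \<le> D * L + L\<^sup>2"
    proof -
      have "q - Q0 = v + y" by (simp add: q_def v_def)
      then show ?thesis using norm_triangle_ineq[of v y] dl ny by (simp add: dl_def)
    qed
    have nQ: "norm (Qn n x) \<le> 2 * C + r"
    proof -
      have "norm (Qn n x) \<le> norm Q0 + dl"
        using norm_triangle_ineq[of Q0 v] by (simp add: v_def dl_def)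
      then show ?thesis using norm_Q0_le dl DL r C_ge by linarith
    qed
    have "0 \<le> gn n x q - gn n x (Qn n x)" using Qn_min[OF n q] by simp
    also have "\<dots> \<le> Gn n x q \<bullet> y"
      using sample_objective_subgradient[of n x q "Qn n x"] by (simp add: q_def)
    finally have neg: "Gn n x q \<bullet> sgn w \<le> 0" using L2 by (simp add: y_def mult_le_0_iff)
    have "norm w = w \<bullet> sgn w" using inner_sgn_self[of w] by (simp add: inner_commute)
    also have "\<dots> \<le> (w - Gn n x q) \<bullet> sgn w" using neg by (simp add: inner_diff_left)
    also have "\<dots> \<le> norm (w - Gn n x q)"
      using inner_sgn_le_norm[of w "w - Gn n x q"] by (simp add: inner_commute)
    also have "norm (w - Gn n x q) = norm (((Gn n x (Qn n x) - G (Qn n x)) - (Gn n x Q0 - G Q0))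
        - ((Gn n x q - G q) - (Gn n x Q0 - G Q0)) - (G q - G (Qn n x)))" by (simp add: w_def)
    also have "\<dots> \<le> norm ((Gn n x (Qn n x) - G (Qn n x)) - (Gn n x Q0 - G Q0))
        + norm ((Gn n x q - G q) - (Gn n x Q0 - G Q0)) + norm (G q - G (Qn n x))"
      by (rule order_trans[OF norm_triangle_ineq4 add_right_mono[OF norm_triangle_ineq4]])
    also have "\<dots> \<le> K * (D + 1) * L\<^sup>2 + K * ((D * L + L\<^sup>2) * L + L\<^sup>2) + 2 * (1 + B) * L\<^sup>2"
    proof (intro add_mono dev1)
      have "norm ((Gn n x q - G q) - (Gn n x Q0 - G Q0)) \<le> K * (norm (q - Q0) * L + L\<^sup>2)"
        by (rule B'[OF q]) (use qn DL L2 in linarith)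
      also have "\<dots> \<le> K * ((D * L + L\<^sup>2) * L + L\<^sup>2)"
        using qn K L by (intro mult_left_mono add_mono mult_right_mono) auto
      finally show "norm ((Gn n x q - G q) - (Gn n x Q0 - G Q0)) \<le> K * ((D * L + L\<^sup>2) * L + L\<^sup>2)" .
      have "norm (G q - G (Qn n x)) \<le> 2 * (1 + B) * norm (q - Qn n x)" by (rule G_lipschitz[OF QZ nQ])
      also have "\<dots> \<le> 2 * (1 + B) * L\<^sup>2" using ny B by (intro mult_left_mono) (auto simp: q_def)
      finally show "norm (G q - G (Qn n x)) \<le> 2 * (1 + B) * L\<^sup>2" .
    qed
    also have "\<dots> \<le> K * (D + 1) * L\<^sup>2 + K * ((D + 1) * L\<^sup>2 + L\<^sup>2) + 2 * (1 + B) * L\<^sup>2"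
    proof -
      have "L\<^sup>2 * L \<le> L\<^sup>2 * 1" using L by (intro mult_left_mono) auto
      then have "(D * L + L\<^sup>2) * L \<le> (D + 1) * L\<^sup>2" by (simp add: power2_eq_square algebra_simps)
      then have "K * ((D * L + L\<^sup>2) * L + L\<^sup>2) \<le> K * ((D + 1) * L\<^sup>2 + L\<^sup>2)"
        using K by (intro mult_left_mono add_right_mono) auto
      then show ?thesis by linarith
    qed
    finally show ?thesis by (simp add: w_def algebra_simps)
  qed
  have tay: "norm (G (Qn n x) - J v) \<le> 4 * B * D\<^sup>2 * L\<^sup>2"
  proof -
    have "norm (G (Qn n x) - J v) \<le> 4 * B * dl\<^sup>2" using G_second_order[of "Qn n x"] by (simp add: v_def dl_def)
    also have "\<dots> \<le> 4 * B * (D * L)\<^sup>2" using dl B by (intro mult_left_mono power_mono) (auto simp: dl_def)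
    finally show ?thesis by (simp add: power_mult_distrib mult_ac)
  qed
  \<comment> \<open>\<open>J v + Gn n x Q0\<close> telescopes, using \<open>G Q0 = 0\<close>, into
    the near-zero sample subgradient, the increment of the empirical deviation and the expansion
    error of \<open>G\<close>.\<close>
  have "norm (J (remainder n x)) = norm (Gn n x (Qn n x) - ((Gn n x (Qn n x) - G (Qn n x)) - (Gn n x Q0 - G Q0))
      - (G (Qn n x) - J v))"
    unfolding J_remainder(2)[OF n] by (simp add: v_def G_Q0 add.commute)
  also have "\<dots> \<le> norm (Gn n x (Qn n x))
      + norm ((Gn n x (Qn n x) - G (Qn n x)) - (Gn n x Q0 - G Q0)) + norm (G (Qn n x) - J v)"
    by (rule order_trans[OF norm_triangle_ineq4 add_right_mono[OF norm_triangle_ineq4]])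
  also have "\<dots> \<le> (2 + 2 * B + K * (2 * D + 3)) * L\<^sup>2 + K * (D + 1) * L\<^sup>2 + 4 * B * D\<^sup>2 * L\<^sup>2"
    by (intro add_mono grad dev1 tay)
  finally have "ell * norm (remainder n x)
      \<le> (K * (D + 1) + (2 + 2 * B + K * (2 * D + 3)) + 4 * B * D\<^sup>2) * L\<^sup>2"
    using J_coercive[OF J_remainder(1)[OF n, of x]] by (simp add: algebra_simps)
  then show ?thesis using ell_pos by (simp add: field_simps)
qed

section \<open>Moment bounds for the test functions\<close>

lemma
  assumes q: "q \<in> Z" "norm q \<le> 2 * C + r" and e: "0 < e"
  shows integral_max_inverse: "(\<integral>x. 2 * e / max (norm (q - P x)) e \<partial>\<mu>) \<le> 2 * e * (1 + B)"
    and integral_max_inverse_sq: "(\<integral>x. (2 * e / max (norm (q - P x)) e)\<^sup>2 \<partial>\<mu>) \<le> (16 * B + 4) * e\<^sup>2"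
proof -
  have le2: "\<bar>2 * e / max (norm (q - P x)) e\<bar> \<le> 2" for x
    using e by (simp add: abs_mult divide_le_eq max_def)
  have int: "integrable \<mu> (\<lambda>x. 2 * e / max (norm (q - P x)) e)"
    by (rule integrable_const_bound[where B=2]) (use le2 in auto)
  have int2: "integrable \<mu> (\<lambda>x. (2 * e / max (norm (q - P x)) e)\<^sup>2)"
  proof (rule integrable_const_bound[where B="2\<^sup>2"])
    have "(2 * e / max (norm (q - P x)) e)\<^sup>2 \<le> 2\<^sup>2" for x
      by (rule power2_le_iff_abs_le[THEN iffD2, OF _ le2]) simp
    then show "AE x in \<mu>. norm ((2 * e / max (norm (q - P x)) e)\<^sup>2) \<le> 2\<^sup>2" by simp
  qed measurable
  have le: "2 * e / max (norm (q - P x)) e \<le> 2 * e * (1 / norm (q - P x))" if "q - P x \<noteq> 0" for x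
  proof -
    have "2 * e / max (norm (q - P x)) e \<le> 2 * e / norm (q - P x)"
      using that e by (intro divide_left_mono) (auto simp: less_max_iff_disj)
    then show ?thesis by simp
  qed
  have "(\<integral>x. 2 * e / max (norm (q - P x)) e \<partial>\<mu>) \<le> (\<integral>x. 2 * e * (1 / norm (q - P x)) \<partial>\<mu>)"
  proof (rule integral_mono_AE[OF int])
    show "integrable \<mu> (\<lambda>x. 2 * e * (1 / norm (q - P x)))"
      using integrable_inverse[OF q] by (rule integrable_mult_right)
    show "AE x in \<mu>. 2 * e / max (norm (q - P x)) e \<le> 2 * e * (1 / norm (q - P x))"
      using AE_ne[OF q] by eventually_elim (rule le)
  qed
  also have "\<dots> = 2 * e * (\<integral>x. 1 / norm (q - P x) \<partial>\<mu>)" by (rule integral_mult_right_zero)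
  also have "\<dots> \<le> 2 * e * (1 + B)" using integral_inverse[OF q] e by (intro mult_left_mono) auto
  finally show "(\<integral>x. 2 * e / max (norm (q - P x)) e \<partial>\<mu>) \<le> 2 * e * (1 + B)" .
  have "(\<integral>x. (2 * e / max (norm (q - P x)) e)\<^sup>2 \<partial>\<mu>) \<le> (\<integral>x. 4 * e\<^sup>2 * (1 / (norm (q - P x))\<^sup>2) \<partial>\<mu>)"
  proof (rule integral_mono_AE[OF int2])
    show "integrable \<mu> (\<lambda>x. 4 * e\<^sup>2 * (1 / (norm (q - P x))\<^sup>2))"
      using integrable_inverse_sq[OF q] by (rule integrable_mult_right)
    show "AE x in \<mu>. (2 * e / max (norm (q - P x)) e)\<^sup>2 \<le> 4 * e\<^sup>2 * (1 / (norm (q - P x))\<^sup>2)"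
      using AE_ne[OF q]
    proof eventually_elim
      case (elim x)
      have "(2 * e / max (norm (q - P x)) e)\<^sup>2 \<le> (2 * e * (1 / norm (q - P x)))\<^sup>2"
        using le[OF elim] e by (intro power_mono) auto
      then show ?case by (simp add: power_mult_distrib power_divide)
    qed
  qed
  also have "\<dots> = 4 * e\<^sup>2 * (\<integral>x. 1 / (norm (q - P x))\<^sup>2 \<partial>\<mu>)" by (rule integral_mult_right_zero)
  also have "\<dots> \<le> 4 * e\<^sup>2 * B" using integral_inverse_sq[OF q] by (intro mult_left_mono) auto
  \<comment> \<open>Deliberately loose: \<open>16 * B + 4\<close> is a common second-moment constant
    for the envelopes, the increments (\<open>16 * B\<close>) and the scores at \<open>Q0\<close>
    (4).\<close>
  also have "\<dots> \<le> (16 * B + 4) * e\<^sup>2" using B by (simp add: algebra_simps)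
  finally show "(\<integral>x. (2 * e / max (norm (q - P x)) e)\<^sup>2 \<partial>\<mu>) \<le> (16 * B + 4) * e\<^sup>2" .
qed

text \<open>This supplies the scale \<open>norm w\<close> in Bernstein's inequality: although
  \<open>sgn\<close> is not Lipschitz, the increment is at most \<open>norm w\<close> times a
  multiple of the square-integrable \<open>1 / norm (Q0 - P x)\<close>.\<close>

lemma integral_increment_sq:
  assumes h: "norm h \<le> 2"
  shows "(\<integral>x. (h \<bullet> (S (Q0 + w) x - S Q0 x))\<^sup>2 \<partial>\<mu>) \<le> (16 * B + 4) * (norm w)\<^sup>2"
proof -
  have le: "\<bar>h \<bullet> (S (Q0 + w) x - S Q0 x)\<bar> \<le> 2 * norm (S (Q0 + w) x - S Q0 x)" for x
    using Cauchy_Schwarz_ineq2[of h "S (Q0 + w) x - S Q0 x"]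
      mult_right_mono[OF h norm_ge_zero[of "S (Q0 + w) x - S Q0 x"]] by linarith
  have le4: "\<bar>h \<bullet> (S (Q0 + w) x - S Q0 x)\<bar> \<le> 4" for x
  proof -
    have "norm (S (Q0 + w) x - S Q0 x) \<le> norm (S (Q0 + w) x) + norm (S Q0 x)" by (rule norm_triangle_ineq4)
    also have "\<dots> \<le> 1 + 1" by (intro add_mono) (simp_all add: norm_sgn)
    finally show ?thesis using le[of x] by linarith
  qed
  have "(\<integral>x. (h \<bullet> (S (Q0 + w) x - S Q0 x))\<^sup>2 \<partial>\<mu>) \<le> (\<integral>x. 16 * (norm w)\<^sup>2 * (1 / (norm (Q0 - P x))\<^sup>2) \<partial>\<mu>)"
  proof (rule integral_mono_AE)
    show "integrable \<mu> (\<lambda>x. (h \<bullet> (S (Q0 + w) x - S Q0 x))\<^sup>2)"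
    proof (rule integrable_const_bound[where B="4\<^sup>2"])
      have "(h \<bullet> (S (Q0 + w) x - S Q0 x))\<^sup>2 \<le> 4\<^sup>2" for x
        using power_mono[OF le4[of x], of 2] by simp
      then show "AE x in \<mu>. norm ((h \<bullet> (S (Q0 + w) x - S Q0 x))\<^sup>2) \<le> 4\<^sup>2" by simp
    qed measurable
    show "integrable \<mu> (\<lambda>x. 16 * (norm w)\<^sup>2 * (1 / (norm (Q0 - P x))\<^sup>2))"
      using integrable_inverse_sq[OF Q0_in_Z norm_Q0_le'] by (rule integrable_mult_right)
    show "AE x in \<mu>. (h \<bullet> (S (Q0 + w) x - S Q0 x))\<^sup>2 \<le> 16 * (norm w)\<^sup>2 * (1 / (norm (Q0 - P x))\<^sup>2)"
      using AE_ne[OF Q0_in_Z norm_Q0_le']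
    proof eventually_elim
      case (elim x)
      have "norm (S (Q0 + w) x - S Q0 x) \<le> 2 * norm w / norm (Q0 - P x)"
        using norm_sgn_diff_le[OF elim, of "Q0 + w - P x"] by simp
      then have "\<bar>h \<bullet> (S (Q0 + w) x - S Q0 x)\<bar> \<le> 2 * (2 * norm w / norm (Q0 - P x))"
        using le[of x] by linarith
      then have "\<bar>h \<bullet> (S (Q0 + w) x - S Q0 x)\<bar>\<^sup>2 \<le> (2 * (2 * norm w / norm (Q0 - P x)))\<^sup>2"
        by (rule power_mono) simp
      then show ?case by (simp add: power_mult_distrib power_divide)
    qed
  qed
  also have "\<dots> = 16 * (norm w)\<^sup>2 * (\<integral>x. 1 / (norm (Q0 - P x))\<^sup>2 \<partial>\<mu>)" by (rule integral_mult_right_zero)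
  also have "\<dots> \<le> 16 * (norm w)\<^sup>2 * B"
    using integral_inverse_sq[OF Q0_in_Z norm_Q0_le'] by (intro mult_left_mono) auto
  also have "\<dots> \<le> (16 * B + 4) * (norm w)\<^sup>2" using B by (simp add: algebra_simps)
  finally show ?thesis .
qed

section \<open>From finitely many test functions to all points and directions\<close>

lemma inner_empirical:
  "h \<bullet> (Gn n x q - G q) = (\<Sum>i=1..n. h \<bullet> S q (x i)) / real n - (\<integral>y. h \<bullet> S q y \<partial>\<mu>)"
proof -
  have "(\<integral>y. h \<bullet> S q y \<partial>\<mu>) = h \<bullet> (\<integral>y. S q y \<partial>\<mu>)" by (rule integral_inner_right) simp
  then show ?thesis
    unfolding Gn_def G_def by (simp add: inner_diff_right inner_sum_right)
qed

text \<open>Replacing the optimal direction \<open>sgn v\<close> by a net point loses at most half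
  of \<open>norm v\<close>, which is absorbed on the left.\<close>

lemma norm_le_of_net:
  assumes net: "\<And>z. z \<in> Z \<Longrightarrow> norm z \<le> 1 \<Longrightarrow> \<exists>h\<in>\<Gamma>. norm (z - h) \<le> 1 / 2"
    and le: "\<And>h. h \<in> \<Gamma> \<Longrightarrow> norm h \<le> 2 \<Longrightarrow> h \<bullet> v \<le> c" and v: "v \<in> Z"
  shows "norm v \<le> 2 * c"
proof -
  obtain h where h: "h \<in> \<Gamma>" "norm (sgn v - h) \<le> 1 / 2"
    using net[OF sgn_in_Z[OF v]] by (fastforce simp: norm_sgn split: if_splits)
  have nh: "norm h \<le> 2"
  proof -
    have "norm h \<le> norm (sgn v) + norm (sgn v - h)"
      using norm_triangle_ineq4[of "sgn v" "sgn v - h"] by simp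
    moreover have "norm (sgn v) \<le> 1" by (simp add: norm_sgn)
    ultimately show ?thesis using h(2) by linarith
  qed
  have "norm v = sgn v \<bullet> v" by (simp add: inner_sgn_self)
  also have "\<dots> = h \<bullet> v + (sgn v - h) \<bullet> v" by (simp add: inner_diff_left)
  also have "\<dots> \<le> c + 1 / 2 * norm v"
    using le[OF h(1) nh] norm_cauchy_schwarz[of "sgn v - h" v] mult_right_mono[OF h(2) norm_ge_zero[of v]] by linarith
  finally show ?thesis by simp
qed

text \<open>The envelope at \<open>q'\<close> dominates the increments to all \<open>q\<close>
  within \<open>e\<close> simultaneously, so a single random average controls uncountably many
  points. Each of the empirical and population increments costs the mean
  \<open>2 * e * (1 + B)\<close>; the former also costs the deviation \<open>c\<close>.\<close>

lemma empirical_increment_le: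
  assumes e: "norm (q - q') \<le> e" "0 < e" and q': "q' \<in> Z" "norm q' \<le> 2 * C + r"
    and c: "\<bar>(\<Sum>i=1..n. 2 * e / max (norm (q' - P (x i))) e) / real n
        - (\<integral>y. 2 * e / max (norm (q' - P y)) e \<partial>\<mu>)\<bar> \<le> c"
  shows "norm ((Gn n x q - G q) - (Gn n x q' - G q')) \<le> 4 * e * (1 + B) + c"
proof -
  define w where "w y = 2 * e / max (norm (q' - P y)) e" for y
  have w: "norm (S q y - S q' y) \<le> w y" for y
    unfolding w_def using e by (intro norm_sgn_diff_le_max) auto
  have iw: "(\<integral>y. w y \<partial>\<mu>) \<le> 2 * e * (1 + B)"
    unfolding w_def by (rule integral_max_inverse[OF q' e(2)])
  have "Gn n x q - Gn n x q' = (1 / real n) *\<^sub>R (\<Sum>i=1..n. S q (x i) - S q' (x i))"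
    by (simp add: Gn_def sum_subtractf scaleR_diff_right)
  then have "norm (Gn n x q - Gn n x q') = norm (\<Sum>i=1..n. S q (x i) - S q' (x i)) / real n" by simp
  also have "\<dots> \<le> (\<Sum>i=1..n. w (x i)) / real n"
    using w by (intro divide_right_mono sum_norm_le) auto
  also have "\<dots> \<le> 2 * e * (1 + B) + c" using c iw unfolding w_def by linarith
  finally have 1: "norm (Gn n x q - Gn n x q') \<le> 2 * e * (1 + B) + c" .
  have "norm (G q - G q') \<le> (\<integral>y. norm (S q y - S q' y) \<partial>\<mu>)"
    unfolding G_diff by (rule integral_norm_bound)
  also have "\<dots> \<le> (\<integral>y. w y \<partial>\<mu>)"
  proof (rule integral_mono)
    show "integrable \<mu> (\<lambda>y. norm (S q y - S q' y))"
      by (intro integrable_norm Bochner_Integration.integrable_diff integrable_S)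
    have "\<bar>w y\<bar> \<le> 2" for y
      using e by (simp add: w_def abs_mult divide_le_eq max_def)
    then show "integrable \<mu> w"
      unfolding w_def by (intro integrable_const_bound[where B=2]) auto
  qed (rule w)
  finally have 2: "norm (G q - G q') \<le> 2 * e * (1 + B)" using iw by linarith
  have "(Gn n x q - G q) - (Gn n x q' - G q') = (Gn n x q - Gn n x q') - (G q - G q')" by simp
  then show ?thesis
    using 1 2 norm_triangle_ineq4[of "Gn n x q - Gn n x q'" "G q - G q'"] by (simp only:)
qed

text \<open>Union bound over a \<open>1/n\<close>-net of the unit ball of \<open>Z\<close>, used both for the directions and for
  the displacements from \<open>Q0\<close>.\<close>

lemma uniform_deviation:
  fixes X :: "nat \<Rightarrow> 'b \<Rightarrow> 'a"
  assumes M: "prob_space M" and ind: "prob_space.indep_vars M (\<lambda>_. borel) X {1..n}"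
    and law: "\<And>i. i \<in> {1..n} \<Longrightarrow> distr M borel (X i) = \<mu>"
    and k: "1 \<le> k" and n: "2 \<le> n" and L: "1 / real n \<le> L\<^sup>2" "0 < L" "L \<le> 1" and K: "0 < K"
  defines "K' \<equiv> 6 * K + 4 + 4 * B"
  obtains bad where "bad \<in> sets M"
    "measure M bad \<le> 6 * (real (2 * (n * k) + 1) ^ k)\<^sup>2 * exp (- (real n * L\<^sup>2 * (K / 4 - (B + 1 / 4))))"
    "\<And>\<omega>. \<omega> \<in> space M - bad \<Longrightarrow> norm (Gn n (\<lambda>i. X i \<omega>) Q0 - G Q0) \<le> K' * L"
    "\<And>\<omega> q. \<omega> \<in> space M - bad \<Longrightarrow> q \<in> Z \<Longrightarrow> norm (q - Q0) \<le> 1 \<Longrightarrow>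
      norm ((Gn n (\<lambda>i. X i \<omega>) q - G q) - (Gn n (\<lambda>i. X i \<omega>) Q0 - G Q0)) \<le> K' * (norm (q - Q0) * L + L\<^sup>2)"
proof -
  interpret M: prob_space M by fact
  have X [measurable]: "X i \<in> borel_measurable M" if "i \<in> {1..n}" for i
    using ind that unfolding M.indep_vars_def by auto
  \<comment> \<open>Fine enough that the discretization error is absorbed by
    \<open>L\<^sup>2\<close>, and at most 1/2, so the same net also serves for directions.\<close>
  define e where "e = 1 / real n"
  have e: "0 < e" "e \<le> 1 / 2" "e \<le> L\<^sup>2" using n L by (auto simp: e_def)
  obtain \<Gamma>0 where \<Gamma>0: "finite \<Gamma>0" "\<Gamma>0 \<subseteq> Z" "card \<Gamma>0 \<le> (2 * (n * k) + 1) ^ k"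
    "\<And>z. z \<in> Z \<Longrightarrow> norm z \<le> 1 \<Longrightarrow> \<exists>q\<in>\<Gamma>0. norm (z - q) \<le> e"
    using finite_net[OF k, of n] n unfolding e_def by (metis Suc_1 Suc_leD One_nat_def)
  \<comment> \<open>Discards distant grid points, so that the test functions are bounded by 4.
    Points close to the unit ball survive since \<open>1 + e \<le> 2\<close>.\<close>
  define \<Gamma> where "\<Gamma> = {w \<in> \<Gamma>0. norm w \<le> 2}"
  have \<Gamma>: "finite \<Gamma>" "\<Gamma> \<subseteq> Z" "\<And>w. w \<in> \<Gamma> \<Longrightarrow> norm w \<le> 2" using \<Gamma>0 by (auto simp: \<Gamma>_def)
  define c where "c = real (2 * (n * k) + 1) ^ k"
  have c1: "1 \<le> c" unfolding c_def by (rule one_le_power) simp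
  have card: "real (card \<Gamma>) \<le> c"
  proof -
    have "card \<Gamma> \<le> card \<Gamma>0" using \<Gamma>0(1) by (intro card_mono) (auto simp: \<Gamma>_def)
    then have "card \<Gamma> \<le> (2 * (n * k) + 1) ^ k" using \<Gamma>0(3) by simp
    then show ?thesis unfolding c_def by (metis of_nat_le_iff of_nat_power)
  qed
  have net: "\<exists>w\<in>\<Gamma>. norm (z - w) \<le> e" if z: "z \<in> Z" "norm z \<le> 1" for z
  proof -
    obtain w where w: "w \<in> \<Gamma>0" "norm (z - w) \<le> e" using \<Gamma>0(4)[OF z] by blast
    have "norm w \<le> norm z + norm (z - w)" using norm_triangle_ineq4[of z "z - w"] by simp
    then have "norm w \<le> 2" using w e z by linarith
    then show ?thesis using w by (auto simp: \<Gamma>_def)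
  qed
  have net2: "\<exists>w\<in>\<Gamma>. norm (z - w) \<le> 1 / 2" if "z \<in> Z" "norm z \<le> 1" for z
    using net[OF that] e by force
  define dev where "dev f \<rho> = {\<omega> \<in> space M. K * L * (\<rho> + L) \<le>
      \<bar>(\<Sum>i=1..n. f (X i \<omega>)) / real n - (\<integral>x. f x \<partial>\<mu>)\<bar>}" for f :: "'a \<Rightarrow> real" and \<rho>
  define p where "p = 2 * exp (- (real n * L\<^sup>2 * (K / 4 - (16 * B + 4) / 16)))"
  have dev: "M.prob (dev f \<rho>) \<le> p"
    if "f \<in> borel_measurable borel" "\<And>x. \<bar>f x\<bar> \<le> 4" "(\<integral>x. (f x)\<^sup>2 \<partial>\<mu>) \<le> (16 * B + 4) * \<rho>\<^sup>2" "0 \<le> \<rho>" for f \<rho>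
    unfolding dev_def p_def
    by (rule M.empirical_mean_deviation[OF ind]) (use that law n B L in auto)
  have dev_sets: "dev f \<rho> \<in> sets M" if [measurable]: "f \<in> borel_measurable borel" for f \<rho>
    unfolding dev_def by measurable
  \<comment> \<open>Three families: \<open>f1\<close> tests the increment from \<open>Q0\<close> by
    \<open>w\<close> in direction \<open>h\<close>, \<open>f2\<close> is the envelope at
    \<open>Q0 + w\<close>, and \<open>f3\<close> tests the score at \<open>Q0\<close>.\<close>
  define f1 where "f1 = (\<lambda>(w, h) x. h \<bullet> (S (Q0 + w) x - S Q0 x))"
  define f2 where "f2 w x = 2 * e / max (norm (Q0 + w - P x)) e" for w x
  define f3 where "f3 h x = h \<bullet> S Q0 x" for h x
  have m1 [measurable]: "f1 wh \<in> borel_measurable borel" for wh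
    unfolding f1_def by (cases wh) simp
  have m2 [measurable]: "f2 w \<in> borel_measurable borel" for w unfolding f2_def by measurable
  have m3 [measurable]: "f3 h \<in> borel_measurable borel" for h unfolding f3_def by measurable
  have Qw: "Q0 + w \<in> Z" "norm (Q0 + w) \<le> 2 * C + r" if "w \<in> \<Gamma>" for w
  proof -
    show "Q0 + w \<in> Z" using that \<Gamma> by (intro subspace_add subspace_Z Q0_in_Z) auto
    show "norm (Q0 + w) \<le> 2 * C + r"
      using norm_triangle_ineq[of Q0 w] norm_Q0_le \<Gamma>(3)[OF that] C_ge r by linarith
  qed
  have p1: "M.prob (dev (f1 wh) (norm (fst wh))) \<le> p" if wh: "wh \<in> \<Gamma> \<times> \<Gamma>" for wh
  proof -
    obtain w h where [simp]: "wh = (w, h)" by (cases wh)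
    have h2: "norm h \<le> 2" using wh \<Gamma>(3) by auto
    show ?thesis
    proof (rule dev[OF m1])
      fix x
      have "norm (S (Q0 + w) x - S Q0 x) \<le> norm (S (Q0 + w) x) + norm (S Q0 x)" by (rule norm_triangle_ineq4)
      also have "\<dots> \<le> 2" by (simp add: norm_sgn)
      finally have "norm h * norm (S (Q0 + w) x - S Q0 x) \<le> 2 * 2" using h2 by (intro mult_mono) auto
      then show "\<bar>f1 wh x\<bar> \<le> 4"
        using Cauchy_Schwarz_ineq2[of h "S (Q0 + w) x - S Q0 x"] by (simp add: f1_def)
    next
      show "(\<integral>x. (f1 wh x)\<^sup>2 \<partial>\<mu>) \<le> (16 * B + 4) * (norm (fst wh))\<^sup>2"
        using integral_increment_sq[OF h2, of w] by (simp add: f1_def)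
    qed simp
  qed
  have p2: "M.prob (dev (f2 w) e) \<le> p" if w: "w \<in> \<Gamma>" for w
  proof (rule dev[OF m2])
    show "\<bar>f2 w x\<bar> \<le> 4" for x
      using e by (simp add: f2_def abs_mult divide_le_eq max_def)
    show "(\<integral>x. (f2 w x)\<^sup>2 \<partial>\<mu>) \<le> (16 * B + 4) * e\<^sup>2"
      unfolding f2_def by (rule integral_max_inverse_sq[OF Qw[OF w] e(1)])
  qed (use e in simp)
  have p3: "M.prob (dev (f3 h) 1) \<le> p" if h: "h \<in> \<Gamma>" for h
  proof (rule dev[OF m3])
    have b: "\<bar>f3 h x\<bar> \<le> 2" for x
    proof -
      have "norm h * norm (S Q0 x) \<le> 2 * 1" using \<Gamma>(3)[OF h] by (intro mult_mono) (auto simp: norm_sgn)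
      then show ?thesis using Cauchy_Schwarz_ineq2[of h "S Q0 x"] by (simp add: f3_def)
    qed
    then show "\<bar>f3 h x\<bar> \<le> 4" for x using order_trans[OF b[of x], of 4] by simp
    have sq: "(f3 h x)\<^sup>2 \<le> 4" for x using power_mono[OF b[of x], of 2] by simp
    have "(\<integral>x. (f3 h x)\<^sup>2 \<partial>\<mu>) \<le> (\<integral>x. 4 \<partial>\<mu>)"
      using sq by (intro integral_mono integrable_const_bound[where B=4]) auto
    then show "(\<integral>x. (f3 h x)\<^sup>2 \<partial>\<mu>) \<le> (16 * B + 4) * 1\<^sup>2" using B by simp
  qed simp
  \<comment> \<open>A finite union of measurable events that contains every failure of the uniform
    bounds; measurability of a supremum over all \<open>q\<close> does not arise.\<close>
  define bad where "bad = (\<Union>wh\<in>\<Gamma> \<times> \<Gamma>. dev (f1 wh) (norm (fst wh)))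
      \<union> ((\<Union>w\<in>\<Gamma>. dev (f2 w) e) \<union> (\<Union>h\<in>\<Gamma>. dev (f3 h) 1))"
  have union: "M.prob (\<Union>i\<in>I. D i) \<le> real (card I) * p"
    if "finite I" "\<And>i. i \<in> I \<Longrightarrow> D i \<in> sets M" "\<And>i. i \<in> I \<Longrightarrow> M.prob (D i) \<le> p"
    for I :: "'i set" and D
  proof -
    have "M.prob (\<Union>i\<in>I. D i) \<le> (\<Sum>i\<in>I. M.prob (D i))"
      using that by (intro M.finite_measure_subadditive_finite) auto
    also have "\<dots> \<le> real (card I) * p" using that by (intro sum_bounded_above)
    finally show ?thesis .
  qed
  have s1: "(\<Union>wh\<in>\<Gamma> \<times> \<Gamma>. dev (f1 wh) (norm (fst wh))) \<in> sets M"
    using \<Gamma>(1) by (intro sets.finite_UN dev_sets m1) auto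
  have s2: "(\<Union>w\<in>\<Gamma>. dev (f2 w) e) \<in> sets M" using \<Gamma>(1) by (intro sets.finite_UN dev_sets m2) auto
  have s3: "(\<Union>h\<in>\<Gamma>. dev (f3 h) 1) \<in> sets M" using \<Gamma>(1) by (intro sets.finite_UN dev_sets m3) auto
  show thesis
  proof (rule that[of bad])
    show "bad \<in> sets M" unfolding bad_def using s1 s2 s3 by simp
    have p0: "0 \<le> p" by (simp add: p_def)
    have "M.prob bad \<le> M.prob (\<Union>wh\<in>\<Gamma> \<times> \<Gamma>. dev (f1 wh) (norm (fst wh)))
        + (M.prob (\<Union>w\<in>\<Gamma>. dev (f2 w) e) + M.prob (\<Union>h\<in>\<Gamma>. dev (f3 h) 1))"
      unfolding bad_def using s1 s2 s3
      by (intro order_trans[OF measure_Un_le] add_left_mono measure_Un_le) auto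
    also have "\<dots> \<le> real (card (\<Gamma> \<times> \<Gamma>)) * p + (real (card \<Gamma>) * p + real (card \<Gamma>) * p)"
      using \<Gamma>(1) p1 p2 p3 by (intro add_mono union dev_sets) auto
    \<comment> \<open>Three unions of at most \<open>c\<^sup>2\<close> events each, with a factor 2
      in \<open>p\<close> for the two tails, account for the 6.\<close>
    also have "\<dots> \<le> c\<^sup>2 * p + (c\<^sup>2 * p + c\<^sup>2 * p)"
    proof -
      have "real (card \<Gamma>) * real (card \<Gamma>) \<le> c * c" using card c1 by (intro mult_mono) auto
      then have a: "real (card (\<Gamma> \<times> \<Gamma>)) \<le> c\<^sup>2" by (simp add: card_cartesian_product power2_eq_square)
      have b: "real (card \<Gamma>) \<le> c\<^sup>2"
        using card mult_left_mono[OF c1, of c] c1 unfolding power2_eq_square by linarith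
      show ?thesis using a b p0 by (intro add_mono mult_right_mono)
    qed
    also have "\<dots> = 6 * c\<^sup>2 * exp (- (real n * L\<^sup>2 * (K / 4 - (B + 1 / 4))))"
      by (simp add: p_def add_divide_distrib)
    finally show "M.prob bad \<le> 6 * (real (2 * (n * k) + 1) ^ k)\<^sup>2
        * exp (- (real n * L\<^sup>2 * (K / 4 - (B + 1 / 4))))" unfolding c_def .
  next
    fix \<omega> assume \<omega>: "\<omega> \<in> space M - bad"
    let ?x = "\<lambda>i. X i \<omega>"
    have nd: "\<bar>(\<Sum>i=1..n. f (X i \<omega>)) / real n - (\<integral>x. f x \<partial>\<mu>)\<bar> \<le> K * L * (\<rho> + L)"
      if "\<omega> \<notin> dev f \<rho>" for f \<rho>
      using that \<omega> by (auto simp: dev_def)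
    have "norm (Gn n ?x Q0 - G Q0) \<le> 2 * (K * L * (1 + L))"
    proof (rule norm_le_of_net[OF net2])
      fix h assume "h \<in> \<Gamma>"
      then have "\<omega> \<notin> dev (f3 h) 1" using \<omega> by (auto simp: bad_def)
      from nd[OF this] show "h \<bullet> (Gn n ?x Q0 - G Q0) \<le> K * L * (1 + L)"
        unfolding inner_empirical f3_def by simp
    qed (assumption+, intro subspace_diff subspace_Z Gn_in_Z G_in_Z Q0_in_Z)
    also have "\<dots> \<le> K' * L"
    proof -
      have "K * L * (1 + L) \<le> K * L * 2" using K L by (intro mult_left_mono) auto
      moreover have "0 \<le> B * L" "0 < K * L" using B K L by simp_all
      ultimately show ?thesis using L by (simp add: K'_def algebra_simps)
    qed
    finally show "norm (Gn n ?x Q0 - G Q0) \<le> K' * L" .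
    fix q assume q: "q \<in> Z" "norm (q - Q0) \<le> 1"
    obtain w where w: "w \<in> \<Gamma>" "norm (q - Q0 - w) \<le> e"
      using net[OF subspace_diff[OF subspace_Z q(1) Q0_in_Z] q(2)] by blast
    have nw: "norm w \<le> norm (q - Q0) + e"
      using norm_triangle_ineq4[of "q - Q0" "q - Q0 - w"] w by simp
    let ?q = "Q0 + w"
    have inc: "norm ((Gn n ?x ?q - G ?q) - (Gn n ?x Q0 - G Q0)) \<le> 2 * (K * L * (norm w + L))"
    proof (rule norm_le_of_net[OF net2])
      fix h assume "h \<in> \<Gamma>"
      then have "\<omega> \<notin> dev (f1 (w, h)) (norm (fst (w, h)))" using \<omega> w by (auto simp: bad_def)
      then have "\<bar>(\<Sum>i=1..n. f1 (w, h) (X i \<omega>)) / real n - (\<integral>x. f1 (w, h) x \<partial>\<mu>)\<bar> \<le> K * L * (norm w + L)"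
        using nd by fastforce
      moreover have "(\<integral>y. h \<bullet> S ?q y - h \<bullet> S Q0 y \<partial>\<mu>) = (\<integral>y. h \<bullet> S ?q y \<partial>\<mu>) - (\<integral>y. h \<bullet> S Q0 y \<partial>\<mu>)"
        by (rule Bochner_Integration.integral_diff) (rule integrable_inner_right, simp)+
      ultimately show "h \<bullet> ((Gn n ?x ?q - G ?q) - (Gn n ?x Q0 - G Q0)) \<le> K * L * (norm w + L)"
        unfolding inner_diff_right[of h "Gn n ?x ?q - G ?q"] inner_empirical f1_def
        by (simp add: inner_diff_right sum_subtractf diff_divide_distrib)
    qed (assumption+, intro subspace_diff subspace_Z Gn_in_Z G_in_Z Q0_in_Z Qw w)
    have osc: "norm ((Gn n ?x q - G q) - (Gn n ?x ?q - G ?q)) \<le> 4 * e * (1 + B) + K * L * (e + L)"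
    proof (rule empirical_increment_le[OF _ e(1) Qw[OF w(1)]])
      show "norm (q - ?q) \<le> e" using w by (simp add: algebra_simps)
      have "\<omega> \<notin> dev (f2 w) e" using \<omega> w by (auto simp: bad_def)
      from nd[OF this]
      show "\<bar>(\<Sum>i=1..n. 2 * e / max (norm (?q - P (X i \<omega>))) e) / real n
          - (\<integral>y. 2 * e / max (norm (?q - P y)) e \<partial>\<mu>)\<bar> \<le> K * L * (e + L)" unfolding f2_def .
    qed
    have "norm ((Gn n ?x q - G q) - (Gn n ?x Q0 - G Q0))
        \<le> (4 * e * (1 + B) + K * L * (e + L)) + 2 * (K * L * (norm w + L))"
      by (rule norm_diff_triangle_le[OF osc inc])
    \<comment> \<open>\<open>e \<le> L\<^sup>2\<close> is used in the mean of the envelope and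
      \<open>e \<le> L\<close> next to the deviation terms; collecting them yields
      \<open>6 * K + 4 + 4 * B\<close>.\<close>
    also have "\<dots> \<le> (4 * L\<^sup>2 * (1 + B) + K * L * (L + L)) + 2 * (K * L * (norm (q - Q0) + L + L))"
    proof -
      have eL: "e \<le> L" using e(3) L(2,3) mult_left_mono[of L 1 L] unfolding power2_eq_square by linarith
      show ?thesis
        using eL e(3) nw K L B by (intro add_mono mult_left_mono mult_right_mono) auto
    qed
    also have "\<dots> = 2 * K * (norm (q - Q0) * L) + (6 * K + 4 + 4 * B) * L\<^sup>2"
      by (simp add: power2_eq_square algebra_simps)
    also have "\<dots> \<le> K' * (norm (q - Q0) * L) + K' * L\<^sup>2"
      unfolding K'_def using K B L by (intro add_mono mult_right_mono) auto
    finally show "norm ((Gn n ?x q - G q) - (Gn n ?x Q0 - G Q0)) \<le> K' * (norm (q - Q0) * L + L\<^sup>2)"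
      by (simp add: distrib_left)
  qed
qed

end

section \<open>Letting the dimension grow\<close>

text \<open>Projecting first onto the larger and then onto the smaller section equals projecting
  onto the smaller one, and the latter projection is a contraction. It also does not increase the
  norm of \<open>q\<close>, so the ball over which the supremum is taken is preserved.\<close>

lemma inverse_second_moment_antimono:
  fixes \<phi> :: "nat \<Rightarrow> 'a::{real_inner,banach,second_countable_topology}"
  assumes basis: "orthonormal_basis_seq \<phi> N" and k: "j \<le> k" "enat k \<le> N"
  shows "inverse_second_moment \<mu> (basis_span \<phi> k) q
    \<le> inverse_second_moment \<mu> (basis_span \<phi> j) (orth_proj (basis_span \<phi> j) q)"
proof -
  interpret K: basis_section \<phi> N k by unfold_locales (use assms in auto)
  interpret J: basis_section \<phi> N j
    by unfold_locales (use assms order_trans[of "enat j" "enat k" N] in auto)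
  have sub: "J.Z \<subseteq> K.Z" unfolding basis_span_def using k by (intro span_mono image_mono) auto
  have PP: "J.P (K.P x) = J.P x" for x
    by (rule J.eq_in_Z) (use sub in \<open>auto simp: J.inner_P K.inner_P\<close>)
  have "norm (J.P q - J.P x) \<le> norm (q - K.P x)" for x
    using J.norm_P_le[of "q - K.P x"] linear_diff[OF bounded_linear.linear[OF J.bounded_linear_P], of q "K.P x"]
    by (simp add: PP)
  moreover have "inverse (ennreal b ^ 2) \<le> inverse (ennreal a ^ 2)" if "0 \<le> a" "a \<le> b" for a b
    using that by (cases "a = 0")
      (simp_all add: ennreal_power inverse_ennreal ennreal_leI le_imp_inverse_le power_mono)
  ultimately show ?thesis
    unfolding inverse_second_moment_def by (intro nn_integral_mono) simp
qed

lemma (in prob_space) tail_small: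
  fixes e :: real and f :: "'a \<Rightarrow> real"
  assumes e: "0 < e" and [measurable]: "f \<in> borel_measurable M"
  obtains r where "0 < r" "prob {x \<in> space M. r < f x} \<le> e"
proof -
  define A where "A n = {x \<in> space M. real n < f x}" for n
  have "(\<lambda>n. prob (A n)) \<longlonglongrightarrow> prob (\<Inter>n. A n)"
  proof (rule finite_Lim_measure_decseq)
    show "range A \<subseteq> events" unfolding A_def by auto
    show "decseq A" unfolding A_def decseq_def by auto
  qed
  moreover have "(\<Inter>n. A n) = {}"
  proof -
    have "\<exists>n. x \<notin> A n" for x
      using reals_Archimedean2[of "f x"] by (auto simp: A_def intro: less_imp_le dest: less_asym)
    then show ?thesis by auto
  qed
  ultimately have "(\<lambda>n. prob (A n)) \<longlonglongrightarrow> 0" by simp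
  then have "\<forall>\<^sub>F n in sequentially. prob (A n) < e" using e by (rule order_tendstoD)
  then have "\<forall>\<^sub>F n in sequentially. prob (A n) < e \<and> 1 \<le> n" by (intro eventually_conj eventually_ge_at_top)
  then obtain n where "prob (A n) < e" "1 \<le> n" by (auto simp: eventually_sequentially)
  then show thesis by (intro that[of "real n"]) (auto simp: A_def)
qed

text \<open>For \<open>\<alpha> < 1/2\<close> the dimension tends to infinity; for \<open>\<alpha> = 1/2\<close> it is a convergent sequence of
  integers and hence eventually constant.\<close>

lemma eventually_dimension_ge:
  fixes d :: "nat \<Rightarrow> nat"
  assumes lim: "(\<lambda>n. real (d n) / real n powr (1 - 2 * \<alpha>)) \<longlonglongrightarrow> c" and c: "0 < c" and \<alpha>: "\<alpha> \<le> 1 / 2"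
  obtains n0 where "n1 \<le> n0" "\<forall>\<^sub>F n in sequentially. d n0 \<le> d n"
proof (cases "\<alpha> = 1 / 2")
  case True
  have "\<forall>\<^sub>F n in sequentially. \<bar>real (d n) / real n powr (1 - 2 * \<alpha>) - c\<bar> < 1 / 2 \<and> 1 \<le> n"
    using tendstoD[OF lim, of "1/2"] by (intro eventually_conj eventually_ge_at_top) (simp add: dist_real_def)
  then obtain m where m: "\<And>n. m \<le> n \<Longrightarrow> \<bar>real (d n) / real n powr (1 - 2 * \<alpha>) - c\<bar> < 1 / 2 \<and> 1 \<le> n"
    by (auto simp: eventually_sequentially)
  have near: "\<bar>real (d n) - c\<bar> < 1 / 2" if "m \<le> n" for n
    using m[OF that] True by (auto split: if_splits)
  have "d (max m n1) \<le> d n" if "m \<le> n" for n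
  proof -
    have "\<bar>real (d n) - real (d (max m n1))\<bar> < 1" using near[OF that] near[of "max m n1"] by linarith
    then show ?thesis by linarith
  qed
  then show thesis by (intro that[of "max m n1"]) (auto simp: eventually_sequentially)
next
  case False
  then have "filterlim (\<lambda>n. real n powr (1 - 2 * \<alpha>)) at_top sequentially"
    using \<alpha> by real_asymp
  then have "filterlim (\<lambda>n. real (d n) / real n powr (1 - 2 * \<alpha>) * real n powr (1 - 2 * \<alpha>)) at_top sequentially"
    by (rule filterlim_tendsto_pos_mult_at_top[OF lim c])
  then have "\<forall>\<^sub>F n in sequentially.
      real (d n1) \<le> real (d n) / real n powr (1 - 2 * \<alpha>) * real n powr (1 - 2 * \<alpha>)"
    by (simp add: filterlim_at_top)
  moreover have "\<forall>\<^sub>F n in sequentially. (1::nat) \<le> n" by (rule eventually_ge_at_top)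
  ultimately have "\<forall>\<^sub>F n in sequentially. d n1 \<le> d n"
    by eventually_elim simp
  then show thesis using that[of n1] by simp
qed

text \<open>The squared net size is at most \<open>n ^ (6 * k)\<close>; the constant 8 leaves
  \<open>n ^ (2 * k)\<close> in the denominator, hence a summable bound.\<close>

lemma net_cardinality_bound:
  fixes n k :: nat
  assumes n: "3 \<le> n" and k: "1 \<le> k" "2 * (n * k) + 1 \<le> n ^ 3"
    and le: "8 * real k * ln (real n) \<le> E"
  shows "6 * (real (2 * (n * k) + 1) ^ k)\<^sup>2 * exp (- E) \<le> 6 / (real n)\<^sup>2"
proof -
  have n0: "0 < real n" "1 \<le> real n" using n by auto
  have l: "0 \<le> ln (real n)" using n0 by simp
  have "real (2 * (n * k) + 1) ^ k \<le> (real n ^ 3) ^ k"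
  proof (rule power_mono)
    show "real (2 * (n * k) + 1) \<le> real n ^ 3"
      using of_nat_mono[OF k(2), where 'a=real] by simp
  qed simp
  then have "(real (2 * (n * k) + 1) ^ k)\<^sup>2 \<le> ((real n ^ 3) ^ k)\<^sup>2" by (rule power_mono) simp
  also have "((real n ^ 3) ^ k)\<^sup>2 = real n ^ (6 * k)" by (simp add: power_mult[symmetric] mult_ac)
  also have "\<dots> = exp (ln (real n)) ^ (6 * k)" using n0 by simp
  also have "\<dots> = exp (6 * real k * ln (real n))" unfolding exp_of_nat_mult[symmetric] by simp
  finally have "(real (2 * (n * k) + 1) ^ k)\<^sup>2 * exp (- E) \<le> exp (6 * real k * ln (real n)) * exp (- E)"
    by (rule mult_right_mono) simp
  also have "\<dots> = exp (6 * real k * ln (real n) - E)" by (simp add: exp_diff exp_minus divide_inverse)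
  also have "\<dots> \<le> exp (- 2 * ln (real n))"
  proof -
    have "1 * ln (real n) \<le> real k * ln (real n)" using k(1) l by (intro mult_right_mono) auto
    then show ?thesis using le by simp
  qed
  also have "\<dots> = 1 / (real n)\<^sup>2"
    using n0 exp_of_nat_mult[of 2 "- ln (real n)"] by (simp add: exp_minus power_inverse inverse_eq_divide power_one_over)
  finally show ?thesis by simp
qed

text \<open>\<open>L\<close> is the square root of the target rate. The hypothesis
  \<open>3 \<le> n\<close> gives \<open>1 \<le> ln n\<close>, and
  \<open>2 * \<alpha> \<le> 1\<close> keeps \<open>L\<^sup>2\<close> above the net resolution
  \<open>1 / n\<close>.\<close>

lemma rate_facts:
  fixes \<alpha> :: real and n :: nat
  assumes n: "3 \<le> n" and \<alpha>: "0 < \<alpha>" "\<alpha> \<le> 1 / 2"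
  defines "L \<equiv> sqrt (ln (real n)) / real n powr \<alpha>"
  shows "L\<^sup>2 = ln (real n) / real n powr (2 * \<alpha>)" "0 < L" "1 / real n \<le> L\<^sup>2"
    "real n * L\<^sup>2 = real n powr (1 - 2 * \<alpha>) * ln (real n)"
proof -
  have n0: "0 < real n" using n by simp
  have "exp 1 \<le> real n" using exp_le n by linarith
  then have ln1: "1 \<le> ln (real n)" using n0 by (simp add: ln_ge_iff)
  show L2: "L\<^sup>2 = ln (real n) / real n powr (2 * \<alpha>)"
    using ln1 n0 by (simp add: L_def power_divide power2_eq_square powr_add[symmetric])
  show "0 < L" unfolding L_def using ln1 n0 n by (intro divide_pos_pos) auto
  have "real n powr (2 * \<alpha>) \<le> real n powr 1" using n \<alpha> by (intro powr_mono) auto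
  then have "1 / real n \<le> 1 / real n powr (2 * \<alpha>)" using n0 by (intro divide_left_mono) auto
  also have "\<dots> \<le> L\<^sup>2" unfolding L2 using ln1 by (intro divide_right_mono) auto
  finally show "1 / real n \<le> L\<^sup>2" .
  show "real n * L\<^sup>2 = real n powr (1 - 2 * \<alpha>) * ln (real n)"
    unfolding L2 using n0 by (simp add: powr_diff)
qed

lemma rate_tendsto_0: "0 < \<alpha> \<Longrightarrow> (\<lambda>n. sqrt (ln (real n)) / real n powr \<alpha>) \<longlonglongrightarrow> 0"
  by real_asymp

theorem theorem3p3:
  fixes \<phi> :: "nat \<Rightarrow> 'a::{real_inner,banach,second_countable_topology}"
    and N :: enat
    and \<mu> :: "'a measure"
    and M :: "'b measure"
    and X :: "nat \<Rightarrow> 'b \<Rightarrow> 'a"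
    and u :: 'a
    and d :: "nat \<Rightarrow> nat"
    and \<alpha> :: real
  defines "Z \<equiv> \<lambda>n. basis_span \<phi> (d n)"
  defines "Q \<equiv> \<lambda>n. spatial_quantile \<mu> (Z n) u"
  defines "Qhat \<equiv> \<lambda>n \<omega>. sample_quantile (Z n) u n (\<lambda>i. X i \<omega>)"
  defines "J \<equiv> \<lambda>n. hessian_operator \<mu> (Z n) (Q n)"
  assumes basis: "orthonormal_basis_seq \<phi> N"
    and mu: "prob_space \<mu>" "sets \<mu> = sets borel"
    and M: "prob_space M"
    and indep: "prob_space.indep_vars M (\<lambda>_. borel) X {1..}"
    and law: "\<And>i. 1 \<le> i \<Longrightarrow> distr M borel (X i) = \<mu>"
    and u: "norm u < 1"
    and d: "\<And>n. 1 \<le> d n \<and> enat (d n) \<le> N"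
    and nonatomic: "nonatomic \<mu>"
    and not_line: "\<And>x1 x2. \<not> (AE x in \<mu>. x \<in> line_through x1 x2)"
    and moment: "\<And>C. C > 0 \<Longrightarrow> \<forall>\<^sub>F n in sequentially.
        (SUP q\<in>{q \<in> Z n. norm q \<le> C}. inverse_second_moment \<mu> (Z n) q) < \<infinity>"
    and alpha: "0 < \<alpha>" "\<alpha> \<le> 1/2"
    and rate: "\<exists>c>0. (\<lambda>n. real (d n) / real n powr (1 - 2 * \<alpha>)) \<longlonglongrightarrow> c"
  shows "(\<forall>\<^sub>F n in sequentially. bij_betw (J n) (Z n) (Z n)) \<and>
    (\<exists>R. AE \<omega> in M.
       (\<forall>\<^sub>F n in sequentially.
          Qhat n \<omega> - Q n =
            - (1 / real n) *\<^sub>R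
                (\<Sum>i=1..n. inv_into (Z n) (J n) (spatial_score (Z n) u (Q n) (X i \<omega>)))
            + R n \<omega>) \<and>
       (\<lambda>n. norm (R n \<omega>)) \<in> O(\<lambda>n. ln (real n) / real n powr (2 * \<alpha>)))"
proof -
  interpret mu: prob_space \<mu> by (rule mu)
  interpret M: prob_space M by (rule M)
  note [measurable_cong] = mu(2)
  obtain r where r: "0 < r" "mu.prob {x \<in> space \<mu>. r < norm x} \<le> (1 - norm u) / 4"
    using mu.tail_small[of "(1 - norm u) / 4" norm] u by auto
  define C where "C = 4 * r / (1 - norm u) + 2"
  have C: "0 < C" using r u by (simp add: C_def add_pos_pos)
  obtain c where c: "0 < c" "(\<lambda>n. real (d n) / real n powr (1 - 2 * \<alpha>)) \<longlonglongrightarrow> c"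
    using rate by blast
  obtain n1 where n1: "\<And>n. n1 \<le> n \<Longrightarrow>
      (SUP q\<in>{q \<in> Z n. norm q \<le> 2 * C + r}. inverse_second_moment \<mu> (Z n) q) < \<infinity>"
    using moment[of "2 * C + r"] C r by (auto simp: eventually_sequentially)
  \<comment> \<open>The index is taken beyond \<open>n1\<close>, where the supremum is finite, and
    has a dimension that is eventually not undercut; its supremum then yields one \<open>B\<close>
    for all later models.\<close>
  obtain n0 where n0: "n1 \<le> n0" "\<forall>\<^sub>F n in sequentially. d n0 \<le> d n"
    using eventually_dimension_ge[OF c(2,1) alpha(2)] by blast
  define B where "B = enn2real (SUP q\<in>{q \<in> Z n0. norm q \<le> 2 * C + r}. inverse_second_moment \<mu> (Z n0) q)"
  have B0: "0 \<le> B" by (simp add: B_def)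
  interpret B0: basis_section \<phi> N "d n0" by unfold_locales (use basis d in auto)
  have B: "inverse_second_moment \<mu> (Z n0) q \<le> ennreal B" if "q \<in> Z n0" "norm q \<le> 2 * C + r" for q
    using n1[OF n0(1)] that unfolding B_def by (subst ennreal_enn2real) (auto intro!: SUP_upper)
  have model: "spatial_model \<phi> N (d n) \<mu> u B C r" if dn: "d n0 \<le> d n" for n
  proof (unfold_locales)
    fix q assume q: "q \<in> basis_span \<phi> (d n)" "norm q \<le> 2 * C + r"
    have "inverse_second_moment \<mu> (basis_span \<phi> (d n)) q \<le> inverse_second_moment \<mu> (Z n0) (B0.P q)"
      unfolding Z_def by (rule inverse_second_moment_antimono[OF basis dn]) (use d in auto)
    also have "\<dots> \<le> ennreal B"
      using B0.norm_P_le[of q] q by (intro B) (simp_all add: Z_def)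
    finally show "inverse_second_moment \<mu> (basis_span \<phi> (d n)) q \<le> ennreal B" .
  qed (use basis d mu u B0 r in \<open>auto simp: C_def\<close>)
  \<comment> \<open>A locale constant depending on \<open>B\<close>, \<open>C\<close> and
    \<open>r\<close> only, hence the same for every dimension.\<close>
  define ell where "ell = spatial_model.ell B C r"
  have ell: "0 < ell" unfolding ell_def by (rule spatial_model.ell_pos[OF model[of n0]]) simp
  define c1 where "c1 = c + 1"
  \<comment> \<open>Solves \<open>K / 4 - (B + 1 / 4) = 8 * c1\<close>, so that the exponent equals
    \<open>8 * c1 * n powr (1 - 2 * \<alpha>) * ln n\<close> and dominates
    \<open>8 * d n * ln n\<close>.\<close>
  define K where "K = 4 * (8 * c1 + (B + 1 / 4))"
  have KB: "K / 4 - (B + 1 / 4) = 8 * c1" by (simp add: K_def field_simps)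
  define K' where "K' = 6 * K + 4 + 4 * B"
  have K: "0 < K" "0 < K'" using c B0 by (auto simp: K_def K'_def c1_def)
  define L where "L n = sqrt (ln (real n)) / real n powr \<alpha>" for n
  define good where "good n \<longleftrightarrow> 3 \<le> n \<and> d n0 \<le> d n \<and> real (d n) \<le> c1 * real n powr (1 - 2 * \<alpha>)
      \<and> 2 * (n * d n) + 1 \<le> n ^ 3 \<and> L n \<le> 1 / 2 \<and> 12 * K' * L n \<le> ell" for n
  have good: "\<forall>\<^sub>F n in sequentially. good n"
  proof -
    have e1: "\<forall>\<^sub>F n in sequentially. real (d n) \<le> c1 * real n powr (1 - 2 * \<alpha>)"
    proof -
      have "\<forall>\<^sub>F n in sequentially. real (d n) / real n powr (1 - 2 * \<alpha>) < c1"
        using c(2) by (rule order_tendstoD) (simp add: c1_def)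
      moreover have "\<forall>\<^sub>F n in sequentially. (1::nat) \<le> n" by (rule eventually_ge_at_top)
      ultimately show ?thesis by eventually_elim (simp add: divide_less_eq)
    qed
    have e2: "\<forall>\<^sub>F n in sequentially. nat \<lceil>2 * c1 + 1\<rceil> + 3 \<le> n" by (rule eventually_ge_at_top)
    have e3: "\<forall>\<^sub>F n in sequentially. 2 * (n * d n) + 1 \<le> n ^ 3"
      using e1 e2
    proof eventually_elim
      case (elim n)
      have n: "2 * c1 + 1 \<le> real n" "1 \<le> real n" using elim(2) by linarith+
      have "c1 * real n powr (1 - 2 * \<alpha>) \<le> c1 * real n powr 1"
        using n alpha c by (intro mult_left_mono powr_mono) (auto simp: c1_def)
      then have "real (d n) \<le> c1 * real n" using elim(1) n by simp
      then have "real n * real (d n) \<le> real n * (c1 * real n)" by (intro mult_left_mono) auto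
      moreover have "1 \<le> real n * real n" using n mult_mono[of 1 "real n" 1 "real n"] by simp
      ultimately have "2 * (real n * real (d n)) + 1 \<le> (2 * c1 + 1) * (real n * real n)"
        by (simp add: algebra_simps)
      also have "\<dots> \<le> real n * (real n * real n)" using n by (intro mult_right_mono) auto
      finally have "real (2 * (n * d n) + 1) \<le> real (n ^ 3)" by (simp add: power3_eq_cube)
      then show ?case by (simp only: of_nat_le_iff)
    qed
    have L0: "L \<longlonglongrightarrow> 0" unfolding L_def by (rule rate_tendsto_0[OF alpha(1)])
    have e4: "\<forall>\<^sub>F n in sequentially. L n < 1 / 2" using L0 by (rule order_tendstoD) simp
    have e5: "\<forall>\<^sub>F n in sequentially. L n < ell / (12 * K')" using L0 by (rule order_tendstoD) (use K ell in simp)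
    show ?thesis
      using n0(2) e1 e2 e3 e4 e5
    proof eventually_elim
      case (elim n)
      have "12 * K' * L n \<le> ell" using elim(6) K by (simp add: field_simps)
      then show ?case using elim by (simp add: good_def)
    qed
  qed
  define D where "D = 6 * K' / ell"
  define K2 where "K2 = (K' * (D + 1) + (2 + 2 * B + K' * (2 * D + 3)) + 4 * B * D\<^sup>2) / ell"
  \<comment> \<open>The representation holds identically by this choice; only the order of
    \<open>R\<close> remains to be shown.\<close>
  define R where "R n \<omega> = Qhat n \<omega> - Q n
      + (1 / real n) *\<^sub>R (\<Sum>i=1..n. inv_into (Z n) (J n) (spatial_score (Z n) u (Q n) (X i \<omega>)))" for n \<omega>
  \<comment> \<open>Indices that are not good receive the empty set, so the probability bound holds
    for every \<open>n\<close>, including \<open>n = 0\<close>, where its right-hand side is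
    0.\<close>
  have "\<exists>bad. bad \<in> sets M \<and> M.prob bad \<le> 6 / (real n)\<^sup>2 \<and>
      (good n \<longrightarrow> (\<forall>\<omega>\<in>space M - bad. norm (R n \<omega>) \<le> K2 * (L n)\<^sup>2))" for n
  proof (cases "good n")
    case True
    then have g: "3 \<le> n" "d n0 \<le> d n" "real (d n) \<le> c1 * real n powr (1 - 2 * \<alpha>)"
      "2 * (n * d n) + 1 \<le> n ^ 3" "L n \<le> 1 / 2" "12 * K' * L n \<le> ell" by (auto simp: good_def)
    interpret S: spatial_model \<phi> N "d n" \<mu> u B C r by (rule model[OF g(2)])
    note rf = rate_facts[OF g(1) alpha, folded L_def]
    have indn: "M.indep_vars (\<lambda>_. borel) X {1..n}" using indep by (rule M.indep_vars_subset) auto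
    obtain bad where bad: "bad \<in> sets M"
      "M.prob bad \<le> 6 * (real (2 * (n * d n) + 1) ^ d n)\<^sup>2 * exp (- (real n * (L n)\<^sup>2 * (K / 4 - (B + 1 / 4))))"
      "\<And>\<omega>. \<omega> \<in> space M - bad \<Longrightarrow> norm (S.Gn n (\<lambda>i. X i \<omega>) S.Q0 - S.G S.Q0) \<le> K' * L n"
      "\<And>\<omega> q. \<omega> \<in> space M - bad \<Longrightarrow> q \<in> S.Z \<Longrightarrow> norm (q - S.Q0) \<le> 1 \<Longrightarrow>
        norm ((S.Gn n (\<lambda>i. X i \<omega>) q - S.G q) - (S.Gn n (\<lambda>i. X i \<omega>) S.Q0 - S.G S.Q0))
          \<le> K' * (norm (q - S.Q0) * L n + (L n)\<^sup>2)"
      using S.uniform_deviation[OF M indn, of "L n" K] law d[of n] g(1,5) rf K(1) unfolding K'_def by auto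
    have "M.prob bad \<le> 6 / (real n)\<^sup>2"
    proof (rule order_trans[OF bad(2)], rule net_cardinality_bound[OF g(1) _ g(4)])
      have "8 * real (d n) * ln (real n) \<le> 8 * (c1 * real n powr (1 - 2 * \<alpha>)) * ln (real n)"
        using g(1,3) by (intro mult_right_mono) auto
      also have "\<dots> = real n * (L n)\<^sup>2 * (K / 4 - (B + 1 / 4))" unfolding rf(4) KB by simp
      finally show "8 * real (d n) * ln (real n) \<le> real n * (L n)\<^sup>2 * (K / 4 - (B + 1 / 4))" .
    qed (use d in simp)
    moreover have "norm (R n \<omega>) \<le> K2 * (L n)\<^sup>2" if "\<omega> \<in> space M - bad" for \<omega>
    proof -
      have "norm (S.remainder n (\<lambda>i. X i \<omega>)) \<le> K2 * (L n)\<^sup>2"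
        unfolding K2_def D_def ell_def
        by (rule S.remainder_bound) (use g rf K bad(3,4)[OF that] in \<open>auto simp: ell_def\<close>)
      then show ?thesis
        by (simp add: S.remainder_def R_def Qhat_def Q_def Z_def J_def)
    qed
    ultimately show ?thesis using bad(1) by blast
  qed (auto intro!: exI[of _ "{}"])
  then obtain bad where bad: "\<And>n. bad n \<in> sets M" "\<And>n. M.prob (bad n) \<le> 6 / (real n)\<^sup>2"
    "\<And>n \<omega>. good n \<Longrightarrow> \<omega> \<in> space M - bad n \<Longrightarrow> norm (R n \<omega>) \<le> K2 * (L n)\<^sup>2" by metis
  have "summable (\<lambda>n. 6 * inverse ((real n)\<^sup>2))"
    by (intro summable_mult inverse_power_summable) simp
  then have sum: "summable (\<lambda>n. M.prob (bad n))"
    by (rule summable_comparison_test') (use bad(2) in \<open>simp add: divide_inverse\<close>)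
  have ae: "AE \<omega> in M. \<forall>\<^sub>F n in sequentially. \<omega> \<in> space M - bad n"
    by (rule borel_cantelli_AE1[OF bad(1) _ sum]) (simp add: M.emeasure_eq_measure)
  have main: "AE \<omega> in M. (\<lambda>n. norm (R n \<omega>)) \<in> O(\<lambda>n. ln (real n) / real n powr (2 * \<alpha>))"
    using ae
  proof eventually_elim
    case (elim \<omega>)
    show ?case
    proof (rule bigoI[where c=K2])
      show "\<forall>\<^sub>F n in sequentially. norm (norm (R n \<omega>)) \<le> K2 * norm (ln (real n) / real n powr (2 * \<alpha>))"
        using elim good
      proof eventually_elim
        case (elim n)
        then have n: "3 \<le> n" by (simp add: good_def)
        have "norm (R n \<omega>) \<le> K2 * (L n)\<^sup>2" using bad(3) elim by blast
        then show ?case unfolding rate_facts(1)[OF n alpha, folded L_def] using n by simp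
      qed
    qed
  qed
  have eq: "Qhat n \<omega> - Q n = - (1 / real n) *\<^sub>R
      (\<Sum>i=1..n. inv_into (Z n) (J n) (spatial_score (Z n) u (Q n) (X i \<omega>))) + R n \<omega>" for n \<omega>
    by (simp add: R_def)
  have bij: "\<forall>\<^sub>F n in sequentially. bij_betw (J n) (Z n) (Z n)"
    using n0(2)
  proof eventually_elim
    case (elim n)
    interpret S: spatial_model \<phi> N "d n" \<mu> u B C r by (rule model[OF elim])
    show ?case unfolding J_def Q_def Z_def by (rule S.bij_betw_hessian_operator)
  qed
  have "AE \<omega> in M. (\<forall>\<^sub>F n in sequentially. Qhat n \<omega> - Q n = - (1 / real n) *\<^sub>R
        (\<Sum>i=1..n. inv_into (Z n) (J n) (spatial_score (Z n) u (Q n) (X i \<omega>))) + R n \<omega>) \<and>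
      (\<lambda>n. norm (R n \<omega>)) \<in> O(\<lambda>n. ln (real n) / real n powr (2 * \<alpha>))"
    using main by eventually_elim (use eq in auto)
  then show ?thesis using bij by blast
qed

end
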